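(* For any finite, connected simplicial complex $K$ there exists a vertex-transitive, finite simplicial complex $\widetilde{K}$ with a homotopy equivalence $$\widetilde{K}\simeq \textstyle\bigvee^n K\vee\bigvee^l S^1$$ for some $n\geq 1$, $l\geq 0$ (a wedge of $n$ copies of $K$ and $l$ copies of the circle). Furthermore, one can require $\widetilde{K}$ to satisfy (in addition) any one of the following conditions: (i) $\mathrm{Aut}(\widetilde{K})$ has a cyclic subgroup whose action on the vertices of $\widetilde{K}$ is transitive; (ii) $\widetilde{K}$ is the clique complex of a Cayley graph of some finite group; (iii) $\widetilde{K}$ is simultaneously vertex-transitive and facet-transitive.
   Context: A simplicial complex $X$ is vertex-transitive if $\mathrm{Aut}(X)$ acts transitively on its vertex set. It is facet-transitive if the induced action of $\mathrm{Aut}(X)$ on the set of facets (maximal faces) is transitive. The clique complex $\mathrm{Cl}(G)$ of a simple graph $G$ is the simplicial complex on $V(G)$ whose faces are the vertex sets of the cliques (complete subgraphs) of $G$. *)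

theory Defs
  imports "HOL-Analysis.Analysis" "HOL-Algebra.Group"
begin

definition simplicial_complex :: "'a set set \<Rightarrow> bool" where
  "simplicial_complex X \<longleftrightarrow> (\<forall>F\<in>X. finite F) \<and> (\<forall>F\<in>X. \<forall>G. G \<subseteq> F \<longrightarrow> G \<in> X)"

definition finite_simplicial_complex :: "'a set set \<Rightarrow> bool" where
  "finite_simplicial_complex X \<longleftrightarrow> simplicial_complex X \<and> finite X"

definition vertices :: "'a set set \<Rightarrow> 'a set" where
  "vertices X = \<Union>X"

definition facets :: "'a set set \<Rightarrow> 'a set set" where
  "facets X = {F \<in> X. \<forall>G\<in>X. F \<subseteq> G \<longrightarrow> G = F}"

definition automorphisms :: "'a set set \<Rightarrow> ('a \<Rightarrow> 'a) set" where
  "automorphisms X = {\<sigma>. bij_betw \<sigma> (vertices X) (vertices X)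
      \<and> (\<forall>x. x \<notin> vertices X \<longrightarrow> \<sigma> x = x)
      \<and> (\<forall>F. F \<subseteq> vertices X \<longrightarrow> (\<sigma> ` F \<in> X \<longleftrightarrow> F \<in> X))}"

definition vertex_transitive :: "'a set set \<Rightarrow> bool" where
  "vertex_transitive X \<longleftrightarrow>
     (\<forall>u\<in>vertices X. \<forall>w\<in>vertices X. \<exists>\<sigma>\<in>automorphisms X. \<sigma> u = w)"

definition facet_transitive :: "'a set set \<Rightarrow> bool" where
  "facet_transitive X \<longleftrightarrow>
     (\<forall>F\<in>facets X. \<forall>G\<in>facets X. \<exists>\<sigma>\<in>automorphisms X. \<sigma> ` F = G)"

text \<open>Aut(X) has a cyclic subgroup acting transitively on the vertices: some automorphism
  whose powers (= the cyclic subgroup it generates, Aut(X) being finite) act transitively.\<close>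

definition cyclic_vertex_transitive :: "'a set set \<Rightarrow> bool" where
  "cyclic_vertex_transitive X \<longleftrightarrow>
     (\<exists>\<sigma>\<in>automorphisms X. \<forall>u\<in>vertices X. \<forall>w\<in>vertices X. \<exists>k::nat. (\<sigma> ^^ k) u = w)"

definition clique_complex :: "'a set \<Rightarrow> ('a \<Rightarrow> 'a \<Rightarrow> bool) \<Rightarrow> 'a set set" where
  "clique_complex V adj = {F. finite F \<and> F \<subseteq> V \<and> (\<forall>x\<in>F. \<forall>y\<in>F. x \<noteq> y \<longrightarrow> adj x y)}"

text \<open>Cayley graph Cay(G,S) of a finite group G with connection set S
  (S \<subseteq> G, 1 \<notin> S, S = S^{-1}): g adjacent to h iff g^{-1} h \<in> S.
  Any finite group is isomorphic to one whose carrier is a set of naturals.\<close>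

definition is_cayley_clique_complex :: "nat set set \<Rightarrow> bool" where
  "is_cayley_clique_complex X \<longleftrightarrow>
     (\<exists>(G :: nat monoid) S. group G \<and> finite (carrier G) \<and> S \<subseteq> carrier G
        \<and> \<one>\<^bsub>G\<^esub> \<notin> S \<and> (\<forall>s\<in>S. inv\<^bsub>G\<^esub> s \<in> S)
        \<and> X = clique_complex (carrier G) (\<lambda>g h. inv\<^bsub>G\<^esub> g \<otimes>\<^bsub>G\<^esub> h \<in> S))"

text \<open>Geometric realization: barycentric-coordinate functions supported on a face,
  as a subspace of the product topology on 'a \<Rightarrow> real.\<close>

definition geometric_realization :: "'a set set \<Rightarrow> ('a \<Rightarrow> real) set" where
  "geometric_realization X =
     {f. (\<forall>x. 0 \<le> f x) \<and> {x. f x \<noteq> 0} \<in> X \<and> sum f {x. f x \<noteq> 0} = 1}"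

definition realization_top :: "'a set set \<Rightarrow> ('a \<Rightarrow> real) topology" where
  "realization_top X = subtopology euclidean (geometric_realization X)"

definition connected_complex :: "'a set set \<Rightarrow> bool" where
  "connected_complex X \<longleftrightarrow> vertices X \<noteq> {} \<and> connected_space (realization_top X)"

text \<open>The wedge of n copies of K and l circles (boundaries of triangles), as a simplicial
  complex: all pieces glued at the single vertex None, which is the base vertex v of each
  copy of K.\<close>

definition wedge_emb :: "'a \<Rightarrow> nat \<Rightarrow> 'a \<Rightarrow> ('a \<times> nat + nat \<times> bool) option" where
  "wedge_emb v i x = (if x = v then None else Some (Inl (x, i)))"

definition wedge_complex ::
    "'a set set \<Rightarrow> 'a \<Rightarrow> nat \<Rightarrow> nat \<Rightarrow> ('a \<times> nat + nat \<times> bool) option set set" where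
  "wedge_complex K v n l =
     (\<Union>i<n. (\<lambda>F. wedge_emb v i ` F) ` K)
     \<union> (\<Union>j<l. {F. F \<subseteq> {None, Some (Inr (j, False)), Some (Inr (j, True))} \<and> card F \<le> 2})"

end

(* Place finitely many copies of K in a finite group, as translates of a generic (Sidon-like) embedding
   of the vertices. Two copies then share at most one vertex, so their union is a graph of copies of K
   and has the homotopy type of a wedge of copies of K and circles, while left translations act
   transitively on the vertices. For (i) the group is cyclic. For (ii) K is first subdivided to a flag
   complex and the group is a finite quotient of (the even part of) a free product of groups of order
   two, in which short words remain distinct: in an abelian group the Cayley graph would also contain
   the reflected triangles. For (iii) one facet of each type, taken from different copies, are combined
   to one large simplex; its translates are the facets, and joining pairwise disjoint simplices only
   adds circles.

   Homotopy equivalences between complexes are produced by elementary collapses only, organised by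
   acyclic matchings. *)

theory Submission
  imports Defs
begin

section \<open>Collapses of geometric realizations\<close>

text \<open>A wedge identifies base vertices, which is no collapse. All comparisons therefore meet
  in \<open>wedge_form\<close>, where disjoint copies are tied to a common hub by edges and
  triangles sit at the hub: there a copy can be collapsed or expanded on its own, and the end of an
  edge can be slid along a connected copy. A union of copies gets there through the mapping cylinder
  of the map from the disjoint copies. Collapsing it onto copies joined to hubs by edges requires
  two vertices to determine the copy; this is what the Sidon property is for. The group of (ii) and
  (iii) is concrete: each letter acts as an involution on the finite set of reduced words of length
  at most \<open>d\<close>, and a reduced word applied to the empty word spells itself. The value
  \<open>d = 4\<close> comes from the longest words compared: two edges of a triangle in the Cayley
  graph, or a passage between two large simplices through a common vertex.\<close>

definition heq :: "'a set set \<Rightarrow> 'b set set \<Rightarrow> bool" (infix "\<sim>" 50) where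
  "X \<sim> Y \<longleftrightarrow> realization_top X homotopy_equivalent_space realization_top Y"

lemma heq_refl: "X \<sim> X"
  by (simp add: heq_def homotopy_equivalent_space_refl)

lemma heq_sym: "X \<sim> Y \<Longrightarrow> Y \<sim> X"
  unfolding heq_def using homotopy_equivalent_space_sym by blast

lemma heq_trans [trans]: "X \<sim> Y \<Longrightarrow> Y \<sim> Z \<Longrightarrow> X \<sim> Z"
  unfolding heq_def by (rule homotopy_eqv_trans)

lemma simplicial_complex_subset: "simplicial_complex X \<Longrightarrow> F \<in> X \<Longrightarrow> G \<subseteq> F \<Longrightarrow> G \<in> X"
  unfolding simplicial_complex_def by blast

lemma realization_sum:
  assumes "f \<in> geometric_realization X" "finite A" "{x. f x \<noteq> 0} \<subseteq> A"
  shows "sum f A = 1"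
proof -
  have "sum f A = sum f {x. f x \<noteq> 0}"
    using assms by (intro sum.mono_neutral_right) auto
  then show ?thesis using assms by (simp add: geometric_realization_def)
qed

lemma realizationI:
  assumes "\<And>x. 0 \<le> f x" "{x. f x \<noteq> 0} \<in> X" "finite A" "{x. f x \<noteq> 0} \<subseteq> A" "sum f A = 1"
  shows "f \<in> geometric_realization X"
proof -
  have "sum f A = sum f {x. f x \<noteq> 0}"
    using assms by (intro sum.mono_neutral_right) auto
  then show ?thesis using assms by (simp add: geometric_realization_def)
qed

lemma continuous_on_Min_image:
  fixes g :: "'v \<Rightarrow> 'b::topological_space \<Rightarrow> real"
  assumes "finite T" "T \<noteq> {}" "\<And>v. v \<in> T \<Longrightarrow> continuous_on S (g v)"
  shows "continuous_on S (\<lambda>x. Min ((\<lambda>v. g v x) ` T))"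
  using assms
proof (induction T rule: finite_ne_induct)
  case (insert v T)
  then have "continuous_on S (\<lambda>x. min (g v x) (Min ((\<lambda>v. g v x) ` T)))"
    by (intro continuous_on_min) auto
  with insert show ?case by simp
qed simp

text \<open>The homotopy moves the mass that a point has on all of \<open>\<tau>\<close> simultaneously to \<open>w\<close>; for a
  free face \<open>\<tau>\<close> of \<open>insert w \<tau>\<close> this is an elementary collapse, for a single vertex \<open>\<tau>\<close> it is
  the removal of a dominated vertex.\<close>

lemma collapse_star:
  assumes X: "simplicial_complex X" and fin: "finite \<tau>" "\<tau> \<noteq> {}" and w: "w \<notin> \<tau>"
    and ins: "\<And>G. G \<in> X \<Longrightarrow> \<tau> \<subseteq> G \<Longrightarrow> insert w G \<in> X"
  shows "X \<sim> {G \<in> X. \<not> \<tau> \<subseteq> G}"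
proof -
  let ?Y = "{G \<in> X. \<not> \<tau> \<subseteq> G}"
  \<comment> \<open>\<open>m f\<close> is the largest amount that can be taken from all vertices of
    \<open>\<tau>\<close> at once. The direction \<open>c\<close> takes one unit from each of them
    and gives all of it to \<open>w\<close>, so the total mass is unchanged, and
    \<open>h 1 f\<close> vanishes at some vertex of \<open>\<tau>\<close>.\<close>
  define m where "m f = Min (f ` \<tau>)" for f :: "'a \<Rightarrow> real"
  define c where "c x = (if x = w then real (card \<tau>) else if x \<in> \<tau> then - 1 else 0)" for x
  define h where "h s f = (\<lambda>x. f x + s * m f * c x)" for s :: real and f :: "'a \<Rightarrow> real"
  have YX: "geometric_realization ?Y \<subseteq> geometric_realization X"
    by (auto simp: geometric_realization_def)
  have m_le: "m f \<le> f x" if "x \<in> \<tau>" for f x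
    unfolding m_def using that fin by auto
  have m_attained: "\<exists>x\<in>\<tau>. f x = m f" for f
  proof -
    have "m f \<in> f ` \<tau>" unfolding m_def using fin by (intro Min_in) auto
    then show ?thesis by auto
  qed
  have m_nn: "0 \<le> m f" if "f \<in> geometric_realization X" for f
    using m_attained[of f] that unfolding geometric_realization_def by (metis (mono_tags, lifting) mem_Collect_eq)
  have m_zero: "m f = 0" if "f \<in> geometric_realization X" "\<not> \<tau> \<subseteq> {x. f x \<noteq> 0}" for f
    using m_le[of _ f] m_nn[of f] that by fastforce
  \<comment> \<open>Joint continuity on the whole function space; the homotopy and its end map
    \<open>h 1\<close> are restrictions.\<close>
  have ch: "continuous_on UNIV (\<lambda>p. h (fst p) (snd p))"
    unfolding h_def m_def
    by (intro continuous_intros continuous_on_coordinatewise_then_product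
          continuous_on_Min_image fin continuous_on_product_then_coordinatewise continuous_on_snd)
  have supp: "{x. h s f x \<noteq> 0} \<in> X \<and> {x. h s f x \<noteq> 0} \<subseteq> insert w {x. f x \<noteq> 0}"
    if f: "f \<in> geometric_realization X" for s f
  proof (cases "m f = 0")
    case True
    then show ?thesis using f by (auto simp: h_def geometric_realization_def)
  next
    case False
    then have sub: "\<tau> \<subseteq> {x. f x \<noteq> 0}" using m_zero f by blast
    have "insert w {x. f x \<noteq> 0} \<in> X"
      using f sub by (intro ins) (auto simp: geometric_realization_def)
    moreover have "{x. h s f x \<noteq> 0} \<subseteq> insert w {x. f x \<noteq> 0}"
      using sub by (auto simp: h_def c_def split: if_splits)
    ultimately show ?thesis using X by (auto simp: simplicial_complex_def)
  qed
  have csum: "sum c A = 0" if "finite A" "insert w \<tau> \<subseteq> A" for A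
  proof -
    have "sum c A = sum c (insert w \<tau>)"
      using that by (intro sum.mono_neutral_right) (auto simp: c_def)
    also have "\<dots> = real (card \<tau>) + sum c \<tau>" using fin w by (simp add: c_def)
    also have "sum c \<tau> = sum (\<lambda>_. - 1) \<tau>" using w by (intro sum.cong) (auto simp: c_def)
    finally show ?thesis by simp
  qed
  have hX: "h s f \<in> geometric_realization X"
    if f: "f \<in> geometric_realization X" and s: "0 \<le> s" "s \<le> 1" for s f
  proof (rule realizationI[where A = "{x. f x \<noteq> 0} \<union> insert w \<tau>"])
    have fin': "finite {x. f x \<noteq> 0}"
      using f X by (auto simp: geometric_realization_def simplicial_complex_def)
    have "s * m f \<le> f x" if "x \<in> \<tau>" for x
    proof -
      have "s * m f \<le> 1 * m f" using s m_nn[OF f] by (intro mult_right_mono) auto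
      also have "\<dots> \<le> f x" using m_le[OF that] by simp
      finally show ?thesis .
    qed
    then show "0 \<le> h s f x" for x
      using f s m_nn[OF f] by (auto simp: h_def c_def geometric_realization_def)
    show "finite ({x. f x \<noteq> 0} \<union> insert w \<tau>)" using fin' fin by simp
    define A where "A = {x. f x \<noteq> 0} \<union> insert w \<tau>"
    have A: "finite A" "{x. f x \<noteq> 0} \<subseteq> A" "insert w \<tau> \<subseteq> A"
      using fin' fin by (auto simp: A_def)
    have "sum (h s f) A = sum f A + s * m f * sum c A"
      by (simp add: h_def sum.distrib sum_distrib_left)
    then show "sum (h s f) ({x. f x \<noteq> 0} \<union> insert w \<tau>) = 1"
      using realization_sum[OF f A(1,2)] csum[OF A(1,3)] by (simp add: A_def)
  qed (use supp[OF f] in auto)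
  have h1Y: "h 1 f \<in> geometric_realization ?Y" if f: "f \<in> geometric_realization X" for f
  proof -
    obtain x where "x \<in> \<tau>" "f x = m f" using m_attained by blast
    then have "h 1 f x = 0" using w by (auto simp: h_def c_def)
    then have "\<not> \<tau> \<subseteq> {x. h 1 f x \<noteq> 0}" using \<open>x \<in> \<tau>\<close> by auto
    then show ?thesis using hX[OF f, of 1] by (auto simp: geometric_realization_def)
  qed
  have h_fix: "h s f = f" if "f \<in> geometric_realization ?Y" for s f
  proof -
    have "m f = 0" using that YX by (intro m_zero) (auto simp: geometric_realization_def)
    then show ?thesis by (simp add: h_def)
  qed
  have cont1: "continuous_on UNIV (h 1)"
    by (rule continuous_on_compose2[OF ch, of UNIV "\<lambda>f. (1, f)", simplified])
       (auto intro!: continuous_intros)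
  have c1: "continuous_map (realization_top X) (realization_top ?Y) (h 1)"
    unfolding realization_top_def
    using h1Y continuous_on_subset[OF cont1] by (auto simp: image_subset_iff)
  have c2: "continuous_map (realization_top ?Y) (realization_top X) id"
    unfolding realization_top_def using YX by auto
  have "homotopic_with (\<lambda>_. True) (realization_top X) (realization_top X) id (h 1)"
    unfolding homotopic_with_def
  proof (intro exI conjI)
    show "continuous_map (prod_topology (top_of_set {0..1}) (realization_top X)) (realization_top X)
        (\<lambda>p. h (fst p) (snd p))"
      unfolding realization_top_def prod_topology_subtopology(1)[symmetric]
      using continuous_on_subset[OF ch] hX
      by (auto simp: prod_topology_subtopology subtopology_subtopology euclidean_product_topology)
  qed (auto simp: h_def)
  then have "homotopic_with (\<lambda>_. True) (realization_top X) (realization_top X) (id \<circ> h 1) id"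
    using homotopic_with_sym by fastforce
  moreover have "homotopic_with (\<lambda>_. True) (realization_top ?Y) (realization_top ?Y) (h 1 \<circ> id) id"
  proof (rule homotopic_with_equal)
    show "continuous_map (realization_top ?Y) (realization_top ?Y) (h 1 \<circ> id)"
      using continuous_map_compose[OF c2 c1] .
  qed (auto simp: realization_top_def h_fix)
  ultimately show ?thesis
    unfolding heq_def homotopy_equivalent_space_def using c1 c2 by blast
qed

lemma simplicial_complex_image:
  assumes "simplicial_complex X"
  shows "simplicial_complex ((`) g ` X)"
  unfolding simplicial_complex_def
proof (intro conjI ballI allI impI)
  fix F assume "F \<in> (`) g ` X"
  then obtain D where D: "D \<in> X" "F = g ` D" by auto
  show "finite F" using D assms by (auto simp: simplicial_complex_def)
  fix G assume "G \<subseteq> F"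
  then obtain E where "E \<subseteq> D" "G = g ` E" using D by (meson subset_imageE)
  then show "G \<in> (`) g ` X" using D assms by (auto simp: simplicial_complex_def)
qed

lemma heq_image:
  assumes X: "simplicial_complex X" and inj: "inj_on g (\<Union>X)"
  shows "X \<sim> (`) g ` X"
proof -
  let ?V = "\<Union>X"
  let ?Y = "(`) g ` X"
  define i where "i = the_inv_into ?V g"
  \<comment> \<open>Extension by zero outside the vertex set makes \<open>A\<close> and
    \<open>B\<close> continuous on all functions, coordinate by coordinate.\<close>
  define A where "A f = (\<lambda>y. if y \<in> g ` ?V then f (i y) else (0::real))" for f
  define B where "B f = (\<lambda>x. if x \<in> ?V then f (g x) else (0::real))" for f
  have ig: "i (g x) = x" if "x \<in> ?V" for x
    unfolding i_def using the_inv_into_f_f[OF inj that] .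
  have Y: "simplicial_complex ?Y" by (rule simplicial_complex_image[OF X])
  have AB: "A (B f) = f" if "f \<in> geometric_realization ?Y" for f
  proof
    fix y
    have "{y. f y \<noteq> 0} \<in> (`) g ` X" using that by (simp add: geometric_realization_def)
    then have "{y. f y \<noteq> 0} \<subseteq> g ` ?V" by (elim imageE) (simp only:, blast)
    show "A (B f) y = f y"
    proof (cases "y \<in> g ` ?V")
      case True
      then obtain x where "x \<in> ?V" "y = g x" by (rule imageE)
      then show ?thesis using True by (simp add: A_def B_def ig)
    next
      case False
      then have "f y = 0" using \<open>{y. f y \<noteq> 0} \<subseteq> g ` ?V\<close> by blast
      then show ?thesis using False by (simp add: A_def)
    qed
  qed
  have BA: "B (A f) = f" if "f \<in> geometric_realization X" for f
  proof
    fix x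
    have "{y. f y \<noteq> 0} \<subseteq> ?V" using that by (auto simp: geometric_realization_def)
    then show "B (A f) x = f x" by (auto simp: A_def B_def ig)
  qed
  have Amap: "A f \<in> geometric_realization ?Y" if f: "f \<in> geometric_realization X" for f
  proof -
    let ?S = "{x. f x \<noteq> 0}"
    have S: "?S \<in> X" "?S \<subseteq> ?V" "finite ?S"
      using f X by (auto simp: geometric_realization_def simplicial_complex_def)
    have Ag: "A f (g x) = f x" if "x \<in> ?V" for x
      using that ig[OF that] by (simp add: A_def)
    have supp: "{y. A f y \<noteq> 0} = g ` ?S"
    proof -
      have Ay: "A f y \<noteq> 0 \<Longrightarrow> y \<in> g ` ?V" for y by (simp add: A_def split: if_splits)
      show ?thesis
      proof (intro equalityI subsetI)
        fix y assume y: "y \<in> {y. A f y \<noteq> 0}"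
        then obtain x where "x \<in> ?V" "y = g x" using Ay[of y] by blast
        then show "y \<in> g ` ?S" using y Ag[of x] by simp
      next
        fix y assume "y \<in> g ` ?S"
        then obtain x where "x \<in> ?S" "y = g x" by (rule imageE)
        then show "y \<in> {y. A f y \<noteq> 0}" using Ag[OF subsetD[OF S(2)]] by simp
      qed
    qed
    have "sum (A f) (g ` ?S) = sum (A f \<circ> g) ?S"
      using inj_on_subset[OF inj S(2)] by (rule sum.reindex)
    also have "\<dots> = sum f ?S" using Ag[OF subsetD[OF S(2)]] by (intro sum.cong) auto
    finally have "sum (A f) (g ` ?S) = 1" using f by (simp add: geometric_realization_def)
    then show ?thesis using f S supp by (auto simp: geometric_realization_def A_def)
  qed
  have Bmap: "B f \<in> geometric_realization X" if f: "f \<in> geometric_realization ?Y" for f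
  proof -
    obtain D where D: "D \<in> X" "{y. f y \<noteq> 0} = g ` D"
      using f by (auto simp: geometric_realization_def)
    have DV: "D \<subseteq> ?V" using D by auto
    have supp: "{x. B f x \<noteq> 0} = D"
    proof (intro equalityI subsetI)
      fix x assume "x \<in> {x. B f x \<noteq> 0}"
      then have "x \<in> ?V" "g x \<in> g ` D" using D(2) by (auto simp: B_def split: if_splits)
      then show "x \<in> D" using inj_on_image_mem_iff[OF inj _ DV] by blast
    next
      fix x assume "x \<in> D"
      then show "x \<in> {x. B f x \<noteq> 0}" using D DV by (auto simp: B_def)
    qed
    have "sum f (g ` D) = sum (f \<circ> g) D"
      using inj_on_subset[OF inj DV] by (rule sum.reindex)
    also have "\<dots> = sum (B f) D" using DV by (intro sum.cong) (auto simp: B_def)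
    finally have "sum (B f) D = 1" using f D by (simp add: geometric_realization_def)
    then show ?thesis using f D supp by (auto simp: geometric_realization_def B_def)
  qed
  have contA: "continuous_on UNIV A"
    unfolding A_def
  proof (rule continuous_on_coordinatewise_then_product)
    show "continuous_on UNIV (\<lambda>f. if y \<in> g ` ?V then f (i y) else (0::real))" for y
      by (cases "y \<in> g ` ?V") (simp_all only: if_True if_False continuous_on_const continuous_on_product_coordinates)
  qed
  have contB: "continuous_on UNIV B"
    unfolding B_def
  proof (rule continuous_on_coordinatewise_then_product)
    show "continuous_on UNIV (\<lambda>f. if y \<in> ?V then f (g y) else (0::real))" for y
      by (cases "y \<in> ?V") (simp_all only: if_True if_False continuous_on_const continuous_on_product_coordinates)
  qed
  have "homeomorphic_maps (realization_top X) (realization_top ?Y) A B"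
    unfolding homeomorphic_maps_def realization_top_def
    using continuous_on_subset[OF contA] continuous_on_subset[OF contB] Amap Bmap AB BA
    by (auto simp: image_subset_iff)
  then show ?thesis
    unfolding heq_def
    using homeomorphic_imp_homotopy_equivalent_space homeomorphic_space_def by blast
qed

section \<open>Connected realizations and paths of edges\<close>

definition edge_rel :: "'a set set \<Rightarrow> ('a \<times> 'a) set" where
  "edge_rel X = {(a, b). {a, b} \<in> X}"

definition edge_connected :: "'a set set \<Rightarrow> bool" where
  "edge_connected X \<longleftrightarrow> (\<forall>a\<in>\<Union>X. \<forall>b\<in>\<Union>X. (a, b) \<in> (edge_rel X)\<^sup>*)"

text \<open>The support of a point is a face, hence lies inside or outside the edge component of
  \<open>a\<close>. The mass on that component is thus a continuous function with values 0 and 1,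
  constant on a connected space, and it is compared at the two vertices.\<close>

lemma connected_complex_imp_edge_connected:
  assumes X: "finite_simplicial_complex X" and con: "connected_complex X"
  shows "edge_connected X"
  unfolding edge_connected_def
proof (intro ballI)
  fix a b assume a: "a \<in> \<Union>X" and b: "b \<in> \<Union>X"
  have sX: "simplicial_complex X" using X by (simp add: finite_simplicial_complex_def)
  have finV: "finite (\<Union>X)"
    using X by (auto simp: finite_simplicial_complex_def simplicial_complex_def)
  define A where "A = {x \<in> \<Union>X. (a, x) \<in> (edge_rel X)\<^sup>*}"
  define g where "g f = sum f A" for f :: "'a \<Rightarrow> real"
  have finA: "finite A" using finV by (rule rev_finite_subset) (auto simp: A_def)
  have range: "g f = 0 \<or> g f = 1" if f: "f \<in> geometric_realization X" for f
  proof (cases "\<exists>x\<in>A. f x \<noteq> 0")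
    case True
    then obtain x where x: "x \<in> A" "f x \<noteq> 0" by blast
    have S: "{x. f x \<noteq> 0} \<in> X" using f by (simp add: geometric_realization_def)
    have "{x. f x \<noteq> 0} \<subseteq> A"
    proof
      fix y assume y: "y \<in> {x. f x \<noteq> 0}"
      have "{x, y} \<in> X"
        using simplicial_complex_subset[OF sX S] y x by auto
      then have "(x, y) \<in> edge_rel X" by (simp add: edge_rel_def)
      moreover have "(a, x) \<in> (edge_rel X)\<^sup>*" using x by (simp add: A_def)
      ultimately have "(a, y) \<in> (edge_rel X)\<^sup>*" by simp
      then show "y \<in> A" using y S by (auto simp: A_def)
    qed
    then show ?thesis using realization_sum[OF f finA] by (simp add: g_def)
  next
    case False
    then show ?thesis by (simp add: g_def)
  qed
  define \<delta> where "\<delta> x = (\<lambda>y. if y = x then 1 else (0::real))" for x :: 'a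
  have \<delta>: "\<delta> x \<in> geometric_realization X" if "x \<in> \<Union>X" for x
  proof (rule realizationI[where A = "{x}"])
    have "{y. \<delta> x y \<noteq> 0} = {x}" by (auto simp: \<delta>_def)
    then show "{y. \<delta> x y \<noteq> 0} \<in> X" "{y. \<delta> x y \<noteq> 0} \<subseteq> {x}"
      using that sX by (auto simp: simplicial_complex_def)
  qed (auto simp: \<delta>_def)
  have "continuous_on (geometric_realization X) g"
    unfolding g_def by (intro continuous_intros continuous_on_product_then_coordinatewise)
  moreover have "connected (geometric_realization X)"
    using con unfolding connected_complex_def realization_top_def
      connectedin_iff_connected[symmetric] connectedin_def by auto
  ultimately have "connected (g ` geometric_realization X)"
    by (rule connected_continuous_image)
  moreover have "finite (g ` geometric_realization X)"
  proof (rule finite_subset)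
    show "g ` geometric_realization X \<subseteq> {0, 1}" using range by blast
  qed simp
  ultimately have "g (\<delta> a) = g (\<delta> b)"
    using \<delta>[OF a] \<delta>[OF b] by (metis connected_finite_iff_sing empty_iff imageI singletonD)
  moreover have "g (\<delta> a) = 1" using finA a by (auto simp: g_def \<delta>_def A_def)
  ultimately have "b \<in> A" using finA by (auto simp: g_def \<delta>_def split: if_splits)
  then show "(a, b) \<in> (edge_rel X)\<^sup>*" by (simp add: A_def)
qed

section \<open>Acyclic matchings and moves of edges\<close>

lemma simplicial_complex_finite: "simplicial_complex X \<Longrightarrow> F \<in> X \<Longrightarrow> finite F"
  unfolding simplicial_complex_def by blast

text \<open>An acyclic matching on the up-closed set \<open>R\<close> of faces: a face is matched with the one
  obtained by toggling the vertex \<open>h\<close>; acyclicity is ensured by the rank \<open>\<rho>\<close>.\<close>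

definition collapsing :: "'a set set \<Rightarrow> 'a set set \<Rightarrow> ('a set \<Rightarrow> 'a) \<Rightarrow> ('a set \<Rightarrow> nat) \<Rightarrow> bool" where
  "collapsing X R h \<rho> \<longleftrightarrow> R \<subseteq> X \<and> {} \<notin> R
     \<and> (\<forall>G\<in>R. insert (h G) G \<in> R \<and> h (insert (h G) G) = h G
           \<and> G - {h G} \<in> R \<and> h (G - {h G}) = h G \<and> \<rho> (G - {h G}) = \<rho> G)
     \<and> (\<forall>F\<in>R. \<forall>G\<in>X. F \<subseteq> G \<longrightarrow> G \<in> R \<and> (\<rho> F < \<rho> G \<or> \<rho> F = \<rho> G \<and> h F = h G))"

lemma collapsingI:
  assumes "R \<subseteq> X" "{} \<notin> R"
    and "\<And>G. G \<in> R \<Longrightarrow> insert (h G) G \<in> R \<and> h (insert (h G) G) = h G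
           \<and> G - {h G} \<in> R \<and> h (G - {h G}) = h G \<and> \<rho> (G - {h G}) = \<rho> G"
    and "\<And>F G. F \<in> R \<Longrightarrow> G \<in> X \<Longrightarrow> F \<subseteq> G \<Longrightarrow> G \<in> R \<and> (\<rho> F < \<rho> G \<or> \<rho> F = \<rho> G \<and> h F = h G)"
  shows "collapsing X R h \<rho>"
  using assms unfolding collapsing_def by blast

lemma finite_max_nat:
  fixes f :: "'b \<Rightarrow> nat"
  assumes "finite A" "A \<noteq> {}"
  obtains x where "x \<in> A" "\<And>y. y \<in> A \<Longrightarrow> f y \<le> f x"
proof -
  have "Max (f ` A) \<in> f ` A" using assms by (intro Max_in) auto
  then obtain x where "x \<in> A" "f x = Max (f ` A)" by auto
  then show ?thesis using that[of x] assms by auto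
qed

text \<open>Induction on the size of \<open>R\<close>. A member \<open>G\<close> of maximal rank,
  and of maximal cardinality among those, contains its own toggled vertex, and
  \<open>G - {h G}\<close> is a free face of it: any face above has the same rank and the same
  toggled vertex, so toggling would bring it above \<open>G\<close>. Removing the pair leaves a
  matching of the same kind.\<close>

lemma collapsing_heq:
  assumes "simplicial_complex X" "finite X" "collapsing X R h \<rho>"
  shows "X \<sim> X - R"
  using assms
proof (induction "card R" arbitrary: X R rule: less_induct)
  case less
  note X = less.prems(1) and finX = less.prems(2)
  have R: "R \<subseteq> X" "{} \<notin> R"
    and tog: "\<And>G. G \<in> R \<Longrightarrow> insert (h G) G \<in> R \<and> h (insert (h G) G) = h G
           \<and> G - {h G} \<in> R \<and> h (G - {h G}) = h G \<and> \<rho> (G - {h G}) = \<rho> G"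
    and up: "\<And>F G. F \<in> R \<Longrightarrow> G \<in> X \<Longrightarrow> F \<subseteq> G \<Longrightarrow> G \<in> R \<and> (\<rho> F < \<rho> G \<or> \<rho> F = \<rho> G \<and> h F = h G)"
    using less.prems(3) unfolding collapsing_def by blast+
  have finR: "finite R" using R finX finite_subset by blast
  show ?case
  proof (cases "R = {}")
    case True
    then show ?thesis by (simp add: heq_refl)
  next
    case False
    obtain G0 where G0: "G0 \<in> R" "\<And>F. F \<in> R \<Longrightarrow> \<rho> F \<le> \<rho> G0"
      using finite_max_nat[OF finR False] by blast
    have "finite {F \<in> R. \<rho> F = \<rho> G0}" "{F \<in> R. \<rho> F = \<rho> G0} \<noteq> {}"
      using finR G0 by auto
    then obtain G where G: "G \<in> {F \<in> R. \<rho> F = \<rho> G0}"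
      and Gmax: "\<And>F. F \<in> {F \<in> R. \<rho> F = \<rho> G0} \<Longrightarrow> card F \<le> card G"
      using finite_max_nat[of _ card] by (metis (lifting))
    have GR: "G \<in> R" using G by simp
    have \<rho>G: "\<rho> F \<le> \<rho> G" if "F \<in> R" for F using G G0(2)[OF that] by simp
    have big: "F = G" if "F \<in> R" "G \<subseteq> F" for F
    proof -
      have FX: "F \<in> X" using that R by blast
      have "\<rho> F = \<rho> G" using up[OF GR FX that(2)] \<rho>G[OF that(1)] by linarith
      then have "card F \<le> card G" using Gmax that(1) G by simp
      then show ?thesis using card_seteq[of F G] simplicial_complex_finite[OF X FX] that by auto
    qed
    define w where "w = h G"
    define \<tau> where "\<tau> = G - {w}"
    have hG: "insert w G = G" using big[of "insert w G"] tog[OF GR] by (auto simp: w_def)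
    then have wG: "w \<in> G" by blast
    have \<tau>R: "\<tau> \<in> R" "h \<tau> = w" "\<rho> \<tau> = \<rho> G" using tog[OF GR] by (auto simp: \<tau>_def w_def)
    have above: "F = \<tau> \<or> F = G" if F: "F \<in> X" "\<tau> \<subseteq> F" for F
    proof -
      have FR: "F \<in> R" and r: "\<rho> \<tau> < \<rho> F \<or> \<rho> \<tau> = \<rho> F \<and> h \<tau> = h F" using up[OF \<tau>R(1) F] by auto
      then have hF: "h F = w" using \<rho>G[OF FR] \<tau>R by auto
      then have "insert w F \<in> R" using tog[OF FR] by auto
      then have "insert w F = G" using F(2) wG by (intro big) (auto simp: \<tau>_def)
      then show ?thesis using F(2) by (auto simp: \<tau>_def)
    qed
    have sub: "{F \<in> X. \<not> \<tau> \<subseteq> F} = X - {\<tau>, G}"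
      using above by (auto simp: \<tau>_def)
    have GX: "G \<in> X" using GR R by blast
    have X1: "X \<sim> X - {\<tau>, G}"
      unfolding sub[symmetric]
    proof (rule collapse_star[OF X])
      show "finite \<tau>" using simplicial_complex_finite[OF X GX] by (simp add: \<tau>_def)
      show "\<tau> \<noteq> {}" using \<tau>R R by auto
      show "w \<notin> \<tau>" by (simp add: \<tau>_def)
      fix F assume "F \<in> X" "\<tau> \<subseteq> F"
      then have "insert w F = G" using above wG by (auto simp: \<tau>_def)
      then show "insert w F \<in> X" using GX by simp
    qed
    have sX': "simplicial_complex (X - {\<tau>, G})"
      using X unfolding sub[symmetric] simplicial_complex_def by blast
    have pair: "F = \<tau> \<or> F = G" if F: "F \<in> R" "insert (h F) F \<in> {\<tau>, G} \<or> F - {h F} \<in> {\<tau>, G}" for F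
    proof -
      have "h F = w" using tog[OF F(1)] F(2) \<tau>R(2) w_def by auto
      then show ?thesis using F(2) wG by (auto simp: \<tau>_def)
    qed
    have col: "collapsing (X - {\<tau>, G}) (R - {\<tau>, G}) h \<rho>"
    proof (rule collapsingI)
      fix F assume F: "F \<in> R - {\<tau>, G}"
      then have "insert (h F) F \<notin> {\<tau>, G}" "F - {h F} \<notin> {\<tau>, G}" using pair by auto
      then show "insert (h F) F \<in> R - {\<tau>, G} \<and> h (insert (h F) F) = h F
           \<and> F - {h F} \<in> R - {\<tau>, G} \<and> h (F - {h F}) = h F \<and> \<rho> (F - {h F}) = \<rho> F"
        using tog[of F] F by blast
    next
      fix F F' assume "F \<in> R - {\<tau>, G}" "F' \<in> X - {\<tau>, G}" "F \<subseteq> F'"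
      then show "F' \<in> R - {\<tau>, G} \<and> (\<rho> F < \<rho> F' \<or> \<rho> F = \<rho> F' \<and> h F = h F')"
        using up[of F F'] by auto
    qed (use R in auto)
    have "card (R - {\<tau>, G}) < card R"
      using finR GR by (intro psubset_card_mono) auto
    then have "X - {\<tau>, G} \<sim> X - {\<tau>, G} - (R - {\<tau>, G})"
      using less.hyps sX' finX col by blast
    moreover have "X - {\<tau>, G} - (R - {\<tau>, G}) = X - R" using GR \<tau>R by auto
    ultimately show ?thesis using heq_trans[OF X1] by simp
  qed
qed

lemma collapse_heq:
  fixes \<rho> :: "'a set \<Rightarrow> nat"
  assumes "simplicial_complex X" "finite X" "R \<subseteq> X" "{} \<notin> R" "Y = X - R"
    and "\<And>G. G \<in> R \<Longrightarrow> insert (h G) G \<in> R \<and> h (insert (h G) G) = h G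
           \<and> G - {h G} \<in> R \<and> h (G - {h G}) = h G \<and> \<rho> (G - {h G}) = \<rho> G"
    and "\<And>F G. F \<in> R \<Longrightarrow> G \<in> X \<Longrightarrow> F \<subseteq> G \<Longrightarrow> G \<in> R \<and> (\<rho> F < \<rho> G \<or> \<rho> F = \<rho> G \<and> h F = h G)"
  shows "X \<sim> Y"
  unfolding assms(5)
proof (rule collapsing_heq[OF assms(1,2), of R h \<rho>], rule collapsingI)
qed (fact assms(3), fact assms(4), erule assms(6), rule assms(7))

text \<open>A single vertex is toggled throughout, so acyclicity is automatic and a constant rank
  suffices.\<close>

lemma collapse_heq_apex:
  assumes "simplicial_complex X" "finite X" "R \<subseteq> X" "{} \<notin> R" "Y = X - R"
    and "\<And>G. G \<in> R \<Longrightarrow> insert w G \<in> R \<and> G - {w} \<in> R"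
    and "\<And>F G. F \<in> R \<Longrightarrow> G \<in> X \<Longrightarrow> F \<subseteq> G \<Longrightarrow> G \<in> R"
  shows "X \<sim> Y"
  by (rule collapse_heq[OF assms(1-5), where h = "\<lambda>_. w" and \<rho> = "\<lambda>_. 0"])
     (simp_all add: assms(6,7))

section \<open>Moves of single edges\<close>

lemma subset_doubleton_cases: "F \<subseteq> {a, b} \<Longrightarrow> F = {} \<or> F = {a} \<or> F = {b} \<or> F = {a, b}"
  by blast

lemma simplicial_complex_insert:
  assumes "simplicial_complex Y" "finite F" "\<And>x. x \<in> F \<Longrightarrow> F - {x} \<in> Y"
  shows "simplicial_complex (insert F Y)"
  unfolding simplicial_complex_def
proof (intro conjI ballI allI impI)
  fix G assume "G \<in> insert F Y"
  then show "finite G" using assms(1,2) by (auto simp: simplicial_complex_def)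
  fix H assume H: "H \<subseteq> G"
  show "H \<in> insert F Y"
  proof (cases "G \<in> Y")
    case True
    then show ?thesis using simplicial_complex_subset[OF assms(1) True H] by simp
  next
    case False
    then have "G = F" using \<open>G \<in> insert F Y\<close> by simp
    show ?thesis
    proof (cases "H = F")
      case False
      then obtain x where "x \<in> F" "H \<subseteq> F - {x}" using H \<open>G = F\<close> by blast
      then show ?thesis using assms simplicial_complex_subset by blast
    qed simp
  qed
qed

text \<open>Fill in the triangle \<open>{a, b, e}\<close>: both \<open>{a, e}\<close> and
  \<open>{b, e}\<close> are then free faces of it, because neither lies in \<open>Y\<close>, and
  collapsing from one of them leaves the other.\<close>

lemma edge_slide:
  assumes Y: "simplicial_complex Y" "finite Y" and "{a, b} \<in> Y" "{e} \<in> Y"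
    and "{a, e} \<notin> Y" "{b, e} \<notin> Y" "a \<noteq> b"
  shows "insert {a, e} Y \<sim> insert {b, e} Y"
proof -
  have vert: "{a} \<in> Y" "{b} \<in> Y" using assms simplicial_complex_subset by blast+
  have ne: "a \<noteq> e" "b \<noteq> e" using assms vert by auto
  have sY: "simplicial_complex (insert {c, e} Y)" if "{c} \<in> Y" "c \<noteq> e" for c
  proof (rule simplicial_complex_insert[OF Y(1)])
    fix x assume "x \<in> {c, e}"
    then show "{c, e} - {x} \<in> Y" using that assms(4) by (auto simp: insert_Diff_if)
  qed simp
  let ?Z = "insert {a, b, e} (insert {b, e} (insert {a, e} Y))"
  have s2: "simplicial_complex (insert {b, e} (insert {a, e} Y))"
  proof (rule simplicial_complex_insert[OF sY])
    fix x assume "x \<in> {b, e}"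
    then show "{b, e} - {x} \<in> insert {a, e} Y" using assms vert by (auto simp: insert_Diff_if)
  qed (use vert ne in auto)
  have sZ: "simplicial_complex ?Z"
  proof (rule simplicial_complex_insert[OF s2])
    fix x assume "x \<in> {a, b, e}"
    then show "{a, b, e} - {x} \<in> insert {b, e} (insert {a, e} Y)"
      using assms ne by (auto simp: insert_Diff_if insert_commute)
  qed simp
  have up: "G \<in> {{c, e}, {a, b, e}}" if "G \<in> ?Z" "{c, e} \<subseteq> G" "c = a \<or> c = b" for G c
  proof -
    have "G \<notin> Y" using that assms simplicial_complex_subset[OF Y(1), of G "{c, e}"] by auto
    then show ?thesis using that ne assms(7) by (auto simp: doubleton_eq_iff)
  qed
  have noY: "{a, b, e} \<notin> Y" using assms simplicial_complex_subset[OF Y(1), of "{a, b, e}" "{a, e}"] by auto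
  have A: "?Z \<sim> insert {a, e} Y"
  proof (rule collapse_heq_apex[OF sZ, where R = "{{b, e}, {a, b, e}}" and w = a])
    show "insert {a, e} Y = ?Z - {{b, e}, {a, b, e}}"
      using assms noY ne by (auto simp: doubleton_eq_iff)
    show "\<And>F G. F \<in> {{b, e}, {a, b, e}} \<Longrightarrow> G \<in> ?Z \<Longrightarrow> F \<subseteq> G \<Longrightarrow> G \<in> {{b, e}, {a, b, e}}"
      using up[of _ b] by blast
    show "\<And>G. G \<in> {{b, e}, {a, b, e}} \<Longrightarrow> insert a G \<in> {{b, e}, {a, b, e}} \<and> G - {a} \<in> {{b, e}, {a, b, e}}"
      using ne assms by auto
  qed (use Y in auto)
  have B: "?Z \<sim> insert {b, e} Y"
  proof (rule collapse_heq_apex[OF sZ, where R = "{{a, e}, {a, b, e}}" and w = b])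
    show "insert {b, e} Y = ?Z - {{a, e}, {a, b, e}}"
      using assms noY ne by (auto simp: doubleton_eq_iff)
    show "\<And>F G. F \<in> {{a, e}, {a, b, e}} \<Longrightarrow> G \<in> ?Z \<Longrightarrow> F \<subseteq> G \<Longrightarrow> G \<in> {{a, e}, {a, b, e}}"
      using up[of _ a] by blast
    show "\<And>G. G \<in> {{a, e}, {a, b, e}} \<Longrightarrow> insert b G \<in> {{a, e}, {a, b, e}} \<and> G - {b} \<in> {{a, e}, {a, b, e}}"
      using ne assms by auto
  qed (use Y in auto)
  show ?thesis using heq_trans[OF heq_sym[OF A] B] .
qed

text \<open>The filled triangle \<open>{a, b, m}\<close> collapses in two ways: toggling
  \<open>a\<close> removes everything at \<open>m\<close>, while pushing in the free edge
  \<open>{a, b}\<close> leaves the path through \<open>m\<close>.\<close>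

lemma edge_subdivide:
  assumes Y: "simplicial_complex Y" "finite Y" and "{a} \<in> Y" "{b} \<in> Y" "a \<noteq> b"
    and "{a, b} \<notin> Y" "m \<notin> \<Union>Y"
  shows "insert {a, b} Y \<sim> Y \<union> {{m}, {a, m}, {b, m}}"
proof -
  let ?Z = "Y \<union> {{a, b}, {m}, {a, m}, {b, m}, {a, b, m}}"
  have mG: "m \<notin> G" if "G \<in> Y" for G using that assms by auto
  have ab: "a \<noteq> m" "b \<noteq> m" using mG[OF assms(3)] mG[OF assms(4)] by auto
  have e: "{} \<in> Y" using simplicial_complex_subset[OF Y(1) assms(3)] by simp
  have 1: "simplicial_complex (insert {a, b} Y)"
  proof (rule simplicial_complex_insert[OF Y(1)])
    fix x assume "x \<in> {a, b}"
    then show "{a, b} - {x} \<in> Y" using assms by (auto simp: insert_Diff_if)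
  qed simp
  have 2: "simplicial_complex (insert {m} (insert {a, b} Y))"
    by (rule simplicial_complex_insert[OF 1]) (use e in auto)
  have 3: "simplicial_complex (insert {a, m} (insert {m} (insert {a, b} Y)))"
  proof (rule simplicial_complex_insert[OF 2])
    fix x assume "x \<in> {a, m}"
    then show "{a, m} - {x} \<in> insert {m} (insert {a, b} Y)" using assms ab by (auto simp: insert_Diff_if)
  qed simp
  have 4: "simplicial_complex (insert {b, m} (insert {a, m} (insert {m} (insert {a, b} Y))))"
  proof (rule simplicial_complex_insert[OF 3])
    fix x assume "x \<in> {b, m}"
    then show "{b, m} - {x} \<in> insert {a, m} (insert {m} (insert {a, b} Y))"
      using assms ab by (auto simp: insert_Diff_if)
  qed simp
  have 5: "simplicial_complex (insert {a, b, m} (insert {b, m} (insert {a, m} (insert {m} (insert {a, b} Y)))))"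
  proof (rule simplicial_complex_insert[OF 4])
    fix x assume "x \<in> {a, b, m}"
    then show "{a, b, m} - {x} \<in> insert {b, m} (insert {a, m} (insert {m} (insert {a, b} Y)))"
      using assms ab by (auto simp: insert_Diff_if insert_commute)
  qed simp
  have Zeq: "?Z = insert {a, b, m} (insert {b, m} (insert {a, m} (insert {m} (insert {a, b} Y))))" by auto
  have sZ: "simplicial_complex ?Z" using 5 Zeq by simp
  have A: "?Z \<sim> insert {a, b} Y"
  proof (rule collapse_heq_apex[OF sZ, where R = "{{m}, {a, m}, {b, m}, {a, b, m}}" and w = a])
    show "insert {a, b} Y = ?Z - {{m}, {a, m}, {b, m}, {a, b, m}}"
    proof -
      have "{a, b} \<noteq> {a, b, m}" using ab by (metis insertE insertI1 insert_commute singletonD)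
      then show ?thesis using mG ab by (auto simp: doubleton_eq_iff)
    qed
    fix F G assume "F \<in> {{m}, {a, m}, {b, m}, {a, b, m}}" "G \<in> ?Z" "F \<subseteq> G"
    then have "m \<in> G" by auto
    then show "G \<in> {{m}, {a, m}, {b, m}, {a, b, m}}" using \<open>G \<in> ?Z\<close> mG ab by auto
  next
    fix G assume "G \<in> {{m}, {a, m}, {b, m}, {a, b, m}}"
    then show "insert a G \<in> {{m}, {a, m}, {b, m}, {a, b, m}} \<and> G - {a} \<in> {{m}, {a, m}, {b, m}, {a, b, m}}"
      using ab \<open>a \<noteq> b\<close> by (auto simp: insert_Diff_if)
  qed (use Y in auto)
  have B: "?Z \<sim> Y \<union> {{m}, {a, m}, {b, m}}"
  proof (rule collapse_heq_apex[OF sZ, where R = "{{a, b}, {a, b, m}}" and w = m])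
    show "Y \<union> {{m}, {a, m}, {b, m}} = ?Z - {{a, b}, {a, b, m}}"
    proof -
      have "m \<notin> {a, b}" "a \<notin> {b, m}" "b \<notin> {a, m}" using ab assms(5) by simp_all
      then have ne: "{a, b} \<noteq> {m}" "{a, b} \<noteq> {a, m}" "{a, b} \<noteq> {b, m}"
          "{a, b, m} \<noteq> {m}" "{a, b, m} \<noteq> {a, m}" "{a, b, m} \<noteq> {b, m}"
        by (metis insertI1 insert_commute singletonI)+
      have "{a, b, m} \<notin> Y" using mG[of "{a, b, m}"] by auto
      then show ?thesis using assms(6) ne ab by (simp add: insert_Diff_if Un_Diff)
    qed
    fix F G assume F: "F \<in> {{a, b}, {a, b, m}}" "G \<in> ?Z" "F \<subseteq> G"
    then have "{a, b} \<subseteq> G" by auto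
    moreover from this have "G \<notin> Y" using assms simplicial_complex_subset[OF Y(1), of G "{a, b}"] by auto
    ultimately show "G \<in> {{a, b}, {a, b, m}}" using F(2) ab \<open>a \<noteq> b\<close> by auto
  next
    fix G assume "G \<in> {{a, b}, {a, b, m}}"
    then show "insert m G \<in> {{a, b}, {a, b, m}} \<and> G - {m} \<in> {{a, b}, {a, b, m}}"
      using ab by (auto simp: insert_Diff_if)
  qed (use Y in auto)
  show ?thesis using heq_trans[OF heq_sym[OF A] B] .
qed

lemma simplicial_complex_add_edge:
  assumes "simplicial_complex Y" "{a} \<in> Y" "{b} \<in> Y"
  shows "simplicial_complex (insert {a, b} Y)"
proof (rule simplicial_complex_insert[OF assms(1)])
  have "{} \<in> Y" using simplicial_complex_subset[OF assms(1,2)] by simp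
  then show "\<And>x. x \<in> {a, b} \<Longrightarrow> {a, b} - {x} \<in> Y" using assms by (auto simp: insert_Diff_if)
qed simp

lemma simplicial_complex_add_vertex:
  assumes "simplicial_complex Y" "{} \<in> Y"
  shows "simplicial_complex (insert {a} Y)"
  by (rule simplicial_complex_insert[OF assms(1)]) (use assms in auto)

text \<open>The edge closes a triangle with the edges from its ends to \<open>r\<close>. Two
  subdivisions put \<open>m\<close> and \<open>m'\<close> on it, and after each of them the outer
  piece is slid to \<open>r\<close>. Two new vertices are needed because a simplicial circle has at
  least three.\<close>

lemma edge_to_circle:
  assumes Y: "simplicial_complex Y" "finite Y" and "{a, r} \<in> Y" "{b, r} \<in> Y" "a \<noteq> r" "b \<noteq> r" "a \<noteq> b"
    and "{a, b} \<notin> Y" "m \<notin> \<Union>Y" "m' \<notin> \<Union>Y" "m \<noteq> m'"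
  shows "insert {a, b} Y \<sim> Y \<union> {{m}, {m'}, {r, m}, {m, m'}, {m', r}}"
proof -
  have v: "{a} \<in> Y" "{b} \<in> Y" "{r} \<in> Y" "{} \<in> Y"
    using simplicial_complex_subset[OF Y(1) assms(3)] simplicial_complex_subset[OF Y(1) assms(4)] by auto
  have mG: "m \<notin> G" "m' \<notin> G" if "G \<in> Y" for G using that assms by auto
  have ne: "a \<noteq> m" "b \<noteq> m" "r \<noteq> m" "a \<noteq> m'" "b \<noteq> m'" "r \<noteq> m'" using mG v by auto
  have no: "G \<notin> Y" if "m \<in> G \<or> m' \<in> G" for G using mG that by blast
  have ar: "{r, a} \<in> Y" "{r, b} \<in> Y" using assms by (auto simp: insert_commute)
  have 1: "insert {a, b} Y \<sim> Y \<union> {{m}, {a, m}, {b, m}}"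
    using assms v by (intro edge_subdivide) auto
  let ?Y1 = "insert {b, m} (insert {m} Y)"
  have s1: "simplicial_complex ?Y1"
    using v Y by (intro simplicial_complex_add_edge simplicial_complex_add_vertex) auto
  have 2: "insert {a, m} ?Y1 \<sim> insert {r, m} ?Y1"
  proof (rule edge_slide[OF s1])
    show "finite ?Y1" using Y by simp
    show "{a, r} \<in> ?Y1" using assms(3,4) by simp
    show "{m} \<in> ?Y1" by simp
    show "{a, m} \<notin> ?Y1" using no[of "{a, m}"] ne assms(5-7,11) by (auto simp: doubleton_eq_iff)
    show "{r, m} \<notin> ?Y1" using no[of "{r, m}"] ne assms(5-7,11) by (auto simp: doubleton_eq_iff)
    show "a \<noteq> r" by fact
  qed
  let ?Y2 = "insert {r, m} (insert {m} Y)"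
  have s2: "simplicial_complex ?Y2"
    using v Y by (intro simplicial_complex_add_edge simplicial_complex_add_vertex) auto
  have 3: "insert {b, m} ?Y2 \<sim> ?Y2 \<union> {{m'}, {b, m'}, {m, m'}}"
  proof (rule edge_subdivide[OF s2])
    show "finite ?Y2" using Y by simp
    show "{b} \<in> ?Y2" "{m} \<in> ?Y2" using v by simp_all
    show "b \<noteq> m" by fact
    show "{b, m} \<notin> ?Y2" using no[of "{b, m}"] ne assms(6) by (auto simp: doubleton_eq_iff)
    show "m' \<notin> \<Union>?Y2" using assms(10,11) ne by auto
  qed
  let ?Y3 = "insert {m, m'} (insert {m'} ?Y2)"
  have s3: "simplicial_complex ?Y3"
    using v Y by (intro simplicial_complex_add_edge simplicial_complex_add_vertex) auto
  have 4: "insert {b, m'} ?Y3 \<sim> insert {r, m'} ?Y3"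
  proof (rule edge_slide[OF s3])
    show "finite ?Y3" using Y by simp
    show "{b, r} \<in> ?Y3" using assms(3,4) by simp
    show "{m'} \<in> ?Y3" by simp
    show "{b, m'} \<notin> ?Y3" using no[of "{b, m'}"] ne assms(5-7,11) by (auto simp: doubleton_eq_iff)
    show "{r, m'} \<notin> ?Y3" using no[of "{r, m'}"] ne assms(5-7,11) by (auto simp: doubleton_eq_iff)
    show "b \<noteq> r" by fact
  qed
  have "insert {a, b} Y \<sim> insert {a, m} ?Y1" using 1 by (simp add: insert_commute)
  also note 2
  also have "insert {r, m} ?Y1 = insert {b, m} ?Y2" by (simp add: insert_commute)
  also note 3
  also have "?Y2 \<union> {{m'}, {b, m'}, {m, m'}} = insert {b, m'} ?Y3" by auto
  also note 4
  also have "insert {r, m'} ?Y3 = Y \<union> {{m}, {m'}, {r, m}, {m, m'}, {m', r}}" by auto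
  finally show ?thesis .
qed

section \<open>Copies of a complex glued along vertices\<close>

text \<open>\<open>Copy t j\<close> is the vertex \<open>j\<close> in copy number \<open>t\<close>,
  \<open>Hub x\<close> the vertex \<open>x\<close> in the target of the gluing maps, and
  \<open>Arc i b\<close> stands for the two vertices of circle number \<open>i\<close> other than
  its base.\<close>

datatype ('a, 'j) avertex = Copy nat 'j | Hub 'a | Arc nat bool

definition copies :: "'j set set \<Rightarrow> nat \<Rightarrow> ('a, 'j) avertex set set" where
  "copies L n = (\<Union>t<n. (`) (Copy t) ` L)"

text \<open>\<open>meet\<close> bounds the intersection of two copies by one vertex, and
  \<open>meetQ\<close> that of a copy with a face of \<open>Q\<close>. For unions of translates
  \<open>Q\<close> is empty; for the wedge itself it holds the circles.\<close>

locale glued_copies =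
  fixes L :: "'j set set" and n :: nat and \<phi> :: "nat \<Rightarrow> 'j \<Rightarrow> 'a" and Q :: "'a set set"
  assumes L: "simplicial_complex L" "finite L" and Q: "simplicial_complex Q" "finite Q"
    and inj: "\<And>t. t < n \<Longrightarrow> inj_on (\<phi> t) (\<Union>L)"
    and meet: "\<And>s t j k j' k'. s < n \<Longrightarrow> t < n \<Longrightarrow> s \<noteq> t \<Longrightarrow> j \<in> \<Union>L \<Longrightarrow> k \<in> \<Union>L \<Longrightarrow>
      j' \<in> \<Union>L \<Longrightarrow> k' \<in> \<Union>L \<Longrightarrow> \<phi> s j = \<phi> t j' \<Longrightarrow> \<phi> s k = \<phi> t k' \<Longrightarrow> j = k"
    and meetQ: "\<And>t j k F. t < n \<Longrightarrow> j \<in> \<Union>L \<Longrightarrow> k \<in> \<Union>L \<Longrightarrow> F \<in> Q \<Longrightarrow>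
      \<phi> t j \<in> F \<Longrightarrow> \<phi> t k \<in> F \<Longrightarrow> j = k"
begin

definition total :: "'a set set" where
  "total = (\<Union>t<n. (`) (\<phi> t) ` L) \<union> Q"

text \<open>The graph of copies: the copies are made disjoint, every vertex of their union becomes a
  hub, and each incidence becomes an edge; \<open>Q\<close> stays on the hubs.\<close>

definition exploded :: "('a, 'j) avertex set set" where
  "exploded = copies L n \<union> {{Hub (\<phi> t j)} | t j. t < n \<and> j \<in> \<Union>L}
     \<union> {{Copy t j, Hub (\<phi> t j)} | t j. t < n \<and> j \<in> \<Union>L} \<union> (`) Hub ` Q"

definition face :: "nat \<Rightarrow> 'j set \<Rightarrow> 'j set \<Rightarrow> ('a, 'j) avertex set" where
  "face t \<sigma> \<sigma>' = Copy t ` \<sigma> \<union> Hub ` \<phi> t ` \<sigma>'"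

text \<open>The mapping cylinder of the map from the disjoint union of the copies to \<open>total\<close>: it
  collapses to either end.\<close>

definition cylinder :: "('a, 'j) avertex set set" where
  "cylinder = {face t \<sigma> \<sigma>' | t \<sigma> \<sigma>'. t < n \<and> \<sigma> \<union> \<sigma>' \<in> L} \<union> (`) Hub ` Q"

lemma face_mem [simp]:
  "Copy s j \<in> face t \<sigma> \<sigma>' \<longleftrightarrow> s = t \<and> j \<in> \<sigma>"
  "Hub x \<in> face t \<sigma> \<sigma>' \<longleftrightarrow> x \<in> \<phi> t ` \<sigma>'"
  "Arc i b \<notin> face t \<sigma> \<sigma>'"
  by (auto simp: face_def)

lemma Hub_image_mem [simp]:
  "Copy s j \<notin> Hub ` q" "Hub x \<in> Hub ` q \<longleftrightarrow> x \<in> q" "Arc i b \<notin> Hub ` q"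
  by auto

lemma subL: "\<sigma> \<in> L \<Longrightarrow> \<tau> \<subseteq> \<sigma> \<Longrightarrow> \<tau> \<in> L"
  using simplicial_complex_subset[OF L(1)] .

lemma cylinder_faceI: "t < n \<Longrightarrow> \<sigma> \<union> \<sigma>' \<in> L \<Longrightarrow> face t \<sigma> \<sigma>' \<in> cylinder"
  unfolding cylinder_def by blast

lemma simplicial_cylinder: "simplicial_complex cylinder"
  unfolding simplicial_complex_def
proof (intro conjI ballI allI impI)
  fix F assume F: "F \<in> cylinder"
  then consider t \<sigma> \<sigma>' where "F = face t \<sigma> \<sigma>'" "t < n" "\<sigma> \<union> \<sigma>' \<in> L" | q where "F = Hub ` q" "q \<in> Q"
    unfolding cylinder_def by auto
  then have "finite F \<and> (\<forall>G\<subseteq>F. G \<in> cylinder)"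
  proof cases
    case 1
    have "finite (\<sigma> \<union> \<sigma>')" using simplicial_complex_finite[OF L(1) 1(3)] .
    moreover have "G \<in> cylinder" if "G \<subseteq> F" for G
    proof -
      have "G \<subseteq> Copy t ` \<sigma> \<union> Hub ` \<phi> t ` \<sigma>'" using that 1 by (simp add: face_def)
      then obtain A B where AB: "A \<subseteq> Copy t ` \<sigma>" "B \<subseteq> (Hub \<circ> \<phi> t) ` \<sigma>'" "G = A \<union> B"
        by (metis image_comp subset_UnE)
      then obtain \<tau> \<tau>' where "\<tau> \<subseteq> \<sigma>" "A = Copy t ` \<tau>" "\<tau>' \<subseteq> \<sigma>'" "B = (Hub \<circ> \<phi> t) ` \<tau>'"
        by (metis subset_imageE)
      moreover from this have "\<tau> \<union> \<tau>' \<in> L" using 1(3) subL[of "\<sigma> \<union> \<sigma>'" "\<tau> \<union> \<tau>'"] by blast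
      ultimately show ?thesis using AB(3) 1(2) unfolding cylinder_def face_def
        by (auto simp: image_comp)
    qed
    ultimately show ?thesis using 1 by (auto simp: face_def)
  next
    case 2
    moreover have "G \<in> cylinder" if "G \<subseteq> F" for G
    proof -
      have "G \<subseteq> Hub ` q" using that 2(1) by simp
      then obtain p where "p \<subseteq> q" "G = Hub ` p" by (rule subset_imageE)
      moreover from this have "p \<in> Q" using simplicial_complex_subset[OF Q(1) 2(2)] by blast
      ultimately show ?thesis by (auto simp: cylinder_def)
    qed
    ultimately show ?thesis using simplicial_complex_finite[OF Q(1)] by auto
  qed
  then show "finite F" "\<And>G. G \<subseteq> F \<Longrightarrow> G \<in> cylinder" by auto
qed

lemma finite_cylinder: "finite cylinder"
proof -
  have "cylinder \<subseteq> (\<lambda>(t, \<sigma>, \<sigma>'). face t \<sigma> \<sigma>') ` ({..<n} \<times> L \<times> L) \<union> (`) Hub ` Q"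
  proof
    fix F assume "F \<in> cylinder"
    then consider t \<sigma> \<sigma>' where "F = face t \<sigma> \<sigma>'" "t < n" "\<sigma> \<union> \<sigma>' \<in> L" | "F \<in> (`) Hub ` Q"
      unfolding cylinder_def by auto
    then show "F \<in> (\<lambda>(t, \<sigma>, \<sigma>'). face t \<sigma> \<sigma>') ` ({..<n} \<times> L \<times> L) \<union> (`) Hub ` Q"
    proof cases
      case 1
      then have "\<sigma> \<in> L" "\<sigma>' \<in> L" using subL by auto
      then show ?thesis using 1 by force
    qed simp
  qed
  then show ?thesis using L Q finite_subset by (metis (no_types, lifting) finite_SigmaI finite_UnI finite_imageI finite_lessThan)
qed

lemma Hub_total_eq:
  "(`) Hub ` total = cylinder - {face t \<sigma> \<sigma>' | t \<sigma> \<sigma>'. t < n \<and> \<sigma> \<union> \<sigma>' \<in> L \<and> \<sigma> \<noteq> {}}"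
    (is "?A = cylinder - ?R")
proof (intro equalityI subsetI)
  fix F assume "F \<in> ?A"
  then consider t \<sigma> where "t < n" "\<sigma> \<in> L" "F = Hub ` \<phi> t ` \<sigma>" | q where "q \<in> Q" "F = Hub ` q"
    unfolding total_def by auto
  then show "F \<in> cylinder - ?R"
  proof cases
    case 1
    then have "F = face t {} \<sigma>" by (auto simp: face_def)
    moreover have "F \<notin> ?R" using 1(3) by (auto simp: face_def)
    moreover have "face t \<sigma> {} \<in> cylinder" "face t {} \<sigma> \<in> cylinder" using 1 by (auto intro: cylinder_faceI)
    ultimately show ?thesis by simp
  qed (auto simp: cylinder_def face_def)
next
  fix F assume F: "F \<in> cylinder - ?R"
  then consider "F \<in> {face t \<sigma> \<sigma>' | t \<sigma> \<sigma>'. t < n \<and> \<sigma> \<union> \<sigma>' \<in> L}" | "F \<in> (`) Hub ` Q"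
    unfolding cylinder_def by blast
  then show "F \<in> ?A"
  proof cases
    case 1
    then obtain t \<sigma> \<sigma>' where 1: "F = face t \<sigma> \<sigma>'" "t < n" "\<sigma> \<union> \<sigma>' \<in> L" by blast
    then have "\<sigma> = {}" using F by blast
    then show ?thesis using 1 by (auto simp: face_def total_def)
  qed (auto simp: total_def)
qed

text \<open>A face with nonempty copy part \<open>\<sigma>\<close> is toggled at the hub of a chosen
  vertex of \<open>\<sigma>\<close>, which changes nothing in
  \<open>\<sigma> \<union> \<sigma>'\<close>. The choice depends only on the copy and on
  \<open>\<sigma>\<close>, so a larger face has either a larger copy part, hence a larger rank, or
  the same toggled vertex.\<close>

lemma cylinder_heq_total: "cylinder \<sim> (`) (Hub :: 'a \<Rightarrow> ('a, 'j) avertex) ` total"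
proof (rule collapse_heq[OF simplicial_cylinder finite_cylinder _ _ Hub_total_eq])
  let ?R = "{face t \<sigma> \<sigma>' | t \<sigma> \<sigma>'. t < n \<and> \<sigma> \<union> \<sigma>' \<in> L \<and> \<sigma> \<noteq> {}}"
  define cp where "cp G = {j. \<exists>t. Copy t j \<in> G}" for G :: "('a, 'j) avertex set"
  define h where "h G = (Hub (\<phi> (SOME t. \<exists>j. Copy t j \<in> G) (SOME j. j \<in> cp G)) :: ('a, 'j) avertex)" for G
  have cp: "cp (face t \<sigma> \<sigma>') = \<sigma>" for t \<sigma> \<sigma>' by (auto simp: cp_def)
  have h: "h (face t \<sigma> \<sigma>') = Hub (\<phi> t (SOME j. j \<in> \<sigma>))" if "\<sigma> \<noteq> {}" for t \<sigma> \<sigma>'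
  proof -
    have "(SOME s. \<exists>j. Copy s j \<in> face t \<sigma> \<sigma>') = t" using that by (intro some_equality) auto
    then show ?thesis by (simp add: h_def cp)
  qed
  show "?R \<subseteq> cylinder" by (auto simp: cylinder_def)
  show "{} \<notin> ?R" by (auto simp: face_def)
  show "insert (h G) G \<in> ?R \<and> h (insert (h G) G) = h G \<and> G - {h G} \<in> ?R \<and> h (G - {h G}) = h G
      \<and> (card \<circ> cp) (G - {h G}) = (card \<circ> cp) G" if GR: "G \<in> ?R" for G
  proof -
    obtain t \<sigma> \<sigma>' where G: "G = face t \<sigma> \<sigma>'" "t < n" "\<sigma> \<union> \<sigma>' \<in> L" "\<sigma> \<noteq> {}" using GR by blast
    define p where "p = (SOME j. j \<in> \<sigma>)"
    have p: "p \<in> \<sigma>" using G(4) unfolding p_def by (simp add: some_in_eq)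
    have hG: "h G = Hub (\<phi> t p)" using h[OF G(4)] by (simp add: G p_def)
    have 1: "insert (h G) G = face t \<sigma> (insert p \<sigma>')" unfolding hG by (auto simp: G face_def)
    have "\<phi> t ` (\<sigma>' - {p}) = \<phi> t ` \<sigma>' - {\<phi> t p}"
      using inj_on_image_set_diff[OF inj[OF G(2)], of \<sigma>' "{p}"] G(3) p by auto
    then have 2: "G - {h G} = face t \<sigma> (\<sigma>' - {p})" unfolding hG by (auto simp: G face_def)
    have "\<sigma> \<union> insert p \<sigma>' = \<sigma> \<union> \<sigma>'" "\<sigma> \<union> (\<sigma>' - {p}) = \<sigma> \<union> \<sigma>'" using p by auto
    then have "face t \<sigma> (insert p \<sigma>') \<in> ?R" "face t \<sigma> (\<sigma>' - {p}) \<in> ?R" using G by (metis (mono_tags, lifting) mem_Collect_eq)+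
    then show ?thesis unfolding 1 2 by (simp add: h[OF G(4)] G(1) cp)
  qed
  show "G \<in> ?R \<and> ((card \<circ> cp) F < (card \<circ> cp) G \<or> (card \<circ> cp) F = (card \<circ> cp) G \<and> h F = h G)"
    if FR: "F \<in> ?R" and GM: "G \<in> cylinder" and FG: "F \<subseteq> G" for F G
  proof -
    obtain t \<sigma> \<sigma>' where F: "F = face t \<sigma> \<sigma>'" "t < n" "\<sigma> \<union> \<sigma>' \<in> L" "\<sigma> \<noteq> {}" using FR by blast
    then obtain j where "j \<in> \<sigma>" by auto
    then have jG: "Copy t j \<in> G" using F FG by auto
    then have "G \<notin> (`) Hub ` Q" by auto
    then obtain s \<tau> \<tau>' where "G = face s \<tau> \<tau>'" "s < n" "\<tau> \<union> \<tau>' \<in> L"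
      using GM unfolding cylinder_def by blast
    then have G: "G = face t \<tau> \<tau>'" "\<tau> \<union> \<tau>' \<in> L" using jG by auto
    have "\<sigma> \<subseteq> \<tau>"
    proof
      fix i assume "i \<in> \<sigma>"
      then have "Copy t i \<in> G" using FG F(1) by auto
      then show "i \<in> \<tau>" using G by simp
    qed
    moreover have "finite \<tau>" using simplicial_complex_finite[OF L(1) G(2)] by simp
    ultimately have "card \<sigma> < card \<tau> \<or> \<sigma> = \<tau>" by (metis psubset_card_mono psubsetI)
    moreover have "G \<in> ?R" using G F \<open>\<sigma> \<subseteq> \<tau>\<close> by blast
    ultimately show ?thesis using h[OF F(4)] by (auto simp: F(1) G(1) cp)
  qed
qed

text \<open>The cylinder faces that are missing from \<open>exploded\<close>. They involve at least
  two vertices of \<open>L\<close>, enough for \<open>meet\<close> to recover the copy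
  \<open>t\<close> from the face.\<close>

definition nondegenerate :: "nat \<Rightarrow> 'j set \<Rightarrow> 'j set \<Rightarrow> bool" where
  "nondegenerate t \<sigma> \<sigma>' \<longleftrightarrow> t < n \<and> \<sigma> \<union> \<sigma>' \<in> L \<and> \<sigma>' \<noteq> {} \<and> (\<nexists>j. \<sigma> \<union> \<sigma>' \<subseteq> {j})"

lemma nondegenerateD:
  assumes "nondegenerate t \<sigma> \<sigma>'"
  shows "t < n" "\<sigma> \<union> \<sigma>' \<in> L" "\<sigma>' \<noteq> {}" "\<nexists>j. \<sigma> \<union> \<sigma>' \<subseteq> {j}"
  using assms by (auto simp: nondegenerate_def)

lemma exploded_eq:
  "exploded = cylinder - {face t \<sigma> \<sigma>' | t \<sigma> \<sigma>'. nondegenerate t \<sigma> \<sigma>'}"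
    (is "_ = cylinder - ?R")
proof (intro equalityI subsetI)
  fix F assume "F \<in> exploded"
  then consider "F \<in> copies L n" | "F \<in> {{Hub (\<phi> t j)} | t j. t < n \<and> j \<in> \<Union>L}"
    | "F \<in> {{Copy t j, Hub (\<phi> t j)} | t j. t < n \<and> j \<in> \<Union>L}" | "F \<in> (`) Hub ` Q"
    by (simp only: exploded_def Un_iff) metis
  then show "F \<in> cylinder - ?R"
  proof cases
    case 1
    then obtain t \<sigma> where 1: "t < n" "\<sigma> \<in> L" "F = Copy t ` \<sigma>" by (auto simp: copies_def)
    then have "F = face t \<sigma> {}" by (auto simp: face_def)
    moreover have "F \<notin> ?R" using 1(3) by (auto simp: face_def nondegenerate_def)
    moreover have "face t \<sigma> {} \<in> cylinder" "face t {} \<sigma> \<in> cylinder" using 1 by (auto intro: cylinder_faceI)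
    ultimately show ?thesis by simp
  next
    case 2
    then obtain t j where 2: "t < n" "j \<in> \<Union>L" "F = {Hub (\<phi> t j)}"
      by (elim CollectE exE conjE) (rule that; assumption)
    have "{j} \<in> L" using 2(2) subL by blast
    then have "F = face t {} {j}" "{} \<union> {j} \<in> L" using 2 by (auto simp: face_def)
    moreover have "F \<notin> ?R"
    proof
      assume "F \<in> ?R"
      then obtain s \<sigma> \<sigma>' where s: "F = face s \<sigma> \<sigma>'" "s < n" "\<sigma> \<union> \<sigma>' \<in> L" "\<nexists>j. \<sigma> \<union> \<sigma>' \<subseteq> {j}"
        by (auto simp: nondegenerate_def)
      have "\<sigma> = {}"
      proof (rule ccontr)
        assume "\<sigma> \<noteq> {}"
        then obtain i where "Copy s i \<in> F" using s(1) by auto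
        then show False using 2(3) by simp
      qed
      moreover have "\<sigma>' \<subseteq> \<Union>L" using s(3) by auto
      moreover have "\<phi> s i = \<phi> t j" if "i \<in> \<sigma>'" for i
      proof -
        have "Hub (\<phi> s i) \<in> F" using that s(1) by simp
        then show ?thesis using 2(3) by simp
      qed
      ultimately show False using s(4) inj[OF s(2)] unfolding inj_on_def
        by (metis (no_types, opaque_lifting) Un_empty_left insertI1 subset_iff)
    qed
    ultimately show ?thesis using 2(1) unfolding cylinder_def by blast
  next
    case 3
    then obtain t j where 3: "t < n" "j \<in> \<Union>L" "F = {Copy t j, Hub (\<phi> t j)}"
      by (elim CollectE exE conjE) (rule that; assumption)
    have "{j} \<in> L" using 3(2) subL by blast
    then have "F = face t {j} {j}" "{j} \<union> {j} \<in> L" using 3 by (auto simp: face_def)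
    moreover have "F \<notin> ?R"
    proof
      assume "F \<in> ?R"
      then obtain s \<sigma> \<sigma>' where s: "F = face s \<sigma> \<sigma>'" "s < n" "\<sigma> \<union> \<sigma>' \<in> L" "\<nexists>j. \<sigma> \<union> \<sigma>' \<subseteq> {j}"
        by (auto simp: nondegenerate_def)
      have "Copy t j \<in> F" using 3(3) by simp
      then have "s = t" using s(1) by simp
      have "i = j" if "i \<in> \<sigma>" for i
      proof -
        have "Copy s i \<in> F" using that s(1) by simp
        then show ?thesis using 3(3) by simp
      qed
      moreover have "i = j" if "i \<in> \<sigma>'" for i
      proof -
        have "Hub (\<phi> s i) \<in> F" using that s(1) by simp
        then have "\<phi> t i = \<phi> t j" using 3(3) \<open>s = t\<close> by simp
        then show ?thesis using inj[OF 3(1)] that s(3) 3(2) unfolding inj_on_def by blast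
      qed
      ultimately show False using s(4) by blast
    qed
    ultimately show ?thesis using 3(1) unfolding cylinder_def by blast
  next
    case 4
    then obtain q where 4: "q \<in> Q" "F = Hub ` q" by blast
    have "F \<notin> ?R"
    proof
      assume "F \<in> ?R"
      then obtain s \<sigma> \<sigma>' where s: "F = face s \<sigma> \<sigma>'" "s < n" "\<sigma> \<union> \<sigma>' \<in> L" "\<nexists>j. \<sigma> \<union> \<sigma>' \<subseteq> {j}"
        by (auto simp: nondegenerate_def)
      have "\<sigma> = {}"
      proof (rule ccontr)
        assume "\<sigma> \<noteq> {}"
        then obtain i where "Copy s i \<in> F" using s(1) by auto
        then show False using 4(2) by simp
      qed
      moreover have "\<phi> s i \<in> q" if "i \<in> \<sigma>'" for i
      proof -
        have "Hub (\<phi> s i) \<in> F" using that s(1) by simp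
        then show ?thesis using 4(2) by simp
      qed
      moreover obtain i k where "i \<in> \<sigma> \<union> \<sigma>'" "k \<in> \<sigma> \<union> \<sigma>'" "i \<noteq> k" using s(4) by blast
      ultimately show False using meetQ[OF s(2) _ _ 4(1), of i k] s(3) by blast
    qed
    then show ?thesis using 4 by (auto simp: cylinder_def)
  qed
next
  fix F assume F: "F \<in> cylinder - ?R"
  then consider "F \<in> {face t \<sigma> \<sigma>' | t \<sigma> \<sigma>'. t < n \<and> \<sigma> \<union> \<sigma>' \<in> L}" | "F \<in> (`) Hub ` Q"
    unfolding cylinder_def by blast
  then show "F \<in> exploded"
  proof cases
    case 1
    then obtain t \<sigma> \<sigma>' where 1: "F = face t \<sigma> \<sigma>'" "t < n" "\<sigma> \<union> \<sigma>' \<in> L" by blast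
    have "\<not> nondegenerate t \<sigma> \<sigma>'" using F 1(1) by blast
    then consider "\<sigma>' = {}" | j where "\<sigma>' \<noteq> {}" "\<sigma> \<union> \<sigma>' \<subseteq> {j}"
      using 1 unfolding nondegenerate_def by blast
    then show ?thesis
    proof cases
      case 1
      then have "F = Copy t ` \<sigma>" "\<sigma> \<in> L"
        using \<open>F = face t \<sigma> \<sigma>'\<close> \<open>\<sigma> \<union> \<sigma>' \<in> L\<close> by (simp_all add: face_def)
      then have "F \<in> copies L n" using \<open>t < n\<close> unfolding copies_def by blast
      then show ?thesis by (simp only: exploded_def Un_iff simp_thms)
    next
      case (2 j)
      then have \<sigma>': "\<sigma>' = {j}" and \<sigma>: "\<sigma> = {} \<or> \<sigma> = {j}" by auto
      have j: "j \<in> \<Union>L" using 1(3) \<sigma>' by blast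
      from \<sigma> show ?thesis
      proof
        assume "\<sigma> = {}"
        then have "F = {Hub (\<phi> t j)}" using 1(1) \<sigma>' by (simp add: face_def)
        then have "F \<in> {{Hub (\<phi> t j)} | t j. t < n \<and> j \<in> \<Union>L}" using 1(2) j by blast
        then show ?thesis by (simp only: exploded_def Un_iff simp_thms)
      next
        assume "\<sigma> = {j}"
        then have "F = {Copy t j, Hub (\<phi> t j)}" using 1(1) \<sigma>' by (simp add: face_def insert_commute)
        then have "F \<in> {{Copy t j, Hub (\<phi> t j)} | t j. t < n \<and> j \<in> \<Union>L}" using 1(2) j by blast
        then show ?thesis by (simp only: exploded_def Un_iff simp_thms)
      qed
    qed
  qed (simp add: exploded_def)
qed

text \<open>The mirror image of the other collapse: a chosen vertex of the hub part is toggled in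
  the copy, with the size of the hub part as rank. Here the copy has to be recovered from hubs
  alone, which is where the bounds on intersections enter; \<open>meetQ\<close> keeps these faces
  apart from \<open>Q\<close>.\<close>

lemma cylinder_heq_exploded: "cylinder \<sim> exploded"
proof (rule collapse_heq[OF simplicial_cylinder finite_cylinder _ _ exploded_eq])
  let ?R = "{face t \<sigma> \<sigma>' | t \<sigma> \<sigma>'. nondegenerate t \<sigma> \<sigma>'}"
  define rep where "rep G = (SOME p. \<exists>\<sigma>. G = face (fst p) \<sigma> (snd p) \<and> nondegenerate (fst p) \<sigma> (snd p))"
    for G :: "('a, 'j) avertex set"
  define h where "h G = (Copy (fst (rep G)) (SOME j. j \<in> snd (rep G)) :: ('a, 'j) avertex)" for G
  define \<rho> where "\<rho> G = card {x. Hub x \<in> G}" for G :: "('a, 'j) avertex set"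
  have up: "s = t \<and> \<sigma> \<subseteq> \<tau> \<and> \<sigma>' \<subseteq> \<tau>'"
    if F: "nondegenerate t \<sigma> \<sigma>'" and G: "s < n" "\<tau> \<union> \<tau>' \<in> L" and FG: "face t \<sigma> \<sigma>' \<subseteq> face s \<tau> \<tau>'" for t \<sigma> \<sigma>' s \<tau> \<tau>'
  proof -
    have cop: "t = s \<and> j \<in> \<tau>" if "j \<in> \<sigma>" for j
    proof -
      have "Copy t j \<in> face s \<tau> \<tau>'" using that subsetD[OF FG, of "Copy t j"] by simp
      then show ?thesis by simp
    qed
    have hub: "\<exists>i\<in>\<tau>'. \<phi> t j = \<phi> s i" if "j \<in> \<sigma>'" for j
    proof -
      have "Hub (\<phi> t j) \<in> face s \<tau> \<tau>'" using that subsetD[OF FG, of "Hub (\<phi> t j)"] by simp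
      then show ?thesis by auto
    qed
    \<comment> \<open>Without copy vertices the face has two different hubs, and \<open>meet\<close>
      allows two different copies only one in common.\<close>
    have st: "s = t"
    proof (cases "\<sigma> = {}")
      case True
      then obtain j k where jk: "j \<in> \<sigma>'" "k \<in> \<sigma>'" "j \<noteq> k" using nondegenerateD[OF F] by blast
      then obtain j' k' where "j' \<in> \<tau>'" "\<phi> t j = \<phi> s j'" "k' \<in> \<tau>'" "\<phi> t k = \<phi> s k'" using hub by meson
      then show ?thesis using meet[of t s j k j' k'] nondegenerateD[OF F] G jk by blast
    next
      case False
      then show ?thesis using cop by blast
    qed
    moreover have "\<sigma>' \<subseteq> \<tau>'"
    proof
      fix j assume "j \<in> \<sigma>'"
      then obtain i where "i \<in> \<tau>'" "\<phi> t j = \<phi> t i" using hub st by blast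
      moreover have "j \<in> \<Union>L" "i \<in> \<Union>L" using \<open>j \<in> \<sigma>'\<close> \<open>i \<in> \<tau>'\<close> nondegenerateD[OF F] G by blast+
      ultimately show "j \<in> \<tau>'" using inj[OF nondegenerateD(1)[OF F]] unfolding inj_on_def by blast
    qed
    ultimately show ?thesis using cop by blast
  qed
  have h: "h (face t \<sigma> \<sigma>') = Copy t (SOME j. j \<in> \<sigma>')" if P: "nondegenerate t \<sigma> \<sigma>'" for t \<sigma> \<sigma>'
  proof -
    have "rep (face t \<sigma> \<sigma>') = (t, \<sigma>')"
      unfolding rep_def
    proof (rule some_equality)
      show "\<exists>\<sigma>''. face t \<sigma> \<sigma>' = face (fst (t, \<sigma>')) \<sigma>'' (snd (t, \<sigma>')) \<and> nondegenerate (fst (t, \<sigma>')) \<sigma>'' (snd (t, \<sigma>'))"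
        using P by auto
    next
      fix p assume "\<exists>\<sigma>''. face t \<sigma> \<sigma>' = face (fst p) \<sigma>'' (snd p) \<and> nondegenerate (fst p) \<sigma>'' (snd p)"
      then obtain \<sigma>'' where p: "face t \<sigma> \<sigma>' = face (fst p) \<sigma>'' (snd p)" "nondegenerate (fst p) \<sigma>'' (snd p)" by blast
      have "fst p = t" "\<sigma>' \<subseteq> snd p" using up[OF P, of "fst p" \<sigma>'' "snd p"] p nondegenerateD[OF p(2)] by auto
      moreover have "snd p \<subseteq> \<sigma>'" using up[OF p(2), of t \<sigma> \<sigma>'] p nondegenerateD[OF P] by auto
      ultimately show "p = (t, \<sigma>')" by (simp add: prod_eq_iff)
    qed
    then show ?thesis by (simp add: h_def)
  qed
  have \<rho>: "\<rho> (face t \<sigma> \<sigma>') = card \<sigma>'" if "nondegenerate t \<sigma> \<sigma>'" for t \<sigma> \<sigma>'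
  proof -
    have "inj_on (\<phi> t) \<sigma>'" using inj[OF nondegenerateD(1)[OF that]] nondegenerateD(2)[OF that]
      by (meson Sup_upper inj_on_subset le_sup_iff)
    then show ?thesis by (simp add: \<rho>_def card_image)
  qed
  show "?R \<subseteq> cylinder" by (auto simp: cylinder_def nondegenerate_def)
  show "{} \<notin> ?R" by (auto simp: face_def nondegenerate_def)
  show "insert (h G) G \<in> ?R \<and> h (insert (h G) G) = h G \<and> G - {h G} \<in> ?R \<and> h (G - {h G}) = h G
      \<and> \<rho> (G - {h G}) = \<rho> G" if GR: "G \<in> ?R" for G
  proof -
    obtain t \<sigma> \<sigma>' where G: "G = face t \<sigma> \<sigma>'" "nondegenerate t \<sigma> \<sigma>'" using GR by blast
    define p where "p = (SOME j. j \<in> \<sigma>')"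
    have p: "p \<in> \<sigma>'" using nondegenerateD[OF G(2)] unfolding p_def by (simp add: some_in_eq)
    have hG: "h G = Copy t p" using h[OF G(2)] by (simp add: G p_def)
    have 1: "insert (h G) G = face t (insert p \<sigma>) \<sigma>'" unfolding hG by (auto simp: G face_def)
    have 2: "G - {h G} = face t (\<sigma> - {p}) \<sigma>'" unfolding hG by (auto simp: G face_def)
    have "insert p \<sigma> \<union> \<sigma>' = \<sigma> \<union> \<sigma>'" "(\<sigma> - {p}) \<union> \<sigma>' = \<sigma> \<union> \<sigma>'" using p by auto
    then have P: "nondegenerate t (insert p \<sigma>) \<sigma>'" "nondegenerate t (\<sigma> - {p}) \<sigma>'" using G(2) unfolding nondegenerate_def by presburger+
    then have "face t (insert p \<sigma>) \<sigma>' \<in> ?R" "face t (\<sigma> - {p}) \<sigma>' \<in> ?R" by blast+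
    then show ?thesis unfolding 1 2
      by (simp only: h[OF P(1)] h[OF P(2)] h[OF G(2)] \<rho>[OF P(2)] \<rho>[OF G(2)] G(1))
  qed
  show "G \<in> ?R \<and> (\<rho> F < \<rho> G \<or> \<rho> F = \<rho> G \<and> h F = h G)"
    if FR: "F \<in> ?R" and GM: "G \<in> cylinder" and FG: "F \<subseteq> G" for F G
  proof -
    obtain t \<sigma> \<sigma>' where F: "F = face t \<sigma> \<sigma>'" "nondegenerate t \<sigma> \<sigma>'" using FR by blast
    from GM consider s \<tau> \<tau>' where "G = face s \<tau> \<tau>'" "s < n" "\<tau> \<union> \<tau>' \<in> L" | q where "q \<in> Q" "G = Hub ` q"
      unfolding cylinder_def by auto
    then show ?thesis
    proof cases
      case 1
      have u: "s = t" "\<sigma> \<subseteq> \<tau>" "\<sigma>' \<subseteq> \<tau>'" using up[OF F(2) 1(2,3)] FG F(1) 1(1) by auto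
      then have P: "nondegenerate t \<tau> \<tau>'" using nondegenerateD[OF F(2)] 1 u unfolding nondegenerate_def by blast
      have "finite \<tau>'" using simplicial_complex_finite[OF L(1) 1(3)] by simp
      then have "card \<sigma>' < card \<tau>' \<or> \<sigma>' = \<tau>'" using u(3) by (metis psubset_card_mono psubsetI)
      then have "\<rho> F < \<rho> G \<or> \<rho> F = \<rho> G \<and> h F = h G"
        using h[OF F(2)] h[OF P] \<rho>[OF F(2)] \<rho>[OF P] by (auto simp: F(1) 1(1) u(1))
      then show ?thesis using P 1(1) u(1) by blast
    next
      case 2
      have "\<sigma> = {}"
      proof (rule ccontr)
        assume "\<sigma> \<noteq> {}"
        then obtain i where "Copy t i \<in> F" using F(1) by auto
        then show False using subsetD[OF FG] 2(2) by auto
      qed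
      then obtain j k where jk: "j \<in> \<sigma>'" "k \<in> \<sigma>'" "j \<noteq> k" using nondegenerateD[OF F(2)] by blast
      have "Hub (\<phi> t j) \<in> Hub ` q" "Hub (\<phi> t k) \<in> Hub ` q"
        using subsetD[OF FG, of "Hub (\<phi> t j)"] subsetD[OF FG, of "Hub (\<phi> t k)"] jk F(1) 2(2) by simp_all
      then show ?thesis using meetQ[of t j k q] jk 2(1) nondegenerateD[OF F(2)] by auto
    qed
  qed
qed

lemma simplicial_total: "simplicial_complex total"
  unfolding simplicial_complex_def
proof (intro conjI ballI allI impI)
  fix F assume "F \<in> total"
  then show "finite F"
    using L(1) Q(1) by (auto simp: total_def simplicial_complex_def)
  fix G assume G: "G \<subseteq> F"
  from \<open>F \<in> total\<close> consider t where "t < n" "F \<in> (`) (\<phi> t) ` L" | "F \<in> Q"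
    by (auto simp: total_def)
  then show "G \<in> total"
  proof cases
    case 1
    then have "G \<in> (`) (\<phi> t) ` L"
      using simplicial_complex_subset[OF simplicial_complex_image[OF L(1)] _ G] by blast
    then show ?thesis using 1 by (auto simp: total_def)
  next
    case 2
    then show ?thesis using simplicial_complex_subset[OF Q(1) _ G] by (auto simp: total_def)
  qed
qed

lemma total_heq_exploded: "total \<sim> exploded"
proof -
  have "total \<sim> (`) (Hub :: 'a \<Rightarrow> ('a, 'j) avertex) ` total"
    by (rule heq_image[OF simplicial_total]) (simp add: inj_on_def)
  also note heq_sym[OF cylinder_heq_total]
  also note cylinder_heq_exploded
  finally show ?thesis .
qed

end

section \<open>Sliding joining edges and splitting off circles\<close>

lemma simplicial_complex_Un_edges:
  assumes B: "simplicial_complex B" and E: "\<And>e. e \<in> E \<Longrightarrow> \<exists>a b. e = {a, b} \<and> {a} \<in> B \<and> {b} \<in> B"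
  shows "simplicial_complex (B \<union> E)"
  unfolding simplicial_complex_def
proof (intro conjI ballI allI impI)
  fix F assume F: "F \<in> B \<union> E"
  then show "finite F" using simplicial_complex_finite[OF B] E by fastforce
  fix G assume G: "G \<subseteq> F"
  show "G \<in> B \<union> E"
  proof (cases "F \<in> B")
    case True
    then show ?thesis using simplicial_complex_subset[OF B _ G] by simp
  next
    case False
    then obtain a b where ab: "F = {a, b}" "{a} \<in> B" "{b} \<in> B" using F E by blast
    then have "{} \<in> B" using simplicial_complex_subset[OF B] by blast
    then show ?thesis using subset_doubleton_cases[of G a b] G ab F by auto
  qed
qed

lemma edge_slide_path:
  assumes Y: "simplicial_complex Y" "finite Y" and e: "{e} \<in> Y"
    and Y': "Y' \<subseteq> Y" "\<And>x. x \<in> \<Union>Y' \<Longrightarrow> {x, e} \<notin> Y"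
    and path: "(a, b) \<in> (edge_rel Y')\<^sup>*"
  shows "insert {a, e} Y \<sim> insert {b, e} Y"
  using path
proof (induction rule: rtrancl_induct)
  case base
  show ?case by (rule heq_refl)
next
  case (step c d)
  have cd: "{c, d} \<in> Y'" using step(2) by (simp add: edge_rel_def)
  show ?case
  proof (cases "c = d")
    case False
    have "{c, e} \<notin> Y" "{d, e} \<notin> Y" using cd Y'(2) by blast+
    then have "insert {c, e} Y \<sim> insert {d, e} Y"
      using cd Y' by (intro edge_slide[OF Y _ e] False) auto
    then show ?thesis using heq_trans[OF step(3)] by blast
  qed (use step in simp)
qed

text \<open>\<open>f\<close> says at which vertex of copy \<open>t\<close> the edge to hub
  \<open>x\<close> ends, so that moving the ends means changing \<open>f\<close> alone.\<close>

definition attachments :: "(nat \<Rightarrow> 'a \<Rightarrow> 'j) \<Rightarrow> (nat \<times> 'a) set \<Rightarrow> ('a, 'j) avertex set set" where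
  "attachments f S = (\<lambda>(t, x). {Copy t (f t x), Hub x}) ` S"

lemma attachments_insert:
  "attachments f (insert (t, x) S) = insert {Copy t (f t x), Hub x} (attachments f S)"
  by (simp add: attachments_def)

lemma attachments_mem: "{Copy t j, Hub x} \<in> attachments f S \<longleftrightarrow> (t, x) \<in> S \<and> j = f t x"
proof
  assume "{Copy t j, Hub x} \<in> attachments f S"
  then obtain s y where "(s, y) \<in> S" "{Copy t j, Hub x} = {Copy s (f s y), Hub y}"
    by (auto simp: attachments_def)
  then show "(t, x) \<in> S \<and> j = f t x" by (simp add: doubleton_eq_iff)
next
  assume "(t, x) \<in> S \<and> j = f t x"
  then show "{Copy t j, Hub x} \<in> attachments f S" unfolding attachments_def by force
qed

text \<open>Edges from \<open>S\<close> still end where \<open>f\<close> says, those from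
  \<open>Z\<close> have already been moved to \<open>g\<close>. Each pair of copy and hub carries a
  single edge, so on its way along the connected copy the sliding edge never runs into another
  one.\<close>

lemma attachments_slide:
  fixes B :: "('a, 'j) avertex set set"
  assumes B: "simplicial_complex B" "finite B" and con: "edge_connected L"
    and S: "finite S" and Z: "finite Z" "S \<inter> Z = {}"
    and cop: "\<And>t x. (t, x) \<in> S \<union> Z \<Longrightarrow> (`) (Copy t) ` L \<subseteq> B"
    and hub: "\<And>t x. (t, x) \<in> S \<union> Z \<Longrightarrow> {Hub x} \<in> B"
    and fg: "\<And>t x. (t, x) \<in> S \<union> Z \<Longrightarrow> {f t x} \<in> L \<and> {g t x} \<in> L"
    and free: "\<And>t x j. (t, x) \<in> S \<union> Z \<Longrightarrow> {Copy t j, Hub x} \<notin> B"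
  shows "B \<union> attachments f S \<union> attachments g Z \<sim> B \<union> attachments g S \<union> attachments g Z"
  using S Z cop hub fg free
proof (induction S arbitrary: Z rule: finite_induct)
  case empty
  show ?case by (simp add: heq_refl attachments_def)
next
  case (insert p S)
  obtain t x where p: "p = (t, x)" by (cases p)
  let ?Y = "B \<union> attachments f S \<union> attachments g Z"
  have px: "(t, x) \<notin> S" "(t, x) \<notin> Z" using insert.hyps insert.prems p by auto
  have tx: "(`) (Copy t) ` L \<subseteq> B" "{Hub x} \<in> B" "{f t x} \<in> L" "{g t x} \<in> L"
    "\<And>j. {Copy t j, Hub x} \<notin> B"
    using insert.prems(3-6)[of t x] p by auto
  have sY: "simplicial_complex ?Y"
    unfolding Un_assoc
  proof (rule simplicial_complex_Un_edges[OF B(1)])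
    fix e assume "e \<in> attachments f S \<union> attachments g Z"
    then obtain s y where "(s, y) \<in> S \<union> Z" "e = {Copy s (f s y), Hub y} \<or> e = {Copy s (g s y), Hub y}"
      by (auto simp: attachments_def)
    then have sy: "(s, y) \<in> insert p S \<union> Z" and e: "\<exists>k. {k} \<in> L \<and> e = {Copy s k, Hub y}"
      using insert.prems(5)[of s y] by auto
    obtain k where k: "{k} \<in> L" "e = {Copy s k, Hub y}" using e by blast
    have "Copy s ` {k} \<in> B" using insert.prems(3)[OF sy] k(1) by blast
    then show "\<exists>a b. e = {a, b} \<and> {a} \<in> B \<and> {b} \<in> B"
      using insert.prems(4)[OF sy] k(2) by (intro exI[of _ "Copy s k"] exI[of _ "Hub y"]) simp
  qed
  have finY: "finite ?Y" using B insert by (simp add: attachments_def)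
  have 1: "insert {Copy t (f t x), Hub x} ?Y \<sim> insert {Copy t (g t x), Hub x} ?Y"
  proof (rule edge_slide_path[OF sY finY])
    show "{Hub x} \<in> ?Y" using tx by simp
    show "(`) (Copy t) ` L \<subseteq> ?Y" using tx by blast
    have "(f t x, g t x) \<in> (edge_rel L)\<^sup>*"
      using con tx unfolding edge_connected_def by blast
    then show "(Copy t (f t x), Copy t (g t x)) \<in> (edge_rel ((`) (Copy t) ` L))\<^sup>*"
    proof (induction rule: rtrancl_induct)
      case (step c d)
      have "Copy t ` {c, d} \<in> (`) (Copy t) ` L" using step(2) unfolding edge_rel_def by blast
      then have "(Copy t c, Copy t d) \<in> edge_rel ((`) (Copy t) ` L)" by (simp add: edge_rel_def)
      then show ?case using step(3) by (rule rtrancl_into_rtrancl[rotated])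
    qed simp
    fix y :: "('a, 'j) avertex" assume "y \<in> \<Union>((`) (Copy t) ` L)"
    then obtain j where y: "y = Copy t j" by blast
    show "{y, Hub x} \<notin> ?Y"
      using tx(5)[of j] px unfolding y by (simp add: attachments_mem)
  qed
  have 2: "B \<union> attachments f (insert p S) \<union> attachments g Z = insert {Copy t (f t x), Hub x} ?Y"
    by (simp add: p attachments_insert)
  have 3: "insert {Copy t (g t x), Hub x} ?Y = B \<union> attachments f S \<union> attachments g (insert p Z)"
    by (simp add: p attachments_insert)
  have 4: "B \<union> attachments f S \<union> attachments g (insert p Z) \<sim>
      B \<union> attachments g S \<union> attachments g (insert p Z)"
  proof (rule insert.IH)
    show "S \<inter> insert p Z = {}" using insert.hyps insert.prems by auto
    fix s y assume "(s, y) \<in> S \<union> insert p Z"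
    then have sy: "(s, y) \<in> insert p S \<union> Z" by auto
    show "(`) (Copy s) ` L \<subseteq> B" "{Hub y} \<in> B" "{f s y} \<in> L \<and> {g s y} \<in> L" "\<And>j. {Copy s j, Hub y} \<notin> B"
      using insert.prems(3-6)[OF sy] by auto
  qed (use insert.prems in auto)
  have 5: "B \<union> attachments g S \<union> attachments g (insert p Z) = B \<union> attachments g (insert p S) \<union> attachments g Z"
    by (simp add: p attachments_insert)
  show ?case unfolding 2 5[symmetric] by (rule heq_trans[OF 1[unfolded 3] 4])
qed

lemma rtrancl_crossing:
  assumes "(r, a) \<in> R\<^sup>*" "r \<in> Q" "a \<notin> Q"
  obtains b c where "(b, c) \<in> R" "b \<in> Q" "c \<notin> Q"
  using assms by (induction rule: rtrancl_induct) auto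

text \<open>Edges are slid one after another to the root \<open>r\<close>, until \<open>r\<close> is a neighbour of every node.\<close>

lemma star_at_root:
  fixes B :: "'a set set"
  assumes B: "simplicial_complex B" "finite B" and N: "finite N" "r \<in> N"
    and NB: "\<And>a. a \<in> N \<Longrightarrow> {a} \<in> B" "\<And>a b. a \<in> N \<Longrightarrow> b \<in> N \<Longrightarrow> a \<noteq> b \<Longrightarrow> {a, b} \<notin> B"
    and E: "E \<subseteq> {{a, b} | a b. a \<in> N \<and> b \<in> N \<and> a \<noteq> b}"
    and con: "\<And>a. a \<in> N \<Longrightarrow> (r, a) \<in> (edge_rel E)\<^sup>*"
  shows "\<exists>E'. E' \<subseteq> {{a, b} | a b. a \<in> N \<and> b \<in> N \<and> a \<noteq> b} \<and> (\<forall>a\<in>N - {r}. {a, r} \<in> E') \<and> B \<union> E \<sim> B \<union> E'"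
  using E con
proof (induction "card {a \<in> N - {r}. {a, r} \<notin> E}" arbitrary: E rule: less_induct)
  case less
  note E = less.prems(1) and con = less.prems(2)
  let ?P = "{{a, b} | a b. a \<in> N \<and> b \<in> N \<and> a \<noteq> b}"
  show ?case
  proof (cases "\<forall>a\<in>N - {r}. {a, r} \<in> E")
    case True
    then show ?thesis using E heq_refl by blast
  next
    case False
    then obtain a where a: "a \<in> N" "a \<noteq> r" "{a, r} \<notin> E" by blast
    \<comment> \<open>\<open>r\<close> and its present neighbours. A path from \<open>r\<close> to a
      node that is not a neighbour leaves \<open>Q\<close> by some edge \<open>{b, c}\<close>, whose
      end \<open>b\<close> can be slid to \<open>r\<close> along \<open>{b, r}\<close>.\<close>
    define Q where "Q = {x. x = r \<or> {x, r} \<in> E}"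
    obtain b c where bc: "(b, c) \<in> edge_rel E" "b \<in> Q" "c \<notin> Q"
      using rtrancl_crossing[OF con[OF a(1)], of Q] a by (auto simp: Q_def)
    have bcE: "{b, c} \<in> E" using bc(1) by (simp add: edge_rel_def)
    then obtain b' c' where bc': "{b, c} = {b', c'}" "b' \<in> N" "c' \<in> N" "b' \<noteq> c'" using E by blast
    then have bcN: "b \<in> N" "c \<in> N" "b \<noteq> c" by (auto simp: doubleton_eq_iff)
    have cr: "c \<noteq> r" "{c, r} \<notin> E" using bc(3) by (auto simp: Q_def)
    have "b \<noteq> r" using cr bcE by (auto simp: insert_commute)
    then have br: "{b, r} \<in> E" using bc(2) by (auto simp: Q_def)
    define E0 where "E0 = E - {{b, c}}"
    define E'' where "E'' = insert {r, c} E0"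
    have brE0: "{b, r} \<in> E0" using br cr bcN by (auto simp: E0_def doubleton_eq_iff)
    have pair: "\<exists>x y. e = {x, y} \<and> {x} \<in> B \<and> {y} \<in> B" if "e \<in> E" for e
    proof -
      have "e \<in> ?P" using that E by blast
      then obtain x y where "e = {x, y}" "x \<in> N" "y \<in> N" by blast
      then show ?thesis using NB(1) by blast
    qed
    have finE: "finite E"
    proof (rule finite_subset[OF E])
      show "finite ?P" using N by (intro finite_subset[of ?P "Pow N"]) auto
    qed
    have "insert {b, c} (B \<union> E0) \<sim> insert {r, c} (B \<union> E0)"
    proof (rule edge_slide)
      show "simplicial_complex (B \<union> E0)"
        using pair by (intro simplicial_complex_Un_edges[OF B(1)]) (auto simp: E0_def)
      show "finite (B \<union> E0)" using B finE by (simp add: E0_def)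
      show "{b, r} \<in> B \<union> E0" using brE0 by simp
      show "{c} \<in> B \<union> E0" using NB(1) bcN by simp
      show "{b, c} \<notin> B \<union> E0" using NB(2) bcN by (simp add: E0_def)
      show "{r, c} \<notin> B \<union> E0" using NB(2)[OF N(2) bcN(2)] cr by (auto simp: E0_def insert_commute)
    qed fact
    moreover have "insert {b, c} (B \<union> E0) = B \<union> E" using bcE by (auto simp: E0_def)
    moreover have "insert {r, c} (B \<union> E0) = B \<union> E''" by (simp add: E''_def)
    ultimately have 1: "B \<union> E \<sim> B \<union> E''" by simp
    \<comment> \<open>The lost edge \<open>{b, c}\<close> is replaced by the detour through
      \<open>r\<close>, so every node remains reachable.\<close>
    have sub: "edge_rel E \<subseteq> (edge_rel E'')\<^sup>*"
    proof
      fix p assume p: "p \<in> edge_rel E"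
      obtain x y where xy: "p = (x, y)" by (cases p)
      have e: "(b, r) \<in> edge_rel E''" "(r, b) \<in> edge_rel E''" "(r, c) \<in> edge_rel E''" "(c, r) \<in> edge_rel E''"
        using brE0 by (auto simp: edge_rel_def E''_def insert_commute)
      show "p \<in> (edge_rel E'')\<^sup>*"
      proof (cases "{x, y} = {b, c}")
        case True
        then have "p = (b, c) \<or> p = (c, b)" by (auto simp: xy doubleton_eq_iff)
        then show ?thesis using e by (meson converse_rtrancl_into_rtrancl r_into_rtrancl)
      next
        case False
        then have "p \<in> edge_rel E''" using p by (simp add: xy edge_rel_def E''_def E0_def)
        then show ?thesis by blast
      qed
    qed
    have "\<exists>E'. E' \<subseteq> ?P \<and> (\<forall>a\<in>N - {r}. {a, r} \<in> E') \<and> B \<union> E'' \<sim> B \<union> E'"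
    proof (rule less.hyps)
      have "{a \<in> N - {r}. {a, r} \<notin> E''} \<subset> {a \<in> N - {r}. {a, r} \<notin> E}"
      proof
        show "{a \<in> N - {r}. {a, r} \<notin> E''} \<subseteq> {a \<in> N - {r}. {a, r} \<notin> E}"
        proof
          fix x assume x: "x \<in> {a \<in> N - {r}. {a, r} \<notin> E''}"
          have "{x, r} \<noteq> {b, c}" using \<open>b \<noteq> r\<close> cr by (auto simp: doubleton_eq_iff)
          then show "x \<in> {a \<in> N - {r}. {a, r} \<notin> E}" using x by (auto simp: E''_def E0_def)
        qed
        have "c \<in> {a \<in> N - {r}. {a, r} \<notin> E}" using cr bcN by simp
        moreover have "c \<notin> {a \<in> N - {r}. {a, r} \<notin> E''}" by (simp add: E''_def insert_commute)
        ultimately show "{a \<in> N - {r}. {a, r} \<notin> E''} \<noteq> {a \<in> N - {r}. {a, r} \<notin> E}" by blast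
      qed
      then show "card {a \<in> N - {r}. {a, r} \<notin> E''} < card {a \<in> N - {r}. {a, r} \<notin> E}"
        using N by (intro psubset_card_mono) auto
      have "{r, c} \<in> ?P" using bcN(2) N(2) cr(1) by blast
      then show "E'' \<subseteq> ?P" using E by (auto simp: E''_def E0_def)
      show "(r, x) \<in> (edge_rel E'')\<^sup>*" if "x \<in> N" for x
        using con[OF that] rtrancl_subset_rtrancl[OF sub] by blast
    qed
    then show ?thesis using heq_trans[OF 1] by blast
  qed
qed

definition circle :: "('a, 'j) avertex \<Rightarrow> nat \<Rightarrow> ('a, 'j) avertex set set" where
  "circle r j = {{Arc j False}, {Arc j True}, {r, Arc j False}, {Arc j False, Arc j True}, {Arc j True, r}}"

lemma simplicial_complex_Un_circle:
  assumes "simplicial_complex Y" "{r} \<in> Y"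
  shows "simplicial_complex (Y \<union> circle r j)"
proof -
  have e: "{} \<in> Y" using simplicial_complex_subset[OF assms] by simp
  have eq: "Y \<union> circle r j = insert {Arc j True, r} (insert {Arc j False, Arc j True} (insert {r, Arc j False}
      (insert {Arc j True} (insert {Arc j False} Y))))" by (auto simp: circle_def)
  show ?thesis
    unfolding eq using assms e
    by (intro simplicial_complex_add_edge simplicial_complex_add_vertex) auto
qed

text \<open>Both ends of each edge are joined to \<open>r\<close> inside \<open>B\<close>, which
  allows the edges to be treated one at a time. \<open>l\<close> is the first free circle number;
  raising it at every step keeps the vertices of later circles fresh.\<close>

lemma edges_to_circles:
  assumes "finite E" "simplicial_complex B" "finite B"
    and "\<And>e. e \<in> E \<Longrightarrow> e \<notin> B \<and> (\<exists>a b. e = {a, b} \<and> a \<noteq> b \<and> a \<noteq> r \<and> b \<noteq> r \<and> {a, r} \<in> B \<and> {b, r} \<in> B)"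
    and "{r} \<in> B" "\<And>G j b. G \<in> B \<Longrightarrow> l \<le> j \<Longrightarrow> Arc j b \<notin> G"
  shows "B \<union> E \<sim> B \<union> (\<Union>j\<in>{l..<l + card E}. circle r j)"
  using assms
proof (induction E arbitrary: B l rule: finite_induct)
  case empty
  then show ?case by (simp add: heq_refl)
next
  case (insert e E)
  obtain a b where ab: "e = {a, b}" "a \<noteq> b" "a \<noteq> r" "b \<noteq> r" "{a, r} \<in> B" "{b, r} \<in> B" "e \<notin> B"
    using insert.prems(3)[of e] by blast
  have vert: "{x} \<in> B" if "{x, r} \<in> B" for x
    using simplicial_complex_subset[OF insert.prems(1) that] by simp
  have noArc: "Arc l c \<notin> G" if "G \<in> B \<union> E" for G c
  proof (cases "G \<in> B")
    case True
    then show ?thesis using insert.prems(5) by blast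
  next
    case False
    then obtain a b where "G = {a, b}" "{a, r} \<in> B" "{b, r} \<in> B" using \<open>G \<in> B \<union> E\<close> insert.prems(3)[of G] by auto
    then show ?thesis using insert.prems(5)[of "{a, r}" l c] insert.prems(5)[of "{b, r}" l c] by auto
  qed
  have sY: "simplicial_complex (B \<union> E)"
  proof (rule simplicial_complex_Un_edges[OF insert.prems(1)])
    fix e assume "e \<in> E"
    then show "\<exists>a b. e = {a, b} \<and> {a} \<in> B \<and> {b} \<in> B" using insert.prems(3)[of e] vert by blast
  qed
  have "insert {a, b} (B \<union> E) \<sim> (B \<union> E) \<union> {{Arc l False}, {Arc l True}, {r, Arc l False}, {Arc l False, Arc l True}, {Arc l True, r}}"
  proof (rule edge_to_circle[OF sY])
    show "finite (B \<union> E)" using insert by simp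
    show "{a, b} \<notin> B \<union> E" using ab insert.hyps by simp
    show "Arc l False \<notin> \<Union>(B \<union> E)" "Arc l True \<notin> \<Union>(B \<union> E)" using noArc by blast+
  qed (use ab in auto)
  then have 1: "B \<union> insert e E \<sim> (B \<union> circle r l) \<union> E"
    by (simp add: ab(1) circle_def Un_ac)
  have new: "e' \<notin> circle r l" if "e' \<in> E" for e'
  proof
    assume "e' \<in> circle r l"
    then have "Arc l False \<in> e' \<or> Arc l True \<in> e'" by (auto simp: circle_def)
    then show False using noArc[of e'] that by blast
  qed
  have 2: "(B \<union> circle r l) \<union> E \<sim> (B \<union> circle r l) \<union> (\<Union>j\<in>{Suc l..<Suc l + card E}. circle r j)"
  proof (rule insert.IH)
    show "simplicial_complex (B \<union> circle r l)"
      using insert.prems by (intro simplicial_complex_Un_circle) auto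
    show "finite (B \<union> circle r l)" using insert.prems by (simp add: circle_def)
    show "e' \<notin> B \<union> circle r l \<and> (\<exists>a b. e' = {a, b} \<and> a \<noteq> b \<and> a \<noteq> r \<and> b \<noteq> r \<and> {a, r} \<in> B \<union> circle r l \<and> {b, r} \<in> B \<union> circle r l)"
      if "e' \<in> E" for e'
      using insert.prems(3)[of e'] new[OF that] that by blast
    show "{r} \<in> B \<union> circle r l" using insert.prems by simp
    fix G j b assume G: "G \<in> B \<union> circle r l" and j: "Suc l \<le> j"
    show "Arc j b \<notin> G"
    proof (cases "G \<in> B")
      case True
      then show ?thesis using insert.prems(5) j by simp
    next
      case False
      then have "G \<in> circle r l" using G by simp
      moreover have "Arc j b \<noteq> r" using insert.prems(5)[OF insert.prems(4), of j b] j by auto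
      ultimately show ?thesis using j by (auto simp: circle_def)
    qed
  qed
  have "{l..<l + card (insert e E)} = insert l {Suc l..<Suc l + card E}"
    using insert.hyps by auto
  then have "(B \<union> circle r l) \<union> (\<Union>j\<in>{Suc l..<Suc l + card E}. circle r j)
      = B \<union> (\<Union>j\<in>{l..<l + card (insert e E)}. circle r j)" by auto
  then show ?case using heq_trans[OF 1 2] by simp
qed

section \<open>The standard form of a wedge\<close>

lemma simplicial_complex_Un:
  "simplicial_complex A \<Longrightarrow> simplicial_complex B \<Longrightarrow> simplicial_complex (A \<union> B)"
  unfolding simplicial_complex_def by (metis Un_iff)

lemma simplicial_complex_UN:
  "(\<And>i. i \<in> I \<Longrightarrow> simplicial_complex (A i)) \<Longrightarrow> simplicial_complex (\<Union>i\<in>I. A i)"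
  unfolding simplicial_complex_def by (metis UN_iff)

lemma simplicial_complex_Un_vertices:
  assumes "simplicial_complex B" "{} \<in> B"
  shows "simplicial_complex (B \<union> {{f x} | x. P x})"
  unfolding simplicial_complex_def
proof (intro conjI ballI allI impI)
  fix F assume F: "F \<in> B \<union> {{f x} | x. P x}"
  then show "finite F" using simplicial_complex_finite[OF assms(1)] by auto
  fix G assume G: "G \<subseteq> F"
  show "G \<in> B \<union> {{f x} | x. P x}"
  proof (cases "F \<in> B")
    case True
    then show ?thesis using simplicial_complex_subset[OF assms(1) _ G] by simp
  next
    case False
    then obtain x where "F = {f x}" using F by blast
    then have "G = {} \<or> G = F" using G by blast
    then show ?thesis using F assms(2) by auto
  qed
qed

lemma simplicial_complex_Diff:
  assumes "simplicial_complex X" "\<And>F G. F \<in> R \<Longrightarrow> G \<in> X \<Longrightarrow> F \<subseteq> G \<Longrightarrow> G \<in> R"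
  shows "simplicial_complex (X - R)"
  using assms unfolding simplicial_complex_def by blast

lemma simplicial_complex_empty_face:
  "simplicial_complex X \<Longrightarrow> v \<in> \<Union>X \<Longrightarrow> {} \<in> X" "simplicial_complex X \<Longrightarrow> v \<in> \<Union>X \<Longrightarrow> {v} \<in> X"
  unfolding simplicial_complex_def by blast+

lemma simplicial_copies: "simplicial_complex L \<Longrightarrow> simplicial_complex (copies L n)"
  unfolding copies_def by (intro simplicial_complex_UN simplicial_complex_image)

lemma finite_copies: "finite L \<Longrightarrow> finite (copies L n)"
  unfolding copies_def by simp

lemma copies_mem: "t < n \<Longrightarrow> F \<in> L \<Longrightarrow> Copy t ` F \<in> copies L n"
  unfolding copies_def by blast

lemma copiesE:
  assumes "F \<in> copies L n"
  obtains t \<sigma> where "t < n" "\<sigma> \<in> L" "F = Copy t ` \<sigma>"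
  using assms unfolding copies_def by blast

text \<open>A wedge whose copies are kept disjoint and tied to \<open>Hub r\<close> by edges at
  \<open>v\<close>, so that a move inside one copy does not touch the others.\<close>

definition wedge_form :: "'j set set \<Rightarrow> 'j \<Rightarrow> nat \<Rightarrow> nat \<Rightarrow> 'a \<Rightarrow> ('a, 'j) avertex set set" where
  "wedge_form L v n l r = copies L n \<union> {{}, {Hub r}} \<union> attachments (\<lambda>_ _. v) ({..<n} \<times> {r})
     \<union> (\<Union>j<l. circle (Hub r) j)"

lemma attachments_const: "attachments (\<lambda>_ _. v) ({..<n} \<times> {r}) = {{Copy t v, Hub r} | t. t < n}"
  unfolding attachments_def by auto

lemma attachments_const_image:
  "attachments (\<lambda>_ _. v) ({..<n} \<times> {r}) = (\<lambda>t. {Copy t v, Hub r}) ` {..<n}"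
  unfolding attachments_def by auto

lemma simplicial_circles:
  assumes "simplicial_complex B" "{r} \<in> B"
  shows "simplicial_complex (B \<union> (\<Union>j<l. circle r j))"
proof (induction l)
  case (Suc l)
  have "B \<union> (\<Union>j<Suc l. circle r j) = (B \<union> (\<Union>j<l. circle r j)) \<union> circle r l"
    by (auto simp: lessThan_Suc)
  then show ?case using simplicial_complex_Un_circle[OF Suc] assms(2) by simp
qed (simp add: assms)

lemma simplicial_pre_wedge_form:
  assumes "simplicial_complex L"
  shows "simplicial_complex (copies L n \<union> {{}, {Hub r}} \<union> (\<Union>j<l. circle (Hub r) j))"
proof (rule simplicial_circles)
  show "simplicial_complex (copies L n \<union> {{}, {Hub r}})"
    by (rule simplicial_complex_Un[OF simplicial_copies[OF assms]]) (auto simp: simplicial_complex_def)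
qed simp

lemma finite_circles: "finite (\<Union>j<l. circle r j)"
  by (simp add: circle_def)

lemma wedge_form_alt:
  "wedge_form L v n l r = (copies L n \<union> {{}, {Hub r}} \<union> (\<Union>j<l. circle (Hub r) j))
     \<union> attachments (\<lambda>_ _. v) ({..<n} \<times> {r})"
  unfolding wedge_form_def by blast

lemma simplicial_wedge_form:
  fixes L :: "'j set set" and r :: 'a
  assumes "simplicial_complex L" "v \<in> \<Union>L"
  shows "simplicial_complex (wedge_form L v n l r)"
  unfolding wedge_form_alt
proof (rule simplicial_complex_Un_edges[OF simplicial_pre_wedge_form[OF assms(1)]])
  fix e assume "e \<in> attachments (\<lambda>_ _. v) ({..<n} \<times> {r})"
  then obtain t where t: "t < n" "e = {Copy t v, Hub r}" by (auto simp: attachments_const)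
  have "(Copy t ` {v} :: ('a, 'j) avertex set) \<in> copies L n"
    using t(1) simplicial_complex_empty_face(2)[OF assms] by (rule copies_mem)
  then show "\<exists>a b. e = {a, b} \<and> {a} \<in> copies L n \<union> {{}, {Hub r}} \<union> (\<Union>j<l. circle (Hub r) j)
      \<and> {b} \<in> copies L n \<union> {{}, {Hub r}} \<union> (\<Union>j<l. circle (Hub r) j)"
    using t(2) by (intro exI[of _ "Copy t v"] exI[of _ "Hub r"]) simp
qed

lemma finite_wedge_form: "finite L \<Longrightarrow> finite (wedge_form L v n l r)"
  unfolding wedge_form_def by (simp add: finite_copies finite_circles attachments_def)

lemma circle_mem_Arc: "F \<in> circle r j \<Longrightarrow> Arc j False \<in> F \<or> Arc j True \<in> F"
  by (auto simp: circle_def)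

lemma circle_no_Copy: "F \<in> circle (Hub r) j \<Longrightarrow> Copy t i \<notin> F"
  by (auto simp: circle_def)

lemma circle_Hub: "F \<in> circle (Hub r) j \<Longrightarrow> Hub x \<in> F \<Longrightarrow> x = r"
  by (auto simp: circle_def)

text \<open>The ties of the copies to the hub slide along the connected \<open>L\<close> from
  \<open>v\<close> to \<open>w\<close>, while the circles stay in place.\<close>

lemma wedge_form_base:
  assumes L: "simplicial_complex L" "finite L" "edge_connected L" and v: "v \<in> \<Union>L" and w: "w \<in> \<Union>L"
  shows "wedge_form L v n l r \<sim> wedge_form L w n l r"
proof -
  let ?B = "copies L n \<union> {{}, {Hub r}} \<union> (\<Union>j<l. circle (Hub r) j)"
  have "?B \<union> attachments (\<lambda>_ _. v) ({..<n} \<times> {r}) \<union> attachments (\<lambda>_ _. w) {}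
      \<sim> ?B \<union> attachments (\<lambda>_ _. w) ({..<n} \<times> {r}) \<union> attachments (\<lambda>_ _. w) {}"
  proof (rule attachments_slide[OF simplicial_pre_wedge_form[OF L(1)] _ L(3)])
    show "finite ?B" using L(2) by (simp add: finite_copies finite_circles)
    fix t x assume "(t, x) \<in> {..<n} \<times> {r} \<union> {}"
    then have tx: "t < n" "x = r" by auto
    show "(`) (Copy t) ` L \<subseteq> ?B" using tx(1) unfolding copies_def by blast
    show "{Hub x} \<in> ?B" using tx by simp
    show "{v} \<in> L \<and> {w} \<in> L" using simplicial_complex_empty_face(2)[OF L(1)] v w by blast
    show "{Copy t j, Hub x} \<notin> ?B" for j
    proof
      assume "{Copy t j, Hub x} \<in> ?B"
      then have "{Copy t j, Hub x} \<in> copies L n \<or> (\<exists>i. {Copy t j, Hub x} \<in> circle (Hub r) i)" by blast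
      then show False
      proof
        assume "{Copy t j, Hub x} \<in> copies L n"
        then obtain s \<sigma> where "{Copy t j, Hub x} = Copy s ` \<sigma>" by (rule copiesE)
        then have "Hub x \<in> Copy s ` \<sigma>" by blast
        then show False by blast
      next
        assume "\<exists>i. {Copy t j, Hub x} \<in> circle (Hub r) i"
        then obtain i where "{Copy t j, Hub x} \<in> circle (Hub r) i" by blast
        from circle_no_Copy[OF this, of t j] show False by simp
      qed
    qed
  qed auto
  then show ?thesis by (simp add: wedge_form_alt attachments_def)
qed

lemma wedge_form_image:
  assumes L: "simplicial_complex L" and v: "v \<in> \<Union>L" and g: "inj_on g (\<Union>L)"
  shows "wedge_form L v n l r \<sim> wedge_form ((`) g ` L) (g v) n l (f r)"
proof -
  let ?g = "map_avertex f g"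
  have gC: "?g ` Copy t ` \<sigma> = Copy t ` g ` \<sigma>" for t \<sigma> by (simp add: image_image)
  have "(`) ?g ` copies L n = copies ((`) g ` L) n"
    unfolding copies_def image_UN by (simp add: image_image)
  moreover have "(`) ?g ` circle (Hub r) j = circle (Hub (f r)) j" for j
    by (simp add: circle_def)
  ultimately have eq: "(`) ?g ` wedge_form L v n l r = wedge_form ((`) g ` L) (g v) n l (f r)"
    unfolding wedge_form_def image_Un image_UN by (simp add: attachments_const_image image_image)
  have "inj_on ?g (\<Union>(wedge_form L v n l r))"
  proof (rule inj_onI)
    define V where "V = \<Union>L"
    have vt: "(\<exists>t j. x = Copy t j \<and> j \<in> V) \<or> x = Hub r \<or> (\<exists>j b. x = Arc j b)"
      if x: "x \<in> \<Union>(wedge_form L v n l r)" for x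
    proof -
      obtain F where F: "F \<in> wedge_form L v n l r" "x \<in> F" using x by blast
      then consider "F \<in> copies L n" | "F \<in> {{}, {Hub r}}" | "F \<in> attachments (\<lambda>_ _. v) ({..<n} \<times> {r})"
        | j where "F \<in> circle (Hub r) j"
        unfolding wedge_form_def by blast
      then show ?thesis
      proof cases
        case 1
        then show ?thesis using F(2) unfolding V_def by (elim copiesE) blast
      next
        case 3
        then show ?thesis using F(2) v by (auto simp: attachments_const V_def)
      next
        case 4
        then show ?thesis using F(2) by (auto simp: circle_def)
      qed (use F(2) in auto)
    qed
    fix x y assume "x \<in> \<Union>(wedge_form L v n l r)" "y \<in> \<Union>(wedge_form L v n l r)" and e: "?g x = ?g y"
    from vt[OF this(1)] vt[OF this(2)] this(3) show "x = y" by (auto dest: inj_onD[OF g[folded V_def]])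
  qed
  from heq_image[OF simplicial_wedge_form[OF L v] this] show ?thesis unfolding eq .
qed

text \<open>The collapse is performed in all copies simultaneously. The only nonempty face that a
  tie shares with its copy is the base vertex, so \<open>{v} \<notin> R\<close> ensures that no tie
  lies above a removed face.\<close>

lemma wedge_form_collapse:
  assumes L: "simplicial_complex L" "finite L" and col: "collapsing L R h \<rho>" and v: "v \<in> \<Union>L" "{v} \<notin> R"
  shows "wedge_form L v n l r \<sim> wedge_form (L - R) v n l r"
proof -
  have R: "R \<subseteq> L" "{} \<notin> R"
    and tog: "\<And>G. G \<in> R \<Longrightarrow> insert (h G) G \<in> R \<and> h (insert (h G) G) = h G
           \<and> G - {h G} \<in> R \<and> h (G - {h G}) = h G \<and> \<rho> (G - {h G}) = \<rho> G"
    and up: "\<And>F G. F \<in> R \<Longrightarrow> G \<in> L \<Longrightarrow> F \<subseteq> G \<Longrightarrow> G \<in> R \<and> (\<rho> F < \<rho> G \<or> \<rho> F = \<rho> G \<and> h F = h G)"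
    using col unfolding collapsing_def by blast+
  \<comment> \<open>On a face of a single copy \<open>cp\<close> recovers the face of
    \<open>L\<close> and \<open>ix\<close> the number of the copy; the toggled vertex and the rank
    are pulled back along them.\<close>
  define cp where "cp G = {j. \<exists>t. Copy t j \<in> G}" for G :: "('b, 'a) avertex set"
  define ix where "ix G = (SOME t. \<exists>j. Copy t j \<in> G)" for G :: "('b, 'a) avertex set"
  define H where "H G = (Copy (ix G) (h (cp G)) :: ('b, 'a) avertex)" for G
  have cp: "cp (Copy t ` F) = F" for t F by (auto simp: cp_def)
  have ix: "ix (Copy t ` F) = t" if "F \<noteq> {}" for t F
    unfolding ix_def using that by (intro some_equality) auto
  have H: "H (Copy t ` F) = Copy t (h F)" if "F \<noteq> {}" for t F
    using ix[OF that] by (simp add: H_def cp)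
  let ?R = "{Copy t ` F | t F. t < n \<and> F \<in> R} :: ('b, 'a) avertex set set"
  show ?thesis
  proof (rule collapse_heq[OF simplicial_wedge_form[OF L(1) v(1)] finite_wedge_form[OF L(2)],
        where R = ?R and h = H and \<rho> = "\<rho> \<circ> cp"])
    show "?R \<subseteq> wedge_form L v n l r"
    proof
      fix G :: "('b, 'a) avertex set" assume "G \<in> ?R"
      then obtain t F where "t < n" "F \<in> R" "G = Copy t ` F" by blast
      then show "G \<in> wedge_form L v n l r" using R copies_mem[of t n F L] by (auto simp: wedge_form_def)
    qed
    show "{} \<notin> ?R" using R by auto
    show "wedge_form (L - R) v n l r = wedge_form L v n l r - ?R"
    proof -
      have 1: "copies (L - R) n = copies L n - ?R" (is "?A = ?C")
      proof (intro equalityI subsetI)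
        fix G assume "G \<in> ?A"
        then obtain t F where G: "t < n" "F \<in> L - R" "G = Copy t ` F" by (rule copiesE)
        have "G \<notin> ?R"
        proof
          assume "G \<in> ?R"
          then obtain s F' where "F' \<in> R" "G = Copy s ` F'" by blast
          then have "F' = F" using cp G(3) by metis
          then show False using G(2) \<open>F' \<in> R\<close> by simp
        qed
        then show "G \<in> ?C" using G copies_mem[of t n F L] by auto
      next
        fix G assume G: "G \<in> ?C"
        then have "G \<in> copies L n" by simp
        then obtain t F where "t < n" "F \<in> L" "G = Copy t ` F" by (rule copiesE)
        then show "G \<in> ?A" using G copies_mem[of t n F "L - R"] by blast
      qed
      have 2: "G \<notin> ?R" if "G \<in> {{}, {Hub r}} \<union> attachments (\<lambda>_ _. v) ({..<n} \<times> {r}) \<union> (\<Union>j<l. circle (Hub r) j)" for G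
      proof
        assume "G \<in> ?R"
        then obtain s F' where F': "F' \<in> R" "G = Copy s ` F'" by blast
        moreover have "F' \<noteq> {}" using F' R by blast
        moreover have "G = {} \<or> Hub r \<in> G \<or> (\<exists>j b. Arc j b \<in> G)"
        proof -
          from that consider "G = {} \<or> G = {Hub r}" | "G \<in> attachments (\<lambda>_ _. v) ({..<n} \<times> {r})"
            | j where "G \<in> circle (Hub r) j" by blast
          then show ?thesis
          proof cases
            case 2
            then show ?thesis by (auto simp: attachments_const)
          next
            case 3
            then show ?thesis using circle_mem_Arc by blast
          qed auto
        qed
        ultimately show False by auto
      qed
      define W :: "('b, 'a) avertex set set"
        where "W = {{}, {Hub r}} \<union> attachments (\<lambda>_ _. v) ({..<n} \<times> {r}) \<union> (\<Union>j<l. circle (Hub r) j)"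
      have W: "wedge_form X v n l r = copies X n \<union> W" for X
        by (simp only: wedge_form_def W_def Un_assoc)
      have "W - ?R = W" using 2 unfolding W_def[symmetric] by (intro equalityI subsetI DiffI) auto
      then show ?thesis by (simp only: W 1 Un_Diff)
    qed
    fix G :: "('b, 'a) avertex set" assume "G \<in> ?R"
    then obtain t F where G: "t < n" "F \<in> R" "G = Copy t ` F" by blast
    have ne: "F \<noteq> {}" "insert (h F) F \<noteq> {}" "F - {h F} \<noteq> {}" using G(2) tog[OF G(2)] R(2) by metis+
    have 1: "insert (H G) G = Copy t ` insert (h F) F" by (simp add: G(3) H[OF ne(1)])
    have 2: "G - {H G} = Copy t ` (F - {h F})" by (auto simp: G(3) H[OF ne(1)])
    show "insert (H G) G \<in> ?R \<and> H (insert (H G) G) = H G \<and> G - {H G} \<in> ?R \<and> H (G - {H G}) = H G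
        \<and> (\<rho> \<circ> cp) (G - {H G}) = (\<rho> \<circ> cp) G"
    proof -
      have "Copy t ` insert (h F) F \<in> ?R" "Copy t ` (F - {h F}) \<in> ?R" using G(1) tog[OF G(2)] by blast+
      then show ?thesis
        unfolding 1 2 unfolding H[OF ne(2)] H[OF ne(3)] unfolding G(3) H[OF ne(1)] o_def cp
        by (simp only: tog[OF G(2)] simp_thms)
    qed
  next
    fix F' G' :: "('b, 'a) avertex set"
    assume FR: "F' \<in> ?R" and GX: "G' \<in> wedge_form L v n l r" and FG: "F' \<subseteq> G'"
    obtain t F where F: "t < n" "F \<in> R" "F' = Copy t ` F" using FR by blast
    obtain j where j: "j \<in> F" using F(2) R by fastforce
    then have jG: "Copy t j \<in> G'" using FG F(3) by blast
    consider "G' \<in> copies L n" | "G' \<in> attachments (\<lambda>_ _. v) ({..<n} \<times> {r})"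
      using GX jG circle_no_Copy unfolding wedge_form_def by fastforce
    then show "G' \<in> ?R \<and> ((\<rho> \<circ> cp) F' < (\<rho> \<circ> cp) G' \<or> (\<rho> \<circ> cp) F' = (\<rho> \<circ> cp) G' \<and> H F' = H G')"
    proof cases
      case 1
      then obtain s G where "s < n" "G \<in> L" "G' = Copy s ` G" by (rule copiesE)
      moreover from this have "s = t" using jG by auto
      ultimately have G: "G \<in> L" "G' = Copy t ` G" by auto
      have "F \<subseteq> G" using FG F(3) G(2) by auto
      then have u: "G \<in> R" "\<rho> F < \<rho> G \<or> \<rho> F = \<rho> G \<and> h F = h G" using up[OF F(2) G(1)] by auto
      have "F \<noteq> {}" "G \<noteq> {}" using u(1) F(2) R by auto
      then show ?thesis using u F(1) H by (auto simp: F(3) G(2) cp)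
    next
      case 2
      then obtain s where s: "G' = {Copy s v, Hub r}" by (auto simp: attachments_const)
      have "i = v" if "i \<in> F" for i
      proof -
        have "Copy t i \<in> G'" using that FG F(3) by blast
        then show ?thesis using s by simp
      qed
      then have "F = {v}" using j by blast
      then show ?thesis using F(2) v(2) by simp
    qed
  qed
qed

section \<open>Connected unions of copies in standard form\<close>

lemma simplicial_exploded_base:
  assumes "simplicial_complex L" "v \<in> \<Union>L" "0 < n"
  shows "simplicial_complex (copies L n \<union> {{Hub x} | x. x \<in> X})"
proof (rule simplicial_complex_Un_vertices[OF simplicial_copies[OF assms(1)]])
  have "{} \<in> L" using simplicial_complex_empty_face(1)[OF assms(1,2)] .
  from copies_mem[OF assms(3) this] show "{} \<in> copies L n" by simp
qed

lemma copies_no_Hub: "F \<in> copies L n \<Longrightarrow> Hub x \<notin> F"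
  by (auto elim: copiesE)

lemma copies_Copy_eq: "F \<in> copies L n \<Longrightarrow> Copy s i \<in> F \<Longrightarrow> Copy t j \<in> F \<Longrightarrow> s = t"
  by (auto elim!: copiesE)

text \<open>Once every joining edge ends at the base vertex of its copy, base vertices and hubs are
  the nodes of a connected graph. Making \<open>r\<close> adjacent to all nodes leaves a star and
  surplus edges: the star provides the ties, the surplus the circles.\<close>

lemma glued_copies_heq_wedge_form:
  fixes L :: "'j set set" and \<phi> :: "nat \<Rightarrow> 'j \<Rightarrow> 'a"
  assumes gl: "glued_copies L n \<phi> {}" and econ: "edge_connected L" and v: "v \<in> \<Union>L" and n: "0 < n"
    and con: "\<And>t. t < n \<Longrightarrow> (0, t) \<in> {(s, t). s < n \<and> t < n \<and> \<phi> s ` \<Union>L \<inter> \<phi> t ` \<Union>L \<noteq> {}}\<^sup>*"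
  shows "\<exists>l r. (\<Union>t<n. (`) (\<phi> t) ` L) \<sim> wedge_form L v n l (r :: 'a)"
proof -
  interpret glued_copies L n \<phi> "{}" by (rule gl)
  define V where "V = \<Union>L"
  note vV = v[folded V_def]
  define VX where "VX = {\<phi> t j | t j. t < n \<and> j \<in> V}"
  define S where "S = {(t, \<phi> t j) | t j. t < n \<and> j \<in> V}"
  \<comment> \<open>Initially the edge to hub \<open>x\<close> ends at the vertex of copy
    \<open>t\<close> that \<open>\<phi> t\<close> sends to \<open>x\<close>.\<close>
  define f where "f t x = the_inv_into V (\<phi> t) x" for t x
  have f: "f t (\<phi> t j) = j" if "t < n" "j \<in> V" for t j
    unfolding f_def using inj[OF that(1), folded V_def] that(2) by (rule the_inv_into_f_f)
  have finV: "finite V"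
    unfolding V_def using L simplicial_complex_finite by blast
  have finS: "finite S"
  proof -
    have "S = (\<lambda>(t, j). (t, \<phi> t j)) ` ({..<n} \<times> V)" by (auto simp: S_def)
    then show ?thesis using finV by simp
  qed
  have finVX: "finite VX"
  proof -
    have "VX = (\<lambda>(t, j). \<phi> t j) ` ({..<n} \<times> V)" by (auto simp: VX_def)
    then show ?thesis using finV by simp
  qed
  define B :: "('a, 'j) avertex set set" where "B = copies L n \<union> {{Hub x} | x. x \<in> VX}"
  have sB: "simplicial_complex B" unfolding B_def by (rule simplicial_exploded_base[OF L(1) v n])
  have finB: "finite B" unfolding B_def using finVX L(2) by (simp add: finite_copies)
  have HubB: "{Hub x} \<in> B" if "x \<in> VX" for x using that by (auto simp: B_def)
  have CopyB: "{Copy t j} \<in> B" if "t < n" "j \<in> V" for t j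
  proof -
    have "{j} \<in> L" using simplicial_complex_empty_face(2)[OF L(1)] that(2) by (simp add: V_def)
    from copies_mem[OF that(1) this] show ?thesis by (simp add: B_def)
  qed
  have Bcases: "F \<in> copies L n \<or> (\<exists>x. F = {Hub x})" if "F \<in> B" for F
    using that by (auto simp: B_def)
  have CHB: "{Copy t j, Hub x} \<notin> B" for t j x
    using Bcases[of "{Copy t j, Hub x}"] copies_no_Hub[of "{Copy t j, Hub x}" L n x] by auto
  have "exploded = B \<union> attachments f S"
  proof -
    have "{{Hub (\<phi> t j) :: ('a, 'j) avertex} | t j. t < n \<and> j \<in> V} = {{Hub x} | x. x \<in> VX}" by (auto simp: VX_def)
    moreover have "{{Copy t j, Hub (\<phi> t j)} | t j. t < n \<and> j \<in> V} = attachments f S" (is "?l = ?r")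
    proof (intro equalityI subsetI)
      fix F assume "F \<in> ?l"
      then obtain t j where tj: "t < n" "j \<in> V" "F = {Copy t j, Hub (\<phi> t j)}" by blast
      have "(t, \<phi> t j) \<in> S" using tj by (auto simp: S_def)
      then show "F \<in> ?r" using tj(3) f[OF tj(1,2)] by (simp add: attachments_mem)
    next
      fix F assume "F \<in> ?r"
      then obtain t x where "(t, x) \<in> S" "F = {Copy t (f t x), Hub x}" by (auto simp: attachments_def)
      then show "F \<in> ?l" using f by (auto simp: S_def)
    qed
    ultimately show ?thesis unfolding exploded_def B_def V_def[symmetric] by (simp add: Un_assoc)
  qed
  then have 1: "total \<sim> B \<union> attachments f S" using total_heq_exploded by simp
  have 2: "B \<union> attachments f S \<union> attachments (\<lambda>_ _. v) {} \<sim> B \<union> attachments (\<lambda>_ _. v) S \<union> attachments (\<lambda>_ _. v) {}"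
  proof (rule attachments_slide[OF sB finB econ finS])
    fix t x assume "(t, x) \<in> S \<union> {}"
    then obtain j where tx: "t < n" "j \<in> V" "x = \<phi> t j" by (auto simp: S_def)
    show "(`) (Copy t) ` L \<subseteq> B" using tx(1) unfolding B_def copies_def by blast
    show "{Hub x} \<in> B" using tx by (intro HubB) (auto simp: VX_def)
    have "{j} \<in> L" if "j \<in> V" for j
      using simplicial_complex_empty_face(2)[OF L(1)] that by (simp add: V_def)
    then show "{f t x} \<in> L \<and> {v} \<in> L" using f[OF tx(1,2)] tx vV by simp
    show "{Copy t j, Hub x} \<notin> B" for j by (rule CHB)
  qed auto
  define E where "E = attachments (\<lambda>_ _. v) S"
  define N where "N = (\<lambda>t. Copy t v) ` {..<n} \<union> Hub ` VX"
  define r0 where "r0 = \<phi> 0 v"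
  define r where "r = (Hub r0 :: ('a, 'j) avertex)"
  have r0: "r0 \<in> VX" using n vV by (auto simp: VX_def r0_def)
  have NB1: "{a} \<in> B" if "a \<in> N" for a
    using that HubB CopyB vV by (auto simp: N_def)
  have NB2: "{a, b} \<notin> B" if abN: "a \<in> N" "b \<in> N" and ne: "a \<noteq> b" for a b
  proof
    assume "{a, b} \<in> B"
    then have c: "{a, b} \<in> copies L n" using Bcases[of "{a, b}"] ne by auto
    obtain s t where "a = Copy s v" "b = Copy t v"
      using abN copies_no_Hub[OF c] by (auto simp: N_def)
    then show False using copies_Copy_eq[OF c, of s v t v] ne by simp
  qed
  have E_S: "{Copy t v, Hub x} \<in> E" if "(t, x) \<in> S" for t x
    using that by (simp add: E_def attachments_mem)
  have edge: "(Copy t v, Hub x) \<in> edge_rel E" "(Hub x, Copy t v) \<in> edge_rel E" if "(t, x) \<in> S" for t x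
    using E_S[OF that] by (simp_all add: edge_rel_def insert_commute)
  have reachC: "(r, Copy t v) \<in> (edge_rel E)\<^sup>*" if "t < n" for t
    using con[OF that]
  proof (induction rule: rtrancl_induct)
    case base
    have "(0, r0) \<in> S" using n vV by (auto simp: S_def r0_def)
    then show ?case unfolding r_def using edge(2) by blast
  next
    case (step s t)
    then obtain x where x: "s < n" "t < n" "x \<in> \<phi> s ` V" "x \<in> \<phi> t ` V" by (auto simp: V_def)
    then have "(s, x) \<in> S" "(t, x) \<in> S" by (auto simp: S_def)
    then show ?case using edge(1)[of s x] edge(2)[of t x] step(3) by (meson rtrancl.rtrancl_into_rtrancl)
  qed
  have reach: "(r, a) \<in> (edge_rel E)\<^sup>*" if a: "a \<in> N" for a
  proof -
    from a consider t where "t < n" "a = Copy t v" | t j where "t < n" "j \<in> V" "a = Hub (\<phi> t j)"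
      by (auto simp: N_def VX_def)
    then show ?thesis
    proof cases
      case 1
      then show ?thesis using reachC by simp
    next
      case 2
      then have "(t, \<phi> t j) \<in> S" by (auto simp: S_def)
      then show ?thesis using edge(1)[of t "\<phi> t j"] reachC[OF 2(1)] 2(3) by (meson rtrancl.rtrancl_into_rtrancl)
    qed
  qed
  let ?P = "{{a, b} | a b. a \<in> N \<and> b \<in> N \<and> a \<noteq> b}"
  have EP: "E \<subseteq> ?P"
  proof
    fix e assume "e \<in> E"
    then obtain t x where tx: "(t, x) \<in> S" "e = {Copy t v, Hub x}" by (auto simp: E_def attachments_def)
    then have "Copy t v \<in> N" "Hub x \<in> N" by (auto simp: S_def N_def VX_def)
    then show "e \<in> ?P" using tx(2) by blast
  qed
  have finN: "finite N" using finVX by (simp add: N_def)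
  have rN: "r \<in> N" using r0 by (simp add: N_def r_def)
  obtain E' where E': "E' \<subseteq> ?P" "\<forall>a\<in>N - {r}. {a, r} \<in> E'" "B \<union> E \<sim> B \<union> E'"
    using star_at_root[OF sB finB finN rN NB1 NB2 EP reach] by blast
  \<comment> \<open>The spokes of the star at \<open>r\<close>; every other edge of
    \<open>E'\<close> closes a triangle with two of them and becomes a circle.\<close>
  define E1 where "E1 = {{a, r} | a. a \<in> N - {r}}"
  define E2 where "E2 = E' - E1"
  define l where "l = card E2"
  have E12: "B \<union> E' = (B \<union> E1) \<union> E2" using E'(2) by (auto simp: E1_def E2_def)
  have finE2: "finite E2"
  proof (rule finite_subset[of _ "Pow N"])
    show "E2 \<subseteq> Pow N" using E'(1) by (auto simp: E2_def)
  qed (simp add: finN)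
  have finE1: "finite E1"
  proof (rule finite_subset[of _ "Pow N"])
    show "E1 \<subseteq> Pow N" using rN by (auto simp: E1_def)
  qed (simp add: finN)
  have sB1: "simplicial_complex (B \<union> E1)"
  proof (rule simplicial_complex_Un_edges[OF sB])
    fix e assume "e \<in> E1"
    then show "\<exists>a b. e = {a, b} \<and> {a} \<in> B \<and> {b} \<in> B" using NB1 rN by (auto simp: E1_def)
  qed
  have 3: "(B \<union> E1) \<union> E2 \<sim> (B \<union> E1) \<union> (\<Union>j\<in>{0..<0 + card E2}. circle r j)"
  proof (rule edges_to_circles[OF finE2 sB1])
    show "finite (B \<union> E1)" using finB finE1 by simp
    show "{r} \<in> B \<union> E1" using NB1[OF rN] by simp
    fix e assume e: "e \<in> E2"
    then obtain a b where ab: "e = {a, b}" "a \<in> N" "b \<in> N" "a \<noteq> b" using E'(1) by (auto simp: E2_def)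
    have "e \<notin> E1" using e by (simp add: E2_def)
    then have "a \<noteq> r" "b \<noteq> r" using ab by (auto simp: E1_def insert_commute)
    moreover have "e \<notin> B \<union> E1" using NB2[OF ab(2-4)] ab(1) \<open>e \<notin> E1\<close> by simp
    ultimately show "e \<notin> B \<union> E1 \<and> (\<exists>a b. e = {a, b} \<and> a \<noteq> b \<and> a \<noteq> r \<and> b \<noteq> r \<and> {a, r} \<in> B \<union> E1 \<and> {b, r} \<in> B \<union> E1)"
      using ab by (auto simp: E1_def)
  next
    fix G j b assume G: "G \<in> B \<union> E1"
    have "Arc j b \<notin> N" by (auto simp: N_def)
    moreover have "Arc j b \<notin> F" if "F \<in> copies L n" for F using that by (auto elim: copiesE)
    ultimately show "Arc j b \<notin> G" using G Bcases[of G] rN by (auto simp: E1_def)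
  qed
  define Z where "Z = (B \<union> E1) \<union> (\<Union>j<l. circle r j)"
  have Zeq: "(B \<union> E1) \<union> (\<Union>j\<in>{0..<0 + card E2}. circle r j) = Z"
    by (simp add: Z_def l_def atLeast0LessThan)
  have sZ: "simplicial_complex Z"
    unfolding Z_def using NB1[OF rN] by (intro simplicial_circles sB1) simp
  have finZ: "finite Z" unfolding Z_def using finB finE1 by (simp add: finite_circles)
  \<comment> \<open>A hub other than \<open>r\<close> now meets nothing but its own spoke, so both
    collapse; the spokes that end at copies are left as ties.\<close>
  define R where "R = {{Hub x} | x. x \<in> VX - {r0}} \<union> {{Hub x, r} | x. x \<in> VX - {r0}}"
  have Zhub: "G = {Hub x} \<or> G = {Hub x, r}" if G: "G \<in> Z" and x: "Hub x \<in> G" "x \<noteq> r0" for G x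
  proof -
    have "G \<in> B \<or> G \<in> E1 \<or> (\<exists>j. G \<in> circle r j)" using G unfolding Z_def by blast
    then consider "G \<in> copies L n" | y where "G = {Hub y}" | a where "G = {a, r}" | j where "G \<in> circle r j"
    proof (elim disjE)
      assume "G \<in> B"
      from Bcases[OF this] that show ?thesis by blast
    next
      assume "G \<in> E1"
      with that(3) show ?thesis unfolding E1_def by blast
    next
      assume "\<exists>j. G \<in> circle r j"
      with that(4) show ?thesis by blast
    qed
    then show ?thesis
    proof cases
      case 1
      from copies_no_Hub[OF this, of x] x(1) show ?thesis by simp
    next
      case 4
      from circle_Hub[OF this[unfolded r_def] x(1)] x(2) show ?thesis by simp
    qed (use x in \<open>auto simp: r_def\<close>)
  qed
  have "wedge_form L v n l r0 = Z - R"
  proof -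
    have inR: "\<exists>x. Hub x \<in> F" "Arc i c \<notin> F" if "F \<in> R" for F i c
      using that by (auto simp: R_def r_def)
    have a: "F \<notin> R" if "F \<in> copies L n" for F
      using inR(1)[of F] copies_no_Hub[OF that] by blast
    have b: "F \<notin> R" if "F \<in> circle r j" for F j
      using inR(2)[of F j] circle_mem_Arc[OF that] by blast
    have c: "{{Hub x} | x. x \<in> VX} - R = {{Hub r0}}" using r0 by (auto simp: R_def r_def doubleton_eq_iff)
    have d: "E1 - R = {{Copy t v, Hub r0} | t. t < n}"
    proof (intro equalityI subsetI)
      fix e assume e: "e \<in> E1 - R"
      then obtain a where a: "a \<in> N" "a \<noteq> r" "e = {a, r}" by (auto simp: E1_def)
      then show "e \<in> {{Copy t v, Hub r0} | t. t < n}"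
        using e by (auto simp: N_def R_def r_def)
    next
      fix e assume "e \<in> {{Copy t v, Hub r0} | t. t < n}"
      then obtain t where t: "t < n" "e = {Copy t v, r}" by (auto simp: r_def)
      moreover have "Copy t v \<in> N - {r}" using t by (auto simp: N_def r_def)
      moreover have "e \<notin> R" using t by (auto simp: R_def r_def doubleton_eq_iff)
      ultimately show "e \<in> E1 - R" by (auto simp: E1_def)
    qed
    have e: "{} \<in> copies L n"
      using copies_mem[OF n simplicial_complex_empty_face(1)[OF L(1) v]] by simp
    have "Z - R = copies L n \<union> ({{Hub x} | x. x \<in> VX} - R) \<union> (E1 - R) \<union> (\<Union>j<l. circle r j)"
    proof -
      have "copies L n - R = copies L n" using a by blast
      moreover have "(\<Union>j<l. circle r j) - R = (\<Union>j<l. circle r j)" using b by blast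
      ultimately show ?thesis unfolding Z_def B_def Un_Diff by simp
    qed
    also have "\<dots> = wedge_form L v n l r0"
      unfolding c d wedge_form_def attachments_const r_def using e by auto
    finally show ?thesis by simp
  qed
  then have 4: "Z \<sim> wedge_form L v n l r0"
  proof (rule collapse_heq_apex[OF sZ finZ, rotated 2, where w = r])
    show "R \<subseteq> Z"
    proof
      fix e assume "e \<in> R"
      then obtain x where x: "x \<in> VX" "x \<noteq> r0" "e = {Hub x} \<or> e = {Hub x, r}" by (auto simp: R_def)
      then have "Hub x \<in> N - {r}" by (auto simp: N_def r_def)
      then have "{Hub x, r} \<in> E1" by (auto simp: E1_def)
      then show "e \<in> Z" using x HubB[OF x(1)] by (auto simp: Z_def)
    qed
    show "{} \<notin> R" by (auto simp: R_def)
    fix G assume "G \<in> R"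
    then obtain x where x: "x \<in> VX - {r0}" "G = {Hub x} \<or> G = {Hub x, r}" by (auto simp: R_def)
    have "Hub x \<noteq> r" using x by (auto simp: r_def)
    then have "insert r G = {Hub x, r}" "G - {r} = {Hub x}" using x(2) by auto
    then show "insert r G \<in> R \<and> G - {r} \<in> R" using x(1) by (auto simp: R_def)
  next
    fix F G assume "F \<in> R" "G \<in> Z" "F \<subseteq> G"
    then obtain x where x: "x \<in> VX - {r0}" "Hub x \<in> G" by (auto simp: R_def)
    then show "G \<in> R" using Zhub[OF \<open>G \<in> Z\<close> x(2)] by (auto simp: R_def)
  qed
  have "total \<sim> wedge_form L v n l r0"
    using heq_trans[OF 1 heq_trans[OF _ heq_trans[OF E'(3) heq_trans[OF _ 4]]]] 2 3
    unfolding Zeq E12 E_def by (simp add: attachments_def)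
  then show ?thesis unfolding total_def by auto
qed

section \<open>The wedge complex in standard form\<close>

lemma subsets_card_le_2:
  assumes "a \<noteq> b" "a \<noteq> c" "b \<noteq> c"
  shows "{F. F \<subseteq> {a, b, c} \<and> card F \<le> 2} = {{}, {a}, {b}, {c}, {a, b}, {b, c}, {c, a}}"
proof (intro equalityI subsetI)
  fix F assume F: "F \<in> {F. F \<subseteq> {a, b, c} \<and> card F \<le> 2}"
  have "card {a, b, c} = 3" using assms by simp
  then have "F \<noteq> {a, b, c}" using F by fastforce
  have sub: "F \<subseteq> {a, b, c}" using F by simp
  have "a \<notin> F \<or> b \<notin> F \<or> c \<notin> F"
  proof (rule ccontr)
    assume "\<not> (a \<notin> F \<or> b \<notin> F \<or> c \<notin> F)"
    then have "{a, b, c} \<subseteq> F" by simp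
    then show False using equalityI[OF sub] \<open>F \<noteq> {a, b, c}\<close> by blast
  qed
  then have "F \<subseteq> {a, b} \<or> F \<subseteq> {b, c} \<or> F \<subseteq> {c, a}"
  proof (elim disjE)
    assume "a \<notin> F"
    then have "F \<subseteq> {b, c}" using sub by blast
    then show ?thesis by simp
  next
    assume "b \<notin> F"
    then have "F \<subseteq> {c, a}" using sub by blast
    then show ?thesis by simp
  next
    assume "c \<notin> F"
    then have "F \<subseteq> {a, b}" using sub by blast
    then show ?thesis by simp
  qed
  then show "F \<in> {{}, {a}, {b}, {c}, {a, b}, {b, c}, {c, a}}" by - (elim disjE; drule subset_doubleton_cases; elim disjE; simp)
qed (auto simp: card_insert_if)

text \<open>The wedge is itself a union of glued copies: two copies share only \<open>None\<close>,
  and the circles play the part of \<open>Q\<close>. In its exploded form the hub of any other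
  vertex of a copy is joined to that vertex alone, and such leaves collapse.\<close>

lemma wedge_complex_heq_wedge_form:
  fixes K :: "'j set set" and r :: 'a
  assumes K: "simplicial_complex K" "finite K" and v: "v \<in> \<Union>K" and n: "0 < n"
  shows "wedge_complex K v n l \<sim> wedge_form K v n l r"
proof -
  define Q :: "('j \<times> nat + nat \<times> bool) option set set" where
    "Q = (\<Union>j<l. {F. F \<subseteq> {None, Some (Inr (j, False)), Some (Inr (j, True))} \<and> card F \<le> 2})"
  have Qj: "{F. F \<subseteq> {None, Some (Inr (j, False)), Some (Inr (j, True))} \<and> card F \<le> 2} =
    {{}, {None}, {Some (Inr (j, False))}, {Some (Inr (j, True))}, {None, Some (Inr (j, False))},
      {Some (Inr (j, False)), Some (Inr (j, True))}, {Some (Inr (j, True)), None}}" for j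
    by (rule subsets_card_le_2) auto
  have Qno: "Some (Inl p) \<notin> F" if "F \<in> Q" for F p
    using that unfolding Q_def by blast
  have sQ: "simplicial_complex Q"
    unfolding Q_def
  proof (rule simplicial_complex_UN)
    fix j
    show "simplicial_complex {F. F \<subseteq> {None :: ('j \<times> nat + nat \<times> bool) option, Some (Inr (j, False)), Some (Inr (j, True))} \<and> card F \<le> 2}"
      unfolding simplicial_complex_def
    proof (intro conjI ballI allI impI)
      fix F :: "('j \<times> nat + nat \<times> bool) option set"
      assume F: "F \<in> {F. F \<subseteq> {None, Some (Inr (j, False)), Some (Inr (j, True))} \<and> card F \<le> 2}"
      then show fF: "finite F" using finite_subset[of F "{None, Some (Inr (j, False)), Some (Inr (j, True))}"] by simp
      fix G assume "G \<subseteq> F"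
      moreover from this have "card G \<le> card F" using fF by (simp add: card_mono)
      ultimately show "G \<in> {F. F \<subseteq> {None, Some (Inr (j, False)), Some (Inr (j, True))} \<and> card F \<le> 2}"
        using F by (simp only: mem_Collect_eq) (meson order_trans)
    qed
  qed
  have finQ: "finite Q" unfolding Q_def Qj by simp
  interpret glued_copies K n "wedge_emb v" Q
  proof
    show "inj_on (wedge_emb v t) (\<Union>K)" for t
      by (rule inj_onI) (auto simp: wedge_emb_def split: if_splits)
    show "j = k" if "s \<noteq> t" "wedge_emb v s j = wedge_emb v t j'" "wedge_emb v s k = wedge_emb v t k'" for s t j k j' k'
      using that by (auto simp: wedge_emb_def split: if_splits)
    show "j = k" if "F \<in> Q" "wedge_emb v t j \<in> F" "wedge_emb v t k \<in> F" for t j k F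
      using that Qno[OF that(1)] by (auto simp: wedge_emb_def split: if_splits)
  qed (use K sQ finQ in auto)
  have tot: "total = wedge_complex K v n l"
    unfolding total_def wedge_complex_def unfolding Q_def ..
  define V where "V = \<Union>K"
  note vV = v[folded V_def]
  define leaf where "leaf t j = (Hub (Some (Inl (j, t))) :: (('j \<times> nat + nat \<times> bool) option, 'j) avertex)" for t j
  define R where "R = {{leaf t j} | t j. t < n \<and> j \<in> V - {v}} \<union> {{Copy t j, leaf t j} | t j. t < n \<and> j \<in> V - {v}}"
  define Y :: "(('j \<times> nat + nat \<times> bool) option, 'j) avertex set set" where
    "Y = copies K n \<union> {{Hub None}} \<union> {{Copy t v, Hub None} | t. t < n} \<union> (`) Hub ` Q"
  have emb: "Hub (wedge_emb v t j) = (if j = v then Hub None else leaf t j)" for t j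
    by (simp add: wedge_emb_def leaf_def)
  have exp: "exploded = Y \<union> R"
  proof -
    have "{{Hub (wedge_emb v t j) :: (('j \<times> nat + nat \<times> bool) option, 'j) avertex} | t j. t < n \<and> j \<in> V}
        = {{Hub None}} \<union> {{leaf t j} | t j. t < n \<and> j \<in> V - {v}}"
      using vV n by (auto simp: emb)
    moreover have "{{Copy t j, Hub (wedge_emb v t j) :: (('j \<times> nat + nat \<times> bool) option, 'j) avertex} | t j. t < n \<and> j \<in> V}
        = {{Copy t v, Hub None} | t. t < n} \<union> {{Copy t j, leaf t j} | t j. t < n \<and> j \<in> V - {v}}"
      using vV by (auto simp: emb)
    ultimately show ?thesis unfolding exploded_def V_def[symmetric] Y_def R_def by (simp add: Un_ac)
  qed
  have leafY: "leaf t j \<notin> G" if "G \<in> Y" for t j G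
  proof -
    from that consider "G \<in> copies K n" | "G = {Hub None}" | t where "G = {Copy t v, Hub None}" | q where "q \<in> Q" "G = Hub ` q"
      unfolding Y_def by blast
    then show ?thesis
    proof cases
      case 1
      then show ?thesis using copies_no_Hub by (simp add: leaf_def)
    next
      case 4
      then show ?thesis using Qno by (auto simp: leaf_def)
    qed (auto simp: leaf_def)
  qed
  have leafR: "\<exists>t j. t < n \<and> j \<in> V - {v} \<and> leaf t j \<in> G" if "G \<in> R" for G
    using that by (auto simp: R_def)
  have Yeq: "Y = exploded - R"
    unfolding exp using leafY leafR by blast
  have sexp: "simplicial_complex exploded"
  proof -
    have "exploded = (copies K n \<union> {{Hub x} | x. x \<in> {wedge_emb v t j | t j. t < n \<and> j \<in> V}} \<union> (`) Hub ` Q)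
      \<union> {{Copy t j, Hub (wedge_emb v t j)} | t j. t < n \<and> j \<in> V}"
      unfolding exploded_def V_def[symmetric] by auto
    also have "simplicial_complex \<dots>"
    proof (rule simplicial_complex_Un_edges)
      show "simplicial_complex (copies K n \<union> {{Hub x} | x. x \<in> {wedge_emb v t j | t j. t < n \<and> j \<in> V}} \<union> (`) Hub ` Q)"
        by (intro simplicial_complex_Un simplicial_exploded_base[OF K(1) v n] simplicial_complex_image sQ)
      fix e :: "(('j \<times> nat + nat \<times> bool) option, 'j) avertex set"
      assume "e \<in> {{Copy t j, Hub (wedge_emb v t j)} | t j. t < n \<and> j \<in> V}"
      then obtain t j where tj: "t < n" "j \<in> V" "e = {Copy t j, Hub (wedge_emb v t j)}" by blast
      have "{j} \<in> K" using simplicial_complex_empty_face(2)[OF K(1)] tj(2) by (simp add: V_def)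
      from copies_mem[OF tj(1) this]
      have "{Copy t j :: (('j \<times> nat + nat \<times> bool) option, 'j) avertex} \<in> copies K n" by simp
      then show "\<exists>a b. e = {a, b}
        \<and> {a} \<in> copies K n \<union> {{Hub x} | x. x \<in> {wedge_emb v t j | t j. t < n \<and> j \<in> V}} \<union> (`) Hub ` Q
        \<and> {b} \<in> copies K n \<union> {{Hub x} | x. x \<in> {wedge_emb v t j | t j. t < n \<and> j \<in> V}} \<union> (`) Hub ` Q"
        using tj by (intro exI[of _ "Copy t j"] exI[of _ "Hub (wedge_emb v t j)"]) auto
    qed
    finally show ?thesis .
  qed
  have finexp: "finite exploded"
    using exploded_eq finite_cylinder by simp
  have upR: "G = {leaf t j} \<or> G = {Copy t j, leaf t j}" if "G \<in> exploded" "leaf t j \<in> G" for G t j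
    using that leafY unfolding exp by (auto simp: R_def leaf_def)
  define h where "h G = (let p = (SOME p. Hub (Some (Inl p)) \<in> G) in Copy (snd p) (fst p) :: (('j \<times> nat + nat \<times> bool) option, 'j) avertex)"
    for G :: "(('j \<times> nat + nat \<times> bool) option, 'j) avertex set"
  have h: "h {leaf t j} = Copy t j" "h {Copy t j, leaf t j} = Copy t j" for t j
    by (simp_all add: h_def leaf_def)
  have Rcases: "\<exists>t j. t < n \<and> j \<in> V - {v} \<and> (G = {leaf t j} \<or> G = {Copy t j, leaf t j})" if "G \<in> R" for G
    using that by (auto simp: R_def)
  have RI: "{leaf t j} \<in> R" "{Copy t j, leaf t j} \<in> R" if "t < n" "j \<in> V - {v}" for t j
    using that by (auto simp: R_def)
  have 1: "exploded \<sim> Y"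
  proof (rule collapse_heq[OF sexp finexp _ _ Yeq, where h = h and \<rho> = "\<lambda>_. 0"])
    show "R \<subseteq> exploded" by (simp add: exp)
    show "{} \<notin> R" by (auto simp: R_def)
    fix G assume "G \<in> R"
    then obtain t j where tj: "t < n" "j \<in> V - {v}" "G = {leaf t j} \<or> G = {Copy t j, leaf t j}"
      using Rcases by blast
    have hG: "h G = Copy t j" using tj(3) h by auto
    have "insert (h G) G = {Copy t j, leaf t j}" "G - {h G} = {leaf t j}"
      using tj(3) unfolding hG by (auto simp: leaf_def)
    then show "insert (h G) G \<in> R \<and> h (insert (h G) G) = h G \<and> G - {h G} \<in> R \<and> h (G - {h G}) = h G
        \<and> (0 :: nat) = 0"
      using RI[OF tj(1,2)] h hG by simp
  next
    fix F G assume "F \<in> R" "G \<in> exploded" "F \<subseteq> G"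
    then obtain t j where tj: "t < n" "j \<in> V - {v}" "F = {leaf t j} \<or> F = {Copy t j, leaf t j}"
      using Rcases by blast
    then have "leaf t j \<in> G" using \<open>F \<subseteq> G\<close> by blast
    then have "G = {leaf t j} \<or> G = {Copy t j, leaf t j}" using upR[OF \<open>G \<in> exploded\<close>] by blast
    then show "G \<in> R \<and> ((0 :: nat) < 0 \<or> (0 :: nat) = 0 \<and> h F = h G)"
      using RI[OF tj(1,2)] h tj(3) by auto
  qed
  \<comment> \<open>On the vertices left in \<open>Y\<close> this turns the hubs of circles into
    arcs and \<open>None\<close> into \<open>r\<close>; the default case is reached there by
    \<open>Hub None\<close> only.\<close>
  define g :: "(('j \<times> nat + nat \<times> bool) option, 'j) avertex \<Rightarrow> ('a, 'j) avertex" where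
    "g x = (case x of Copy t j \<Rightarrow> Copy t j | Hub (Some (Inr (j, b))) \<Rightarrow> Arc j b | _ \<Rightarrow> Hub r)" for x
  have g: "g (Copy t j) = Copy t j" "g (Hub None) = Hub r" "g (Hub (Some (Inr (i, b)))) = Arc i b" for t j i b
    by (simp_all add: g_def)
  have gY: "(`) g ` Y = wedge_form K v n l r"
  proof -
    have "(`) g ` copies K n = copies K n"
      unfolding copies_def image_UN by (simp add: image_image g)
    moreover have "(`) g ` {{Copy t v, Hub None} | t. t < n} = attachments (\<lambda>_ _. v) ({..<n} \<times> {r})"
    proof -
      have "{{Copy t v, Hub None} | t. t < n} = (\<lambda>t. {Copy t v, Hub None :: (('j \<times> nat + nat \<times> bool) option, 'j) avertex}) ` {..<n}" by auto
      then show ?thesis by (simp add: attachments_const_image image_image g)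
    qed
    moreover have "(`) g ` (`) Hub ` Q = (\<Union>j<l. {{}, {Hub r}} \<union> circle (Hub r) j)"
      unfolding Q_def Qj image_UN circle_def by (simp add: g) blast
    moreover have "{} \<in> copies K n"
      using copies_mem[OF n simplicial_complex_empty_face(1)[OF K(1) v]] by simp
    ultimately show ?thesis
      unfolding Y_def wedge_form_def image_Un by (auto simp: g)
  qed
  have "inj_on g (\<Union>Y)"
  proof (rule inj_onI)
    fix x y assume "x \<in> \<Union>Y" "y \<in> \<Union>Y" and e: "g x = g y"
    then have "\<nexists>p. x = Hub (Some (Inl p))" "\<nexists>p. y = Hub (Some (Inl p))"
      using leafY unfolding leaf_def by auto
    moreover have "x \<noteq> Arc j b" if "x \<in> \<Union>Y" for x j b
    proof -
      obtain G where "G \<in> Y" "x \<in> G" using \<open>x \<in> \<Union>Y\<close> by blast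
      then show ?thesis by (auto simp: Y_def elim: copiesE)
    qed
    then have "\<nexists>j b. x = Arc j b" "\<nexists>j b. y = Arc j b" using \<open>x \<in> \<Union>Y\<close> \<open>y \<in> \<Union>Y\<close> by blast+
    ultimately show "x = y"
      using e unfolding g_def by (auto split: avertex.splits option.splits sum.splits)
  qed
  moreover have "simplicial_complex Y"
    unfolding Yeq
  proof (rule simplicial_complex_Diff[OF sexp])
    fix F G assume "F \<in> R" "G \<in> exploded" "F \<subseteq> G"
    then show "G \<in> R" using leafR[of F] upR[of G] RI by blast
  qed
  ultimately have "Y \<sim> wedge_form K v n l r" using heq_image[of Y g] unfolding gY by blast
  then show ?thesis using heq_trans[OF total_heq_exploded heq_trans[OF 1]] unfolding tot by blast
qed

section \<open>Subdivisions and whiskers\<close>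

definition meets :: "('g \<Rightarrow> 'j \<Rightarrow> 'a) \<Rightarrow> 'j set \<Rightarrow> 'g set \<Rightarrow> ('g \<times> 'g) set" where
  "meets \<phi> V T = {(s, t). s \<in> T \<and> t \<in> T \<and> \<phi> s ` V \<inter> \<phi> t ` V \<noteq> {}}"

lemma glued_family_heq_wedge_form:
  fixes \<phi> :: "'g \<Rightarrow> 'j \<Rightarrow> 'a"
  assumes L: "simplicial_complex L" "finite L" "edge_connected L" and v: "v \<in> \<Union>L"
    and T: "finite T" "t0 \<in> T"
    and inj: "\<And>t. t \<in> T \<Longrightarrow> inj_on (\<phi> t) (\<Union>L)"
    and meet: "\<And>s t j k j' k'. s \<in> T \<Longrightarrow> t \<in> T \<Longrightarrow> s \<noteq> t \<Longrightarrow> j \<in> \<Union>L \<Longrightarrow> k \<in> \<Union>L \<Longrightarrow>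
      j' \<in> \<Union>L \<Longrightarrow> k' \<in> \<Union>L \<Longrightarrow> \<phi> s j = \<phi> t j' \<Longrightarrow> \<phi> s k = \<phi> t k' \<Longrightarrow> j = k"
    and con: "\<And>t. t \<in> T \<Longrightarrow> (t0, t) \<in> (meets \<phi> (\<Union>L) T)\<^sup>*"
  shows "\<exists>n l r. 0 < n \<and> (\<Union>t\<in>T. (`) (\<phi> t) ` L) \<sim> wedge_form L v n l (r :: 'a)"
proof -
  define n where "n = card T"
  have n: "0 < n" using T by (auto simp: n_def card_gt_0_iff)
  obtain e0 where e0: "bij_betw e0 {..<n} T"
    using T(1) by (metis n_def ex_bij_betw_nat_finite atLeast0LessThan)
  obtain k where k: "k < n" "e0 k = t0"
    using e0 T(2) unfolding bij_betw_def by (metis imageE lessThan_iff)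
  \<comment> \<open>Paths in the numbered version start at index 0, so the enumeration is rearranged
    to have \<open>t0\<close> there.\<close>
  define e where "e = e0 \<circ> Transposition.transpose 0 k"
  have "bij_betw (Transposition.transpose 0 k) {..<n} {..<n}"
    using n k by (intro bij_betw_transpose_iff) auto
  then have e: "bij_betw e {..<n} T" unfolding e_def using e0 by (rule bij_betw_trans)
  have e00: "e 0 = t0" using k by (simp add: e_def)
  have eT: "e i \<in> T" if "i < n" for i using e that by (auto simp: bij_betw_def)
  have einj: "e i \<noteq> e j" if "i < n" "j < n" "i \<noteq> j" for i j
    using e that by (auto simp: bij_betw_def inj_on_def)
  let ?M = "{(s, t). s < n \<and> t < n \<and> (\<phi> \<circ> e) s ` \<Union>L \<inter> (\<phi> \<circ> e) t ` \<Union>L \<noteq> {}}"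
  have path: "\<forall>i<n. e i = t \<longrightarrow> (0, i) \<in> ?M\<^sup>*" if "(t0, t) \<in> (meets \<phi> (\<Union>L) T)\<^sup>*" for t
    using that
  proof (induction rule: rtrancl_induct)
    case base
    show ?case
    proof (intro allI impI)
      fix i assume "i < n" "e i = t0"
      then have "i = 0" using einj[of i 0] n e00 by metis
      then show "(0, i) \<in> ?M\<^sup>*" by simp
    qed
  next
    case (step s t)
    show ?case
    proof (intro allI impI)
      fix i assume i: "i < n" "e i = t"
      have st: "s \<in> T" "\<phi> s ` \<Union>L \<inter> \<phi> t ` \<Union>L \<noteq> {}" using step(2) by (auto simp: meets_def)
      then obtain i' where i': "i' < n" "e i' = s"
        using e unfolding bij_betw_def by (metis imageE lessThan_iff)
      have "(i', i) \<in> ?M" using i i' st(2) by simp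
      moreover have "(0, i') \<in> ?M\<^sup>*" using step(3) i' by blast
      ultimately show "(0, i) \<in> ?M\<^sup>*" by (rule rtrancl_into_rtrancl[rotated])
    qed
  qed
  have "\<exists>l r. (\<Union>i<n. (`) ((\<phi> \<circ> e) i) ` L) \<sim> wedge_form L v n l (r :: 'a)"
  proof (rule glued_copies_heq_wedge_form[OF _ L(3) v n])
    show "glued_copies L n (\<phi> \<circ> e) {}"
    proof
      show "simplicial_complex L" "finite L" by fact+
      show "simplicial_complex {}" "finite {}" by (auto simp: simplicial_complex_def)
      show "inj_on ((\<phi> \<circ> e) t) (\<Union>L)" if "t < n" for t using inj[OF eT[OF that]] by simp
      show "j = k" if "s < n" "t < n" "s \<noteq> t" "j \<in> \<Union>L" "k \<in> \<Union>L" "j' \<in> \<Union>L" "k' \<in> \<Union>L"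
        "(\<phi> \<circ> e) s j = (\<phi> \<circ> e) t j'" "(\<phi> \<circ> e) s k = (\<phi> \<circ> e) t k'" for s t j k j' k'
        using meet[OF eT[OF that(1)] eT[OF that(2)] einj[OF that(1-3)] that(4-7)] that(8,9) by simp
    qed simp
    fix i assume "i < n"
    then show "(0, i) \<in> ?M\<^sup>*" using path[OF con[OF eT]] by blast
  qed
  moreover have "(\<Union>i<n. (`) ((\<phi> \<circ> e) i) ` L) = (\<Union>t\<in>T. (`) (\<phi> t) ` L)"
  proof -
    have "T = e ` {..<n}" using e by (simp add: bij_betw_def)
    then show ?thesis by simp
  qed
  ultimately show ?thesis using n by auto
qed

section \<open>Barycentric subdivision\<close>

definition chain_of :: "'a set set \<Rightarrow> bool" where
  "chain_of C \<longleftrightarrow> (\<forall>A\<in>C. \<forall>B\<in>C. A \<subseteq> B \<or> B \<subseteq> A)"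

text \<open>The order complex of the nonempty faces. Being a chain is a condition on pairs, so this
  complex is flag.\<close>

definition sd :: "'a set set \<Rightarrow> 'a set set set" where
  "sd K = {C. finite C \<and> C \<subseteq> K - {{}} \<and> chain_of C}"

lemma simplicial_sd: "simplicial_complex (sd K)"
  unfolding simplicial_complex_def
proof (intro conjI ballI allI impI)
  fix F assume F: "F \<in> sd K"
  then show "finite F" by (simp add: sd_def)
  fix G assume G: "G \<subseteq> F"
  have "finite G" using G F finite_subset by (auto simp: sd_def)
  moreover have "G \<subseteq> K - {{}}" using G F by (auto simp: sd_def)
  moreover have "chain_of G" using G F unfolding sd_def chain_of_def by blast
  ultimately show "G \<in> sd K" by (simp add: sd_def)
qed

lemma finite_sd: "finite K \<Longrightarrow> finite (sd K)"
  by (rule finite_subset[of _ "Pow K"]) (auto simp: sd_def)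

lemma vertices_sd: "\<Union>(sd K) = K - {{}}"
proof (intro equalityI subsetI)
  fix A assume "A \<in> K - {{}}"
  then have "{A} \<in> sd K" by (auto simp: sd_def chain_of_def)
  then show "A \<in> \<Union>(sd K)" by blast
qed (auto simp: sd_def)

lemma edge_sd: "A \<in> K - {{}} \<Longrightarrow> B \<in> K - {{}} \<Longrightarrow> A \<subseteq> B \<Longrightarrow> {A, B} \<in> sd K"
  by (auto simp: sd_def chain_of_def)

lemma edge_rel_sym: "(a, b) \<in> edge_rel X \<Longrightarrow> (b, a) \<in> edge_rel X"
  by (simp add: edge_rel_def insert_commute)

lemma edge_connectedI:
  assumes "\<And>a. a \<in> \<Union>X \<Longrightarrow> (r, a) \<in> (edge_rel X)\<^sup>*"
  shows "edge_connected X"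
  unfolding edge_connected_def
proof (intro ballI)
  fix a b assume "a \<in> \<Union>X" "b \<in> \<Union>X"
  have "sym (edge_rel X)" by (rule symI) (rule edge_rel_sym)
  then have "sym ((edge_rel X)\<^sup>*)" by (rule sym_rtrancl)
  then show "(a, b) \<in> (edge_rel X)\<^sup>*"
    using assms[OF \<open>a \<in> \<Union>X\<close>] assms[OF \<open>b \<in> \<Union>X\<close>] by (meson rtrancl_trans symD)
qed

lemma edge_connected_sd:
  assumes K: "simplicial_complex K" "edge_connected K" and v: "v \<in> \<Union>K"
  shows "edge_connected (sd K)"
proof (rule edge_connectedI[where r = "{v}"])
  fix A assume "A \<in> \<Union>(sd K)"
  then have A: "A \<in> K" "A \<noteq> {}" unfolding vertices_sd by auto
  then obtain x where x: "x \<in> A" by blast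
  have "(v, x) \<in> (edge_rel K)\<^sup>*" using K(2) v A(1) x unfolding edge_connected_def by blast
  then have "({v}, {x}) \<in> (edge_rel (sd K))\<^sup>*"
  proof (induction rule: rtrancl_induct)
    case (step y z)
    have yz: "{y, z} \<in> K" using step(2) by (simp add: edge_rel_def)
    then have "{y} \<in> K" "{z} \<in> K" using simplicial_complex_subset[OF K(1)] by blast+
    then have "({y}, {y, z}) \<in> edge_rel (sd K)" "({z}, {y, z}) \<in> edge_rel (sd K)"
      using yz by (auto simp: edge_rel_def intro!: edge_sd)
    then show ?case using step(3) edge_rel_sym by (meson rtrancl.rtrancl_into_rtrancl)
  qed simp
  moreover have "{x} \<in> K" using simplicial_complex_subset[OF K(1) A(1)] x by blast
  then have "({x}, A) \<in> edge_rel (sd K)" using A x by (auto simp: edge_rel_def intro!: edge_sd)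
  ultimately show "({v}, A) \<in> (edge_rel (sd K))\<^sup>*" by (rule rtrancl_into_rtrancl)
qed

text \<open>A complex containing both \<open>K\<close> and its subdivision, which collapses to either of them.\<close>

definition sd_bridge :: "'a set set \<Rightarrow> ('a + 'a set) set set" where
  "sd_bridge K = {Inl ` \<sigma> \<union> Inr ` C | \<sigma> C. \<sigma> \<in> K \<and> C \<in> sd K \<and> (\<forall>A\<in>C. \<sigma> \<subseteq> A)}"

lemma Plus_face_vimage: "Inl -` (Inl ` \<sigma> \<union> Inr ` C) = \<sigma>" "Inr -` (Inl ` \<sigma> \<union> Inr ` C) = C"
  by blast+

lemma Plus_face_vimages: "Inl ` (Inl -` G) \<union> Inr ` (Inr -` G) = G"
proof (intro equalityI subsetI)
  fix x assume "x \<in> G"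
  then show "x \<in> Inl ` (Inl -` G) \<union> Inr ` (Inr -` G)" by (cases x) auto
qed auto

lemma sd_bridge_mem:
  "G \<in> sd_bridge K \<longleftrightarrow> Inl -` G \<in> K \<and> Inr -` G \<in> sd K \<and> (\<forall>A\<in>Inr -` G. Inl -` G \<subseteq> A)"
proof
  assume "G \<in> sd_bridge K"
  then obtain \<sigma> C where "G = Inl ` \<sigma> \<union> Inr ` C" "\<sigma> \<in> K" "C \<in> sd K" "\<forall>A\<in>C. \<sigma> \<subseteq> A"
    unfolding sd_bridge_def by blast
  then show "Inl -` G \<in> K \<and> Inr -` G \<in> sd K \<and> (\<forall>A\<in>Inr -` G. Inl -` G \<subseteq> A)"
    by (simp only: Plus_face_vimage simp_thms)
next
  assume "Inl -` G \<in> K \<and> Inr -` G \<in> sd K \<and> (\<forall>A\<in>Inr -` G. Inl -` G \<subseteq> A)"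
  then show "G \<in> sd_bridge K"
    unfolding sd_bridge_def using Plus_face_vimages[of G] by blast
qed

lemma simplicial_sd_bridge:
  assumes "simplicial_complex K"
  shows "simplicial_complex (sd_bridge K)"
  unfolding simplicial_complex_def
proof (intro conjI ballI allI impI)
  fix F assume F: "F \<in> sd_bridge K"
  then have "finite (Inl -` F)" "finite (Inr -` F)"
    using simplicial_complex_finite[OF assms] simplicial_complex_finite[OF simplicial_sd]
    by (auto simp: sd_bridge_mem)
  then show "finite F" using Plus_face_vimages[of F] by (metis finite_UnI finite_imageI)
  fix G assume "G \<subseteq> F"
  then have "Inl -` G \<subseteq> Inl -` F" "Inr -` G \<subseteq> Inr -` F" by auto
  note sub = this
  have FF: "Inl -` F \<in> K" "Inr -` F \<in> sd K" "\<forall>A\<in>Inr -` F. Inl -` F \<subseteq> A"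
    using F by (simp_all add: sd_bridge_mem)
  have "Inl -` G \<in> K" using simplicial_complex_subset[OF assms FF(1) sub(1)] .
  moreover have "Inr -` G \<in> sd K" using simplicial_complex_subset[OF simplicial_sd FF(2) sub(2)] .
  moreover have "\<forall>A\<in>Inr -` G. Inl -` G \<subseteq> A" using FF(3) sub by blast
  ultimately show "G \<in> sd_bridge K" by (simp add: sd_bridge_mem)
qed

lemma finite_sd_bridge:
  assumes "finite K"
  shows "finite (sd_bridge K)"
proof -
  have "sd_bridge K \<subseteq> (\<lambda>(\<sigma>, C). Inl ` \<sigma> \<union> Inr ` C) ` (K \<times> sd K)"
    unfolding sd_bridge_def by auto
  then show ?thesis using assms finite_sd[OF assms] by (meson finite_SigmaI finite_imageI finite_subset)
qed

lemma edge_connected_sd_bridge: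
  fixes K :: "'a set set"
  assumes K: "simplicial_complex K" "edge_connected K" and v: "v \<in> \<Union>K"
  shows "edge_connected (sd_bridge K)"
proof (rule edge_connectedI[where r = "Inl v"])
  have e: "{} \<in> sd K" by (auto simp: sd_def chain_of_def)
  have reach: "(Inl v, Inl x) \<in> (edge_rel (sd_bridge K))\<^sup>*" if "x \<in> \<Union>K" for x
  proof -
    have "(v, x) \<in> (edge_rel K)\<^sup>*" using K(2) v that unfolding edge_connected_def by blast
    then show ?thesis
    proof (induction rule: rtrancl_induct)
      case (step y z)
      have "{y, z} \<in> K" using step(2) by (simp add: edge_rel_def)
      moreover have "Inl -` {Inl y, Inl z :: 'a + 'a set} = {y, z}" "Inr -` {Inl y, Inl z :: 'a + 'a set} = {}" by auto
      ultimately have "{Inl y, Inl z} \<in> sd_bridge K" using e by (simp add: sd_bridge_mem)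
      then show ?case using step(3) by (simp add: edge_rel_def rtrancl.rtrancl_into_rtrancl)
    qed simp
  qed
  fix a assume "a \<in> \<Union>(sd_bridge K)"
  then obtain G where G: "G \<in> sd_bridge K" "a \<in> G" by blast
  show "(Inl v, a) \<in> (edge_rel (sd_bridge K))\<^sup>*"
  proof (cases a)
    case (Inl x)
    then have "x \<in> \<Union>K" using G unfolding sd_bridge_mem by blast
    then show ?thesis using reach Inl by simp
  next
    case (Inr A)
    then have "A \<in> \<Union>(sd K)" using G unfolding sd_bridge_mem by blast
    then have A: "A \<in> K" "A \<noteq> {}" unfolding vertices_sd by auto
    then obtain x where x: "x \<in> A" by blast
    have "Inl -` {Inl x, Inr A} = {x}" "Inr -` {Inl x, Inr A} = {A}" by auto
    moreover have "{x} \<in> K" using simplicial_complex_subset[OF K(1) A(1)] x by blast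
    moreover have "{A} \<in> sd K" using A by (simp add: sd_def chain_of_def)
    ultimately have "{Inl x, Inr A} \<in> sd_bridge K" using x by (simp add: sd_bridge_mem)
    then have "(Inl x, a) \<in> edge_rel (sd_bridge K)" using Inr by (simp add: edge_rel_def)
    moreover have "(Inl v, Inl x) \<in> (edge_rel (sd_bridge K))\<^sup>*" using reach x A(1) by blast
    ultimately show ?thesis by (rule rtrancl_into_rtrancl[rotated])
  qed
qed

lemma chain_Inter_mem:
  assumes "finite C" "C \<noteq> {}" "chain_of C"
  shows "\<Inter>C \<in> C"
  using assms
proof (induction C rule: finite_ne_induct)
  case (insert A C)
  then have "\<Inter>C \<in> C" by (simp add: chain_of_def)
  then have "A \<subseteq> \<Inter>C \<or> \<Inter>C \<subseteq> A" using insert.prems by (simp add: chain_of_def)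
  then have "A \<inter> \<Inter>C = A \<or> A \<inter> \<Inter>C = \<Inter>C" by blast
  then show ?case using \<open>\<Inter>C \<in> C\<close> by auto
qed simp

lemma sd_bridge_collapsing_sd:
  assumes K: "simplicial_complex K"
  shows "collapsing (sd_bridge K) {G \<in> sd_bridge K. Inl -` G \<noteq> {}} (\<lambda>G. Inr (Inl -` G)) (\<lambda>G. card (Inl -` G))"
proof (rule collapsingI)
  fix G :: "('a + 'a set) set" assume "G \<in> {G \<in> sd_bridge K. Inl -` G \<noteq> {}}"
  then have G: "Inl -` G \<in> K" "Inr -` G \<in> sd K" "\<forall>A\<in>Inr -` G. Inl -` G \<subseteq> A" "Inl -` G \<noteq> {}"
    by (auto simp: sd_bridge_mem)
  let ?w = "Inr (Inl -` G) :: 'a + 'a set"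
  have 1: "Inl -` insert ?w G = Inl -` G" "Inr -` insert ?w G = insert (Inl -` G) (Inr -` G)"
    "Inl -` (G - {?w}) = Inl -` G" "Inr -` (G - {?w}) = Inr -` G - {Inl -` G}" by auto
  have "insert (Inl -` G) (Inr -` G) \<in> sd K"
    using G unfolding sd_def chain_of_def by auto
  moreover have "Inr -` G - {Inl -` G} \<in> sd K"
    using simplicial_complex_subset[OF simplicial_sd G(2)] by blast
  ultimately show "insert ?w G \<in> {G \<in> sd_bridge K. Inl -` G \<noteq> {}} \<and> Inr (Inl -` insert ?w G) = ?w
      \<and> G - {?w} \<in> {G \<in> sd_bridge K. Inl -` G \<noteq> {}} \<and> Inr (Inl -` (G - {?w})) = ?w
      \<and> card (Inl -` (G - {?w})) = card (Inl -` G)"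
    using G by (simp add: sd_bridge_mem 1)
next
  fix F G :: "('a + 'a set) set"
  assume F: "F \<in> {G \<in> sd_bridge K. Inl -` G \<noteq> {}}" and G: "G \<in> sd_bridge K" and FG: "F \<subseteq> G"
  have sub: "Inl -` F \<subseteq> Inl -` G" using FG by auto
  have "finite (Inl -` G)" using G simplicial_complex_finite[OF K] by (simp add: sd_bridge_mem)
  then have "card (Inl -` F) < card (Inl -` G) \<or> Inl -` F = Inl -` G"
    using sub by (metis psubset_card_mono psubsetI)
  then show "G \<in> {G \<in> sd_bridge K. Inl -` G \<noteq> {}} \<and> (card (Inl -` F) < card (Inl -` G)
      \<or> card (Inl -` F) = card (Inl -` G) \<and> Inr (Inl -` F) = Inr (Inl -` G))"
    using F G sub by auto
qed auto

text \<open>A chosen point of the smallest member of the chain is toggled; that member contains the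
  simplex part, which therefore stays a face. A longer chain may have a smaller minimum, so the rank
  counts the vertices outside the minimum.\<close>

lemma sd_bridge_collapsing_base:
  fixes K :: "'a set set"
  assumes K: "simplicial_complex K" "finite K"
  shows "collapsing (sd_bridge K) {G \<in> sd_bridge K. Inr -` G \<noteq> {}}
    (\<lambda>G. Inl (SOME x. x \<in> \<Inter>(Inr -` G))) (\<lambda>G. card (\<Union>K) - card (\<Inter>(Inr -` G)))"
proof (rule collapsingI)
  have min: "\<Inter>C \<in> K \<and> \<Inter>C \<noteq> {}" if "C \<in> sd K" "C \<noteq> {}" for C
  proof -
    have "\<Inter>C \<in> C" using that by (intro chain_Inter_mem) (auto simp: sd_def)
    then show ?thesis using that(1) by (auto simp: sd_def)
  qed
  {
    fix G :: "('a + 'a set) set" assume "G \<in> {G \<in> sd_bridge K. Inr -` G \<noteq> {}}"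
    then have G: "Inl -` G \<in> K" "Inr -` G \<in> sd K" "\<forall>A\<in>Inr -` G. Inl -` G \<subseteq> A" "Inr -` G \<noteq> {}"
      by (auto simp: sd_bridge_mem)
    define x where "x = (SOME x. x \<in> \<Inter>(Inr -` G))"
    have x: "x \<in> \<Inter>(Inr -` G)" unfolding x_def some_in_eq using min[OF G(2,4)] by blast
    let ?w = "Inl x :: 'a + 'a set"
    have 1: "Inl -` insert ?w G = insert x (Inl -` G)" "Inr -` insert ?w G = Inr -` G"
      "Inl -` (G - {?w}) = Inl -` G - {x}" "Inr -` (G - {?w}) = Inr -` G" by auto
    have "insert x (Inl -` G) \<subseteq> \<Inter>(Inr -` G)" using x G(3) by blast
    then have "insert x (Inl -` G) \<in> K"
      using simplicial_complex_subset[OF K(1)] min[OF G(2,4)] by blast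
    moreover have "Inl -` G - {x} \<in> K" using simplicial_complex_subset[OF K(1) G(1)] by blast
    moreover have "\<forall>A\<in>Inr -` G. insert x (Inl -` G) \<subseteq> A" using x G(3) by blast
    ultimately have "insert ?w G \<in> {G \<in> sd_bridge K. Inr -` G \<noteq> {}}" "G - {?w} \<in> {G \<in> sd_bridge K. Inr -` G \<noteq> {}}"
      using G by (auto simp: sd_bridge_mem 1)
    then show "insert (Inl (SOME x. x \<in> \<Inter>(Inr -` G))) G \<in> {G \<in> sd_bridge K. Inr -` G \<noteq> {}}
      \<and> Inl (SOME x. x \<in> \<Inter>(Inr -` insert (Inl (SOME x. x \<in> \<Inter>(Inr -` G))) G)) = (Inl (SOME x. x \<in> \<Inter>(Inr -` G)) :: 'a + 'a set)
      \<and> G - {Inl (SOME x. x \<in> \<Inter>(Inr -` G))} \<in> {G \<in> sd_bridge K. Inr -` G \<noteq> {}}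
      \<and> Inl (SOME x. x \<in> \<Inter>(Inr -` (G - {Inl (SOME x. x \<in> \<Inter>(Inr -` G))}))) = (Inl (SOME x. x \<in> \<Inter>(Inr -` G)) :: 'a + 'a set)
      \<and> card (\<Union>K) - card (\<Inter>(Inr -` (G - {Inl (SOME x. x \<in> \<Inter>(Inr -` G))}))) = card (\<Union>K) - card (\<Inter>(Inr -` G))"
      unfolding x_def[symmetric] 1 by (simp add: x_def[symmetric])
  next
    fix F G :: "('a + 'a set) set"
    assume F: "F \<in> {G \<in> sd_bridge K. Inr -` G \<noteq> {}}" and G: "G \<in> sd_bridge K" and FG: "F \<subseteq> G"
    have sub: "Inr -` F \<subseteq> Inr -` G" using FG by auto
    have ne: "Inr -` F \<noteq> {}" "Inr -` G \<noteq> {}" using F sub by auto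
    have m: "\<Inter>(Inr -` F) \<in> K" using min F ne(1) by (auto simp: sd_bridge_mem)
    have fin: "finite (\<Union>K)" using K simplicial_complex_finite by blast
    have le: "\<Inter>(Inr -` G) \<subseteq> \<Inter>(Inr -` F)" using sub by blast
    have "card (\<Union>K) - card (\<Inter>(Inr -` F)) < card (\<Union>K) - card (\<Inter>(Inr -` G)) \<or> \<Inter>(Inr -` F) = \<Inter>(Inr -` G)"
    proof (cases "\<Inter>(Inr -` F) = \<Inter>(Inr -` G)")
      case False
      have "card (\<Inter>(Inr -` G)) < card (\<Inter>(Inr -` F))"
        using False le m simplicial_complex_finite[OF K(1)] by (intro psubset_card_mono) auto
      moreover have "card (\<Inter>(Inr -` F)) \<le> card (\<Union>K)" using m fin by (intro card_mono) auto
      ultimately show ?thesis by linarith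
    qed simp
    then have "card (\<Union>K) - card (\<Inter>(Inr -` F)) < card (\<Union>K) - card (\<Inter>(Inr -` G)) \<or>
       card (\<Union>K) - card (\<Inter>(Inr -` F)) = card (\<Union>K) - card (\<Inter>(Inr -` G)) \<and>
       Inl (SOME x. x \<in> \<Inter>(Inr -` F)) = (Inl (SOME x. x \<in> \<Inter>(Inr -` G)) :: 'a + 'a set)"
    proof
      assume "\<Inter>(Inr -` F) = \<Inter>(Inr -` G)"
      then show ?thesis by (simp only: simp_thms)
    qed simp
    moreover have "G \<in> {G \<in> sd_bridge K. Inr -` G \<noteq> {}}" using G ne(2) by simp
    ultimately show "G \<in> {G \<in> sd_bridge K. Inr -` G \<noteq> {}} \<and>
      (card (\<Union>K) - card (\<Inter>(Inr -` F)) < card (\<Union>K) - card (\<Inter>(Inr -` G)) \<or>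
       card (\<Union>K) - card (\<Inter>(Inr -` F)) = card (\<Union>K) - card (\<Inter>(Inr -` G)) \<and>
       Inl (SOME x. x \<in> \<Inter>(Inr -` F)) = (Inl (SOME x. x \<in> \<Inter>(Inr -` G)) :: 'a + 'a set))"
      by (rule conjI[rotated])
  }
qed auto

lemma wedge_form_sd:
  fixes K :: "'a set set" and r :: 'b
  assumes K: "simplicial_complex K" "finite K" "edge_connected K" and v: "v \<in> \<Union>K"
  shows "wedge_form (sd K) {v} n l r \<sim> wedge_form K v n l r"
proof -
  let ?M = "sd_bridge K"
  have e: "{} \<in> K" "{v} \<in> K" using simplicial_complex_empty_face[OF K(1) v] .
  have vsd: "{v} \<in> \<Union>(sd K)" unfolding vertices_sd using e by simp
  have sM: "simplicial_complex ?M" "finite ?M"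
    using simplicial_sd_bridge[OF K(1)] finite_sd_bridge[OF K(2)] by auto
  have im: "(`) Inr ` sd K = ?M - {G \<in> ?M. Inl -` G \<noteq> {}}"
  proof (intro equalityI subsetI)
    fix G :: "('a + 'a set) set" assume "G \<in> (`) Inr ` sd K"
    then obtain C where C: "C \<in> sd K" "G = Inr ` C" by blast
    then have "Inl -` G = {}" "Inr -` G = C" by auto
    then show "G \<in> ?M - {G \<in> ?M. Inl -` G \<noteq> {}}" using C e by (simp add: sd_bridge_mem)
  next
    fix G assume "G \<in> ?M - {G \<in> ?M. Inl -` G \<noteq> {}}"
    then have "Inl -` G = {}" "Inr -` G \<in> sd K" by (auto simp: sd_bridge_mem)
    moreover from this have "Inr ` (Inr -` G) = G"
      using Plus_face_vimages[of G] by (simp only: image_empty Un_empty_left)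
    ultimately show "G \<in> (`) Inr ` sd K" by (metis image_eqI)
  qed
  have im': "(`) Inl ` K = ?M - {G \<in> ?M. Inr -` G \<noteq> {}}"
  proof (intro equalityI subsetI)
    fix G :: "('a + 'a set) set" assume "G \<in> (`) Inl ` K"
    then obtain \<sigma> where C: "\<sigma> \<in> K" "G = Inl ` \<sigma>" by blast
    then have "Inr -` G = {}" "Inl -` G = \<sigma>" by auto
    moreover have "{} \<in> sd K" by (simp add: sd_def chain_of_def)
    ultimately show "G \<in> ?M - {G \<in> ?M. Inr -` G \<noteq> {}}" using C by (simp add: sd_bridge_mem)
  next
    fix G assume "G \<in> ?M - {G \<in> ?M. Inr -` G \<noteq> {}}"
    then have "Inr -` G = {}" "Inl -` G \<in> K" by (auto simp: sd_bridge_mem)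
    moreover from this have "Inl ` (Inl -` G) = G"
      using Plus_face_vimages[of G] by (simp only: image_empty Un_empty_right)
    ultimately show "G \<in> (`) Inl ` K" by (metis image_eqI)
  qed
  have vM: "Inr {v} \<in> \<Union>?M" "Inl v \<in> \<Union>?M"
  proof -
    have "Inr {v} \<in> \<Union>((`) (Inr :: 'a set \<Rightarrow> 'a + 'a set) ` sd K)"
      unfolding image_Union[symmetric] using vsd by (rule imageI)
    then show "Inr {v} \<in> \<Union>?M" unfolding im by (elim UnionE) (rule UnionI, erule DiffD1)
    have "Inl v \<in> \<Union>((`) (Inl :: 'a \<Rightarrow> 'a + 'a set) ` K)"
      unfolding image_Union[symmetric] using v by (rule imageI)
    then show "Inl v \<in> \<Union>?M" unfolding im' by (elim UnionE) (rule UnionI, erule DiffD1)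
  qed
  have "wedge_form (sd K) {v} n l r \<sim> wedge_form ((`) (Inr :: 'a set \<Rightarrow> 'a + 'a set) ` sd K) (Inr {v}) n l (id r)"
    by (rule wedge_form_image[OF simplicial_sd vsd]) simp
  also have "\<dots> \<sim> wedge_form ?M (Inr {v}) n l (id r)"
    unfolding im
    by (rule heq_sym[OF wedge_form_collapse[OF sM sd_bridge_collapsing_sd[OF K(1)] vM(1)]]) auto
  \<comment> \<open>Each of the two collapses has to keep the base vertex, and the two ends of the
    bridge have no vertex in common; so the base is moved inside the bridge.\<close>
  also have "\<dots> \<sim> wedge_form ?M (Inl v) n l (id r)"
    by (rule wedge_form_base[OF sM edge_connected_sd_bridge[OF K(1,3) v] vM])
  also have "\<dots> \<sim> wedge_form ((`) (Inl :: 'a \<Rightarrow> 'a + 'a set) ` K) (Inl v) n l (id r)"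
    unfolding im'
    by (rule wedge_form_collapse[OF sM sd_bridge_collapsing_base[OF K(1,2)] vM(2)]) auto
  also have "\<dots> \<sim> wedge_form K v n l r"
    by (rule heq_sym[OF wedge_form_image[OF K(1) v]]) simp
  finally show ?thesis .
qed

text \<open>In the facet construction \<open>I\<close> is the set of facets, and the leaf
  \<open>Inr i\<close> is where a copy of \<open>K\<close> is tied to the large simplex that
  contains its facet \<open>i\<close>.\<close>

definition whiskered :: "'a set set \<Rightarrow> 'i set \<Rightarrow> ('i \<Rightarrow> 'a) \<Rightarrow> ('a + 'i) set set" where
  "whiskered K I c = (`) Inl ` K \<union> {{Inr i} | i. i \<in> I} \<union> {{Inl (c i), Inr i} | i. i \<in> I}"

lemma whiskered_cases [consumes 1]:
  assumes "F \<in> whiskered K I c"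
  obtains (base) \<sigma> where "\<sigma> \<in> K" "F = Inl ` \<sigma>" | (leaf) i where "i \<in> I" "F = {Inr i}"
    | (whisker) i where "i \<in> I" "F = {Inl (c i), Inr i}"
proof -
  from assms consider "F \<in> (`) Inl ` K" | "F \<in> {{Inr i} | i. i \<in> I}" | "F \<in> {{Inl (c i), Inr i} | i. i \<in> I}"
    unfolding whiskered_def Un_iff by (elim disjE)
  then show ?thesis
  proof cases
    case 1
    then show ?thesis by (elim imageE) (rule base; assumption)
  next
    case 2
    then show ?thesis by (elim CollectE exE conjE) (rule leaf; assumption)
  next
    case 3
    then show ?thesis by (elim CollectE exE conjE) (rule whisker; assumption)
  qed
qed

lemma vertices_whiskered: "c ` I \<subseteq> \<Union>K \<Longrightarrow> \<Union>(whiskered K I c) = Inl ` \<Union>K \<union> Inr ` I"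
proof -
  assume c: "c ` I \<subseteq> \<Union>K"
  have "\<Union>((`) Inl ` K) = Inl ` \<Union>K" by (simp add: image_Union)
  moreover have "\<Union>{{Inr i} | i. i \<in> I} = Inr ` I" by auto
  moreover have "\<Union>{{Inl (c i), Inr i} | i. i \<in> I} = Inl ` c ` I \<union> Inr ` I" by auto
  moreover have "Inl ` c ` I \<subseteq> Inl ` \<Union>K" using c by (rule image_mono)
  ultimately show ?thesis unfolding whiskered_def Union_Un_distrib by auto
qed

lemma simplicial_whiskered:
  assumes K: "simplicial_complex K" and c: "c ` I \<subseteq> \<Union>K" and ne: "v \<in> \<Union>K"
  shows "simplicial_complex (whiskered K I c)"
  unfolding whiskered_def
proof (rule simplicial_complex_Un_edges)
  have "{} \<in> (`) Inl ` K" using simplicial_complex_empty_face(1)[OF K ne] by force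
  then show "simplicial_complex ((`) Inl ` K \<union> {{Inr i} | i. i \<in> I})"
    by (intro simplicial_complex_Un_vertices simplicial_complex_image K)
  fix e :: "('a + 'b) set" assume "e \<in> {{Inl (c i), Inr i} | i. i \<in> I}"
  then obtain i where i: "i \<in> I" "e = {Inl (c i), Inr i}" by blast
  have "c i \<in> \<Union>K" using c i(1) by blast
  then have "{c i} \<in> K" by (rule simplicial_complex_empty_face(2)[OF K])
  then have "Inl ` {c i} \<in> (`) Inl ` K" by (rule imageI)
  then show "\<exists>a b. e = {a, b} \<and> {a} \<in> (`) Inl ` K \<union> {{Inr i} | i. i \<in> I} \<and> {b} \<in> (`) Inl ` K \<union> {{Inr i} | i. i \<in> I}"
    using i by (intro exI[of _ "Inl (c i)"] exI[of _ "Inr i"]) simp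
qed

lemma finite_whiskered: "finite K \<Longrightarrow> finite I \<Longrightarrow> finite (whiskered K I c)"
  unfolding whiskered_def by simp

lemma edge_connected_whiskered:
  assumes K: "edge_connected K" and c: "c ` I \<subseteq> \<Union>K" and v: "v \<in> \<Union>K"
  shows "edge_connected (whiskered K I c)"
proof (rule edge_connectedI[where r = "Inl v"])
  have reach: "(Inl v, Inl x) \<in> (edge_rel (whiskered K I c))\<^sup>*" if "x \<in> \<Union>K" for x
  proof -
    have "(v, x) \<in> (edge_rel K)\<^sup>*" using K v that unfolding edge_connected_def by blast
    then show ?thesis
    proof (induction rule: rtrancl_induct)
      case (step y z)
      have "Inl ` {y, z} \<in> whiskered K I c" using step(2) unfolding edge_rel_def whiskered_def by blast
      then show ?case using step(3) by (simp add: edge_rel_def rtrancl.rtrancl_into_rtrancl)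
    qed simp
  qed
  fix a assume "a \<in> \<Union>(whiskered K I c)"
  then consider "a \<in> Inl ` \<Union>K" | "a \<in> Inr ` I"
    unfolding vertices_whiskered[OF c] Un_iff by (rule disjE)
  then show "(Inl v, a) \<in> (edge_rel (whiskered K I c))\<^sup>*"
  proof cases
    case 1
    then obtain x where "x \<in> \<Union>K" "a = Inl x" by (rule imageE)
    then show ?thesis using reach by simp
  next
    case 2
    then obtain i where 2: "a = Inr i" "i \<in> I" by (rule imageE)
    then have "(Inl (c i), a) \<in> edge_rel (whiskered K I c)"
      unfolding edge_rel_def whiskered_def by blast
    moreover have "(Inl v, Inl (c i)) \<in> (edge_rel (whiskered K I c))\<^sup>*" using c 2(2) by (intro reach) blast
    ultimately show ?thesis by (rule rtrancl_into_rtrancl[rotated])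
  qed
qed

lemma wedge_form_whiskered:
  fixes K :: "'a set set" and I :: "'i set" and r :: 'b
  assumes K: "simplicial_complex K" "finite K" and v: "v \<in> \<Union>K" and I: "finite I" "c ` I \<subseteq> \<Union>K"
  shows "wedge_form (whiskered K I c) (Inl v) n l r \<sim> wedge_form K v n l r"
proof -
  let ?L = "whiskered K I c"
  let ?R = "{{Inr i} | i. i \<in> I} \<union> {{Inl (c i), Inr i} | i. i \<in> I} :: ('a + 'i) set set"
  let ?h = "\<lambda>G. Inl (c (SOME i. Inr i \<in> G)) :: 'a + 'i"
  have noInr: "Inr i \<notin> G" if "G \<in> (`) Inl ` K" for G and i :: 'i using that by blast
  have R: "\<exists>i\<in>I. G = {Inr i} \<or> G = {Inl (c i), Inr i}" if "G \<in> ?R" for G using that by blast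
  have h: "?h {Inr i} = Inl (c i)" "?h {Inl (c i), Inr i} = Inl (c i)" for i by simp_all
  have Leq: "(`) Inl ` K = ?L - ?R"
  proof -
    have "G \<notin> ?R" if "G \<in> (`) Inl ` K" for G using noInr[OF that] by blast
    then show ?thesis unfolding whiskered_def by blast
  qed
  have col: "collapsing ?L ?R ?h (\<lambda>_. 0)"
  proof (rule collapsingI)
    show "?R \<subseteq> ?L" unfolding whiskered_def by blast
    show "{} \<notin> ?R" by blast
    fix G assume "G \<in> ?R"
    then obtain i where i: "i \<in> I" "G = {Inr i} \<or> G = {Inl (c i), Inr i}" using R by blast
    have hG: "?h G = Inl (c i)" using i(2) h by auto
    have 1: "insert (?h G) G = {Inl (c i), Inr i}" "G - {?h G} = {Inr i}" unfolding hG using i(2) by auto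
    have 2: "{Inl (c i), Inr i} \<in> ?R" "{Inr i} \<in> ?R" using i(1) by blast+
    show "insert (?h G) G \<in> ?R \<and> ?h (insert (?h G) G) = ?h G \<and> G - {?h G} \<in> ?R \<and> ?h (G - {?h G}) = ?h G \<and> (0 :: nat) = 0"
      unfolding 1 unfolding h hG using 2 by blast
  next
    fix F G assume "F \<in> ?R" "G \<in> ?L" "F \<subseteq> G"
    then obtain i where i: "i \<in> I" "F = {Inr i} \<or> F = {Inl (c i), Inr i}" using R by blast
    then have iG: "Inr i \<in> G" using \<open>F \<subseteq> G\<close> by blast
    then have "G \<notin> (`) Inl ` K" using noInr by blast
    then have GR: "G \<in> ?R" using \<open>G \<in> ?L\<close> unfolding whiskered_def by blast
    then obtain k where "k \<in> I" "G = {Inr k} \<or> G = {Inl (c k), Inr k}" using R by blast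
    then have "G = {Inr i} \<or> G = {Inl (c i), Inr i}" using iG by auto
    then have "?h G = ?h F" using i(2) h by (elim disjE) simp_all
    then show "G \<in> ?R \<and> ((0 :: nat) < 0 \<or> (0 :: nat) = 0 \<and> ?h F = ?h G)" using GR by simp
  qed
  have "wedge_form ?L (Inl v) n l r \<sim> wedge_form (?L - ?R) (Inl v) n l r"
  proof (rule wedge_form_collapse[OF simplicial_whiskered[OF K(1) I(2) v] finite_whiskered[OF K(2) I(1)] col])
    show "Inl v \<in> \<Union>?L" unfolding vertices_whiskered[OF I(2)] using v by blast
    show "{Inl v} \<notin> ?R" by blast
  qed
  also have "wedge_form (?L - ?R) (Inl v) n l r \<sim> wedge_form K v n l r"
    unfolding Leq[symmetric] using heq_sym[OF wedge_form_image[OF K(1) v, of Inl n l r id]] by simp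
  finally show ?thesis .
qed

section \<open>Transitive complexes and the cyclic construction\<close>

definition wedge_type :: "'a set set \<Rightarrow> 'b set set \<Rightarrow> bool" where
  "wedge_type K X \<longleftrightarrow> (\<exists>n l v. n \<ge> 1 \<and> v \<in> vertices K \<and>
     realization_top X homotopy_equivalent_space realization_top (wedge_complex K v n l))"

lemma wedge_typeI:
  fixes K :: "'a set set" and r :: 'r
  assumes "X \<sim> wedge_form K v n l r" "0 < n" "v \<in> \<Union>K" "simplicial_complex K" "finite K"
  shows "wedge_type K X"
proof -
  have "X \<sim> wedge_complex K v n l"
    using heq_trans[OF assms(1) heq_sym[OF wedge_complex_heq_wedge_form[OF assms(4,5,3,2)]]] .
  then show ?thesis
    unfolding wedge_type_def heq_def vertices_def using assms by (intro exI[of _ n] exI[of _ l] exI[of _ v]) simp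
qed

lemma wedge_type_heq: "X \<sim> Y \<Longrightarrow> wedge_type K X \<Longrightarrow> wedge_type K Y"
  unfolding wedge_type_def heq_def by (meson homotopy_equivalent_space_sym homotopy_eqv_trans)

text \<open>On a finite complex an injection that takes faces to faces is onto the vertices and onto
  the faces. A set with a face as image is then itself a face.\<close>

lemma automorphismI:
  assumes X: "simplicial_complex X" "finite X" and inj: "inj_on \<sigma> (\<Union>X)"
    and face: "\<And>F. F \<in> X \<Longrightarrow> \<sigma> ` F \<in> X" and out: "\<And>x. x \<notin> \<Union>X \<Longrightarrow> \<sigma> x = x"
  shows "\<sigma> \<in> automorphisms X"
proof -
  have fin: "finite (\<Union>X)" using X simplicial_complex_finite by blast
  have sub: "\<sigma> ` \<Union>X \<subseteq> \<Union>X" using face by blast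
  have "\<sigma> ` \<Union>X = \<Union>X" using endo_inj_surj[OF fin sub inj] .
  then have 1: "bij_betw \<sigma> (\<Union>X) (\<Union>X)" using inj by (simp add: bij_betw_def)
  have injX: "inj_on ((`) \<sigma>) X"
    by (rule inj_on_subset[OF inj_on_image_Pow[OF inj]]) blast
  have surjX: "(`) \<sigma> ` X = X"
    using face by (intro endo_inj_surj[OF X(2) _ injX]) blast
  have 2: "F \<in> X" if F: "F \<subseteq> \<Union>X" "\<sigma> ` F \<in> X" for F
  proof -
    obtain G where G: "G \<in> X" "\<sigma> ` F = \<sigma> ` G" using F(2) surjX by (metis imageE)
    have "G \<subseteq> \<Union>X" using G(1) by blast
    then have "F = G" using inj_on_image_eq_iff[OF inj F(1)] G(2) by blast
    then show ?thesis using G(1) by simp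
  qed
  show ?thesis
    unfolding automorphisms_def vertices_def using 1 2 face out by auto
qed

lemma automorphism_image:
  assumes inj: "inj_on g (\<Union>X)" and \<sigma>: "\<sigma> \<in> automorphisms X" and X: "simplicial_complex X" "finite X"
  shows "(\<lambda>y. if y \<in> g ` \<Union>X then g (\<sigma> (the_inv_into (\<Union>X) g y)) else y) \<in> automorphisms ((`) g ` X)"
    (is "?\<tau> \<in> _")
proof (rule automorphismI)
  define V where "V = \<Union>X"
  have UX: "\<Union>((`) g ` X) = g ` V" by (simp add: V_def image_Union)
  have \<sigma>V: "bij_betw \<sigma> V V" and \<sigma>X: "\<And>F. F \<subseteq> V \<Longrightarrow> \<sigma> ` F \<in> X \<longleftrightarrow> F \<in> X"
    using \<sigma> by (auto simp: automorphisms_def vertices_def V_def)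
  note inj = inj[folded V_def]
  have \<tau>: "?\<tau> (g x) = g (\<sigma> x)" if "x \<in> V" for x
    using that the_inv_into_f_f[OF inj that] by (simp add: V_def[symmetric])
  show "simplicial_complex ((`) g ` X)" by (rule simplicial_complex_image[OF X(1)])
  show "finite ((`) g ` X)" using X(2) by simp
  show "inj_on ?\<tau> (\<Union>((`) g ` X))"
    unfolding UX
  proof (rule inj_onI)
    fix y z assume "y \<in> g ` V" "z \<in> g ` V" and e: "?\<tau> y = ?\<tau> z"
    then obtain a b where ab: "a \<in> V" "y = g a" "b \<in> V" "z = g b" by blast
    then have "g (\<sigma> a) = g (\<sigma> b)" using e \<tau> by metis
    moreover have "\<sigma> a \<in> V" "\<sigma> b \<in> V" using \<sigma>V ab by (auto simp: bij_betw_def)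
    ultimately have "\<sigma> a = \<sigma> b" using inj by (simp add: inj_on_def)
    then show "y = z" using \<sigma>V ab by (auto simp: bij_betw_def inj_on_def)
  qed
  show "?\<tau> ` F \<in> (`) g ` X" if F: "F \<in> (`) g ` X" for F
  proof -
    obtain D where D: "D \<in> X" "F = g ` D" using F by blast
    then have DV: "D \<subseteq> V" by (auto simp: V_def)
    have "?\<tau> ` F = (\<lambda>x. ?\<tau> (g x)) ` D" by (simp only: D(2) image_image)
    also have "\<dots> = g ` \<sigma> ` D"
      unfolding image_image by (rule image_cong[OF refl], rule \<tau>, rule subsetD[OF DV])
    finally show ?thesis using \<sigma>X[OF DV] D(1) by blast
  qed
  show "?\<tau> x = x" if "x \<notin> \<Union>((`) g ` X)" for x
    using that unfolding UX V_def by simp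
qed

lemma vertex_transitive_image:
  assumes inj: "inj_on g (\<Union>X)" and X: "simplicial_complex X" "finite X" and tr: "vertex_transitive X"
  shows "vertex_transitive ((`) g ` X)"
  unfolding vertex_transitive_def
proof (intro ballI)
  have UX: "vertices ((`) g ` X) = g ` \<Union>X" by (simp add: vertices_def image_Union)
  fix u w assume "u \<in> vertices ((`) g ` X)" "w \<in> vertices ((`) g ` X)"
  then obtain a b where ab: "a \<in> \<Union>X" "u = g a" "b \<in> \<Union>X" "w = g b" unfolding UX by blast
  then obtain \<sigma> where \<sigma>: "\<sigma> \<in> automorphisms X" "\<sigma> a = b"
    using tr unfolding vertex_transitive_def vertices_def by blast
  show "\<exists>\<sigma>\<in>automorphisms ((`) g ` X). \<sigma> u = w"
  proof (rule bexI[OF _ automorphism_image[OF inj \<sigma>(1) X]])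
    show "(if u \<in> g ` \<Union>X then g (\<sigma> (the_inv_into (\<Union>X) g u)) else u) = w"
      using imageI[OF ab(1), of g] \<sigma>(2) the_inv_into_f_f[OF inj ab(1)] ab(2,4) by simp
  qed
qed

lemma facets_image:
  assumes inj: "inj_on g (\<Union>X)" and F: "F \<in> facets ((`) g ` X)"
  obtains D where "D \<in> facets X" "F = g ` D"
proof -
  obtain D where D: "D \<in> X" "F = g ` D" using F by (auto simp: facets_def)
  have "G = D" if "G \<in> X" "D \<subseteq> G" for G
  proof -
    have "\<forall>H\<in>(`) g ` X. F \<subseteq> H \<longrightarrow> H = F" using F by (simp add: facets_def)
    from bspec[OF this imageI[OF that(1)]] have "g ` G = g ` D" using image_mono[OF that(2), of g] D(2) by simp
    moreover have "G \<subseteq> \<Union>X" "D \<subseteq> \<Union>X" using that(1) D(1) by blast+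
    ultimately show ?thesis using inj_on_image_eq_iff[OF inj] by blast
  qed
  then show ?thesis using D that by (auto simp: facets_def)
qed

lemma facet_transitive_image:
  assumes inj: "inj_on g (\<Union>X)" and X: "simplicial_complex X" "finite X" and tr: "facet_transitive X"
  shows "facet_transitive ((`) g ` X)"
  unfolding facet_transitive_def
proof (intro ballI)
  fix F G assume "F \<in> facets ((`) g ` X)" "G \<in> facets ((`) g ` X)"
  then obtain A B where AB: "A \<in> facets X" "F = g ` A" "B \<in> facets X" "G = g ` B"
    using facets_image[OF inj] by metis
  then obtain \<sigma> where \<sigma>: "\<sigma> \<in> automorphisms X" "\<sigma> ` A = B"
    using tr unfolding facet_transitive_def by blast
  have A: "A \<subseteq> \<Union>X" using AB(1) by (auto simp: facets_def)
  show "\<exists>\<sigma>\<in>automorphisms ((`) g ` X). \<sigma> ` F = G"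
  proof (rule bexI[OF _ automorphism_image[OF inj \<sigma>(1) X]])
    have "(if g x \<in> g ` \<Union>X then g (\<sigma> (the_inv_into (\<Union>X) g (g x))) else g x) = g (\<sigma> x)" if "x \<in> A" for x
      using subsetD[OF A that] the_inv_into_f_f[OF inj] by (metis imageI)
    then show "(\<lambda>y. if y \<in> g ` \<Union>X then g (\<sigma> (the_inv_into (\<Union>X) g y)) else y) ` F = G"
      unfolding AB(2,4) \<sigma>(2)[symmetric] image_image by (intro image_cong) auto
  qed
qed

section \<open>Sums of offsets and cyclic translates\<close>

lemma powers_of_3_add_eq:
  assumes "(3::nat) ^ x + 3 ^ w = 3 ^ y + 3 ^ z"
  shows "x = y \<and> w = z \<or> x = z \<and> w = y"
proof -
  have le: "w = z \<and> x = y" if xw: "x \<le> w" and yz: "y \<le> z" and e: "(3::nat) ^ x + 3 ^ w = 3 ^ y + 3 ^ z" for x w y z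
  proof -
    \<comment> \<open>With \<open>w\<close> the larger exponent the sum is at most
      \<open>2 * 3 ^ w\<close>, hence below the next power. So the larger exponents agree, and then
      the smaller ones.\<close>
    have lt: "(3::nat) ^ x + 3 ^ w < 3 ^ z" if "x \<le> w" "w < z" for x w z
    proof -
      have "(3::nat) ^ x \<le> 3 ^ w" using that(1) by (simp add: power_increasing)
      moreover have "(3::nat) ^ Suc w \<le> 3 ^ z" using that(2) by (intro power_increasing) auto
      moreover have "(0::nat) < 3 ^ w" by simp
      ultimately show ?thesis unfolding power_Suc by linarith
    qed
    have "\<not> w < z" using lt[OF xw, of z] e by auto
    moreover have "\<not> z < w" using lt[OF yz, of w] e by auto
    ultimately have "w = z" by simp
    then show ?thesis using e by simp
  qed
  show ?thesis
    using le[of x w y z] le[of w x y z] le[of x w z y] le[of w x z y] assms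
    by (metis add.commute nat_le_linear)
qed

text \<open>Witness: \<open>(3 ^ i - 1) / 2\<close>. The offsets \<open>0\<close> and \<open>1\<close> make consecutive translates share a vertex.\<close>

lemma sidon_offsets:
  fixes m :: nat
  obtains a :: "nat \<Rightarrow> nat" where "a 0 = 0" "a 1 = 1" "inj a" "\<And>i. i < m \<Longrightarrow> 2 * a i < 3 ^ m"
    "\<And>x w y z. a x + a w = a y + a z \<Longrightarrow> x = y \<and> w = z \<or> x = z \<and> w = y"
proof
  define a where "a i = ((3::nat) ^ i - 1) div 2" for i
  have a: "2 * a i + 1 = 3 ^ i" for i
  proof -
    have "odd ((3::nat) ^ i)" by simp
    then show ?thesis by (auto simp: a_def elim!: oddE)
  qed
  show "a 0 = 0" "a 1 = 1" by (simp_all add: a_def)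
  show "inj a"
  proof (rule injI)
    fix x y assume "a x = a y"
    then have "(3::nat) ^ x = 3 ^ y" using a[of x] a[of y] by simp
    then show "x = y" by simp
  qed
  show "2 * a i < 3 ^ m" if "i < m" for i
  proof -
    have "(3::nat) ^ i < 3 ^ m" using that by simp
    then show ?thesis using a[of i] by linarith
  qed
  fix x w y z assume "a x + a w = a y + a z"
  then have "(3::nat) ^ x + 3 ^ w = 3 ^ y + 3 ^ z" using a[of x] a[of w] a[of y] a[of z] by linarith
  then show "x = y \<and> w = z \<or> x = z \<and> w = y" by (rule powers_of_3_add_eq)
qed

lemma funpow_mod_Suc:
  fixes N :: nat
  assumes "u < N" "\<And>x. x < N \<Longrightarrow> \<sigma> x = (x + 1) mod N"
  shows "(\<sigma> ^^ k) u = (u + k) mod N"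
proof (induction k)
  case (Suc k)
  have "(\<sigma> ^^ Suc k) u = \<sigma> ((u + k) mod N)" using Suc by simp
  also have "\<dots> = ((u + k) mod N + 1) mod N" using assms by (intro assms(2)) simp
  also have "\<dots> = (u + Suc k) mod N" by (simp add: mod_simps)
  finally show ?case .
qed (use assms in simp)

lemma cyclic_construction:
  fixes K :: "'a set set"
  assumes K: "simplicial_complex K" "finite K" "edge_connected K" and v: "v \<in> \<Union>K"
  shows "\<exists>X :: nat set set. finite_simplicial_complex X \<and> vertex_transitive X \<and> wedge_type K X
    \<and> cyclic_vertex_transitive X"
proof -
  define V where "V = \<Union>K"
  define m where "m = card V"
  have finV: "finite V" unfolding V_def using K simplicial_complex_finite by blast
  obtain b where b: "bij_betw b V {..<m}"
    using finV by (metis m_def ex_bij_betw_finite_nat atLeast0LessThan)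
  obtain a0 :: "nat \<Rightarrow> nat" where a0: "a0 0 = 0" "a0 1 = 1" "inj a0" "\<And>i. i < m \<Longrightarrow> 2 * a0 i < 3 ^ m"
    "\<And>x w y z. a0 x + a0 w = a0 y + a0 z \<Longrightarrow> x = y \<and> w = z \<or> x = z \<and> w = y"
    using sidon_offsets[of m] by blast
  define a where "a j = a0 (b j)" for j
  \<comment> \<open>The modulus exceeds the sum of any two offsets, so the Sidon property survives
    modulo \<open>N\<close>. For a single vertex the translates would be disjoint points; there
    \<open>N = 1\<close> keeps the union connected.\<close>
  define N :: nat where "N = (if m = 1 then 1 else 3 ^ m)"
  have N0: "0 < N" by (simp add: N_def)
  have bm: "b j < m" if "j \<in> V" for j using b that by (auto simp: bij_betw_def)
  have ainj: "j = k" if "j \<in> V" "k \<in> V" "a j = a k" for j k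
    using that a0(3) b by (auto simp: a_def bij_betw_def inj_on_def inj_def)
  have aN: "2 * a j < N" if "j \<in> V" for j
    using a0(4)[OF bm[OF that]] bm[OF that] a0(1) by (auto simp: a_def N_def)
  have aadd: "j = j' \<and> k = k' \<or> j = k' \<and> k = j'"
    if "j \<in> V" "k \<in> V" "j' \<in> V" "k' \<in> V" "a j + a k = a j' + a k'" for j k j' k'
    using a0(5)[of "b j" "b k" "b j'" "b k'"] that b by (auto simp: a_def bij_betw_def inj_on_def)
  define \<phi> where "\<phi> t j = (t + a j) mod N" for t j
  define X where "X = (\<Union>t\<in>{..<N}. (`) (\<phi> t) ` K)"
  have XN: "x < N" if "x \<in> \<Union>X" for x
    using that N0 by (auto simp: X_def \<phi>_def)
  \<comment> \<open>Both sums are below \<open>2 * N\<close>, so congruent ones differ by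
    \<open>N\<close> at most.\<close>
  have phieq: "s + a j = t + a j' \<or> s + a j = t + a j' + N \<or> s + a j + N = t + a j'"
    if "s < N" "t < N" "j \<in> V" "j' \<in> V" "\<phi> s j = \<phi> t j'" for s t j j'
  proof -
    have "s + a j < 2 * N" "t + a j' < 2 * N" using that aN[OF that(3)] aN[OF that(4)] by auto
    moreover have "(s + a j) mod N = (t + a j') mod N" using that(5) by (simp add: \<phi>_def)
    moreover have "x mod N = (if x < N then x else x - N)" if "x < 2 * N" for x
      using that by (simp add: le_mod_geq)
    ultimately show ?thesis by (auto split: if_splits)
  qed
  have sX: "simplicial_complex X"
    unfolding X_def by (intro simplicial_complex_UN simplicial_complex_image K)
  have finX: "finite X" unfolding X_def using K(2) by simp
  have "\<exists>n l r. 0 < n \<and> X \<sim> wedge_form K v n l (r :: nat)"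
    unfolding X_def
  proof (rule glued_family_heq_wedge_form[OF K v, of "{..<N}" 0])
    show "0 \<in> {..<N}" using N0 by simp
    show "inj_on (\<phi> t) (\<Union>K)" if "t \<in> {..<N}" for t
    proof (rule inj_onI, fold V_def)
      fix j k assume jk: "j \<in> V" "k \<in> V" "\<phi> t j = \<phi> t k"
      then have "a j = a k" using phieq[of t t j k] aN[of j] aN[of k] that by auto
      then show "j = k" using ainj jk by blast
    qed
  next
    fix s t j k j' k'
    assume st: "s \<in> {..<N}" "t \<in> {..<N}" "s \<noteq> t" and V: "j \<in> \<Union>K" "k \<in> \<Union>K" "j' \<in> \<Union>K" "k' \<in> \<Union>K"
      and e: "\<phi> s j = \<phi> t j'" "\<phi> s k = \<phi> t k'"
    note V = V[folded V_def]
    \<comment> \<open>Subtracting the two congruences eliminates \<open>s\<close> and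
      \<open>t\<close>; multiples of \<open>N\<close> cannot occur, because both sides are below
      \<open>N\<close>.\<close>
    have "a j + a k' = a j' + a k"
      using phieq[of s t j j'] phieq[of s t k k'] st V e aN[OF V(1)] aN[OF V(2)] aN[OF V(3)] aN[OF V(4)]
      by auto
    then have "j = j' \<and> k' = k \<or> j = k \<and> k' = j'" using aadd V by blast
    moreover have "j \<noteq> j'" using phieq[of s t j j'] st V e by auto
    ultimately show "j = k" by blast
  next
    fix t assume t: "t \<in> {..<N}"
    have "t < N \<Longrightarrow> (0, t) \<in> (meets \<phi> (\<Union>K) {..<N})\<^sup>*"
    proof (induction t)
      case (Suc t)
      have "m \<noteq> 1" using Suc.prems by (auto simp: N_def split: if_splits)
      moreover have "m \<noteq> 0" using v finV by (auto simp: m_def V_def)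
      ultimately have "0 < m" "1 < m" by auto
      then obtain j0 j1 where j: "j0 \<in> V" "b j0 = 0" "j1 \<in> V" "b j1 = 1"
        using b unfolding bij_betw_def by (metis imageE lessThan_iff)
      have "\<phi> t j1 = \<phi> (Suc t) j0" using j a0(1,2) by (simp add: \<phi>_def a_def)
      moreover have "\<phi> t j1 \<in> \<phi> t ` \<Union>K" "\<phi> (Suc t) j0 \<in> \<phi> (Suc t) ` \<Union>K"
        using j unfolding V_def by (auto intro!: imageI)
      ultimately have "\<phi> t ` \<Union>K \<inter> \<phi> (Suc t) ` \<Union>K \<noteq> {}" by (metis IntI empty_iff)
      then have "(t, Suc t) \<in> meets \<phi> (\<Union>K) {..<N}" using Suc.prems by (simp add: meets_def)
      moreover have "(0, t) \<in> (meets \<phi> (\<Union>K) {..<N})\<^sup>*" using Suc by simp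
      ultimately show ?case by (rule rtrancl_into_rtrancl[rotated])
    qed simp
    then show "(0, t) \<in> (meets \<phi> (\<Union>K) {..<N})\<^sup>*" using t by simp
  qed simp
  then obtain n l and r :: nat where "0 < n" "X \<sim> wedge_form K v n l r" by blast
  then have wt: "wedge_type K X" using v K by (intro wedge_typeI)
  define \<sigma> where "\<sigma> k x = (if x \<in> \<Union>X then (x + k) mod N else x)" for k x
  have aut: "\<sigma> k \<in> automorphisms X" for k
  proof (rule automorphismI[OF sX finX])
    show "inj_on (\<sigma> k) (\<Union>X)"
    proof (rule inj_onI)
      fix x y assume xy: "x \<in> \<Union>X" "y \<in> \<Union>X" "\<sigma> k x = \<sigma> k y"
      then have "(x + k) mod N = (y + k) mod N" by (simp only: \<sigma>_def if_True)
      moreover have "p = q" if "p \<le> q" "p < N" "q < N" "(p + k) mod N = (q + k) mod N" for p q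
      proof -
        have "N dvd (q + k) - (p + k)" using that by (intro mod_eq_dvd_iff_nat[THEN iffD1]) auto
        then have "N dvd q - p" by simp
        then show ?thesis using that by (meson diff_is_0_eq' dvd_imp_le le_antisym less_imp_diff_less not_less zero_less_diff)
      qed
      ultimately show "x = y" using XN[OF xy(1)] XN[OF xy(2)] by (metis nat_le_linear)
    qed
    show "\<sigma> k ` F \<in> X" if F: "F \<in> X" for F
    proof -
      obtain t D where D: "t < N" "D \<in> K" "F = \<phi> t ` D" using F by (auto simp: X_def)
      have "\<sigma> k x = (x + k) mod N" if "x \<in> F" for x
        using that F unfolding \<sigma>_def by (meson UnionI)
      then have "\<sigma> k ` F = (\<lambda>x. (x + k) mod N) ` F" by (intro image_cong) auto
      also have "\<dots> = \<phi> ((t + k) mod N) ` D"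
        unfolding D(3) image_image \<phi>_def by (intro image_cong) (auto simp: mod_simps ac_simps)
      finally have "\<sigma> k ` F \<in> (`) (\<phi> ((t + k) mod N)) ` K" using D(2) by simp
      then show ?thesis unfolding X_def by (rule UN_I[rotated]) (simp add: N0)
    qed
  qed (simp only: \<sigma>_def if_False)
  have shift: "(u + (w + N - u)) mod N = w" if "u < N" "w < N" for u w
    using that by simp
  have "vertex_transitive X"
    unfolding vertex_transitive_def vertices_def
  proof (intro ballI)
    fix u w assume uw: "u \<in> \<Union>X" "w \<in> \<Union>X"
    have "\<sigma> (w + N - u) u = w" using uw shift[OF XN XN, OF uw] by (simp only: \<sigma>_def if_True)
    then show "\<exists>\<sigma>\<in>automorphisms X. \<sigma> u = w" using aut by blast
  qed
  moreover have UX: "\<Union>X = {..<N}"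
  proof (intro equalityI subsetI)
    fix x assume "x \<in> {..<N}"
    obtain D where "v \<in> D" "D \<in> K" using v by blast
    define t where "t = (x + N - a v) mod N"
    have "a v < N" using aN[of v] v by (simp add: V_def)
    then have "\<phi> t v = x" using \<open>x \<in> {..<N}\<close> by (simp add: \<phi>_def t_def mod_simps)
    moreover have "\<phi> t ` D \<in> X"
      unfolding X_def by (rule UN_I[of t]) (use \<open>D \<in> K\<close> N0 in \<open>simp_all add: t_def\<close>)
    ultimately show "x \<in> \<Union>X" using \<open>v \<in> D\<close> by blast
  qed (use XN in auto)
  have "cyclic_vertex_transitive X"
    unfolding cyclic_vertex_transitive_def vertices_def
  proof (intro bexI[OF _ aut[of 1]] ballI)
    fix u w assume uw: "u \<in> \<Union>X" "w \<in> \<Union>X"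
    have "(\<sigma> 1 ^^ (w + N - u)) u = (u + (w + N - u)) mod N"
      using uw UX by (intro funpow_mod_Suc) (auto simp: \<sigma>_def)
    then show "\<exists>k. (\<sigma> 1 ^^ k) u = w" using shift[OF XN XN, OF uw] by auto
  qed
  ultimately show ?thesis using sX finX wt by (auto simp: finite_simplicial_complex_def)
qed

section \<open>A finite quotient of a free product of groups of order two\<close>

locale word_permutations =
  fixes \<Lambda> :: "'c set" and d :: nat
  assumes fin_letters: "finite \<Lambda>"
begin

definition reduced :: "'c list set" where
  "reduced = {w. set w \<subseteq> \<Lambda> \<and> length w \<le> d \<and> distinct_adj w}"

text \<open>Left multiplication by the letter \<open>c\<close> in the free product of groups of order two, truncated
  to words of length at most \<open>d\<close>.\<close>

definition g :: "'c \<Rightarrow> 'c list \<Rightarrow> 'c list" where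
  "g c w = (if w \<in> reduced then if w \<noteq> [] \<and> hd w = c then tl w else if length w < d then c # w else w else w)"

definition act :: "'c list \<Rightarrow> 'c list \<Rightarrow> 'c list" where
  "act u = foldr (\<lambda>c f. g c \<circ> f) u id"

lemma act_simps [simp]: "act [] = id" "act (c # u) = g c \<circ> act u"
  by (simp_all add: act_def)

lemma finite_reduced: "finite reduced"
proof (rule finite_subset)
  show "reduced \<subseteq> {w. set w \<subseteq> \<Lambda> \<and> length w \<le> d}" by (auto simp: reduced_def)
qed (rule finite_lists_length_le[OF fin_letters])

lemma g_reduced: "c \<in> \<Lambda> \<Longrightarrow> w \<in> reduced \<Longrightarrow> g c w \<in> reduced"
  by (cases w) (auto simp: g_def reduced_def distinct_adj_Cons)

text \<open>\<open>g c\<close> exchanges \<open>w\<close> and \<open>c # w\<close> whenever both are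
  in \<open>reduced\<close>, and fixes everything else, in particular the words of full length
  \<open>d\<close> that do not start with \<open>c\<close>.\<close>

lemma g_g: "c \<in> \<Lambda> \<Longrightarrow> g c (g c w) = w"
proof (cases w)
  case Nil
  then show "c \<in> \<Lambda> \<Longrightarrow> g c (g c w) = w" by (auto simp: g_def reduced_def)
next
  case (Cons e w')
  then show "c \<in> \<Lambda> \<Longrightarrow> g c (g c w) = w"
    by (auto simp: g_def reduced_def distinct_adj_Cons)
qed

lemma g_comp_g: "c \<in> \<Lambda> \<Longrightarrow> g c \<circ> g c = id"
  by (simp add: fun_eq_iff g_g)

lemma comp_g_comp_g: "c \<in> \<Lambda> \<Longrightarrow> t \<circ> g c \<circ> g c = t"
  by (simp add: fun_eq_iff g_g)

lemma g_permutes: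
  assumes "c \<in> \<Lambda>"
  shows "g c permutes reduced"
proof (rule bij_imp_permutes)
  show "bij_betw (g c) reduced reduced"
    by (rule bij_betw_byWitness[where f' = "g c"]) (use g_g[OF assms] g_reduced[OF assms] in blast)+
qed (simp add: g_def)

text \<open>Each letter is prepended without cancellation and within the length bound, so the image
  of the empty word spells \<open>u\<close>. Hence different reduced words of length at most
  \<open>d\<close> act differently.\<close>

lemma act_Nil: "u \<in> reduced \<Longrightarrow> act u [] = u"
proof (induction u)
  case (Cons c u)
  then have "u \<in> reduced" by (auto simp: reduced_def distinct_adj_Cons)
  with Cons show ?case by (auto simp: g_def reduced_def distinct_adj_Cons)
qed simp

lemma act_inject: "u \<in> reduced \<Longrightarrow> w \<in> reduced \<Longrightarrow> act u = act w \<Longrightarrow> u = w"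
  by (metis act_Nil)

text \<open>The closure of \<open>t0\<close> under right multiplication by two-letter words from
  \<open>P\<close>. For symmetric \<open>P\<close> over the letters and \<open>t0 = id\<close> this
  is a group of permutations; other starting permutations give its left cosets.\<close>

inductive_set orb :: "('c \<times> 'c) set \<Rightarrow> ('c list \<Rightarrow> 'c list) \<Rightarrow> ('c list \<Rightarrow> 'c list) set"
  for P t0 where
  base: "t0 \<in> orb P t0"
| step: "t \<in> orb P t0 \<Longrightarrow> (c, e) \<in> P \<Longrightarrow> t \<circ> g c \<circ> g e \<in> orb P t0"

lemma orb_permutes:
  assumes "t \<in> orb P t0" "P \<subseteq> \<Lambda> \<times> \<Lambda>" "t0 permutes reduced"
  shows "t permutes reduced"
  using assms
proof induction
  case (step t c e)
  then have "c \<in> \<Lambda>" "e \<in> \<Lambda>" by auto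
  then show ?case using step by (intro permutes_compose g_permutes) auto
qed

lemma finite_orb: "P \<subseteq> \<Lambda> \<times> \<Lambda> \<Longrightarrow> t0 permutes reduced \<Longrightarrow> finite (orb P t0)"
  by (rule finite_subset[OF _ finite_permutations[OF finite_reduced]]) (auto intro: orb_permutes)

lemma permutes_left_cancel: "s permutes reduced \<Longrightarrow> s \<circ> f = s \<circ> f' \<Longrightarrow> f = f'"
proof
  fix x assume "s permutes reduced" "s \<circ> f = s \<circ> f'"
  then show "f x = f' x" using injD[OF permutes_inj, of s reduced "f x" "f' x"] by (metis comp_apply)
qed

lemma orb_comp:
  assumes "x \<in> orb P id" "t \<in> orb P t0"
  shows "x \<circ> t \<in> orb P (x \<circ> t0)"
  using assms(2)
proof induction
  case base
  show ?case by (rule orb.base)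
next
  case (step t c e)
  then have "(x \<circ> t) \<circ> g c \<circ> g e \<in> orb P (x \<circ> t0)" by (intro orb.step)
  then show ?case by (simp only: comp_assoc)
qed

lemma orb_trans:
  assumes "t \<in> orb P s" "s \<in> orb P t0"
  shows "t \<in> orb P t0"
  using assms(1)
proof induction
  case (step t c e)
  then show ?case by (intro orb.step)
qed (fact assms(2))

lemma orb_id_comp: "x \<in> orb P id \<Longrightarrow> t \<in> orb P id \<Longrightarrow> x \<circ> t \<in> orb P id"
  using orb_comp[of x P t id] orb_trans[of "x \<circ> t" P x id] by (simp only: comp_id)

text \<open>Letters are involutions, so the step by \<open>(c, e)\<close> is undone by
  \<open>(e, c)\<close>.\<close>

lemma orb_id_inverse:
  assumes "x \<in> orb P id" "P \<subseteq> \<Lambda> \<times> \<Lambda>" "sym P"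
  shows "\<exists>y\<in>orb P id. y \<circ> x = id \<and> x \<circ> y = id"
  using assms
proof induction
  case base
  show ?case by (rule bexI[OF _ orb.base]) (simp only: id_comp simp_thms)
next
  case (step x c e)
  obtain y where y: "y \<in> orb P id" "y \<circ> x = id" "x \<circ> y = id"
    using step.IH[OF step.prems] by blast
  have ce: "c \<in> \<Lambda>" "e \<in> \<Lambda>" "(e, c) \<in> P" using step by (auto dest: symD)
  have "id \<circ> g e \<circ> g c \<in> orb P id" using ce(3) by (intro orb.step orb.base)
  from orb_id_comp[OF this y(1)] have "g e \<circ> g c \<circ> y \<in> orb P id" by (simp only: id_comp)
  moreover have "(g e \<circ> g c \<circ> y) \<circ> (x \<circ> g c \<circ> g e) = id"
    using y(2) ce by (auto simp: fun_eq_iff g_g)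
  moreover have "(x \<circ> g c \<circ> g e) \<circ> (g e \<circ> g c \<circ> y) = id"
    using y(3) ce by (auto simp: fun_eq_iff g_g)
  ultimately show ?case by blast
qed

end

section \<open>Cayley graphs\<close>

context word_permutations
begin

lemma g_pair_eqD:
  assumes "2 \<le> d" "{a, b, c, e} \<subseteq> \<Lambda>" "a \<noteq> b" "c \<noteq> e" "g a \<circ> g b = g c \<circ> g e"
  shows "a = c" "b = e"
proof -
  have "act [a, b] = act [c, e]" using assms(5) by simp
  then have "[a, b] = [c, e]" using assms(1-4) by (intro act_inject) (auto simp: reduced_def)
  then show "a = c" "b = e" by auto
qed

lemma g_pair_neq_id:
  assumes "2 \<le> d" "a \<in> \<Lambda>" "b \<in> \<Lambda>" "a \<noteq> b"
  shows "g a \<circ> g b \<noteq> id"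
proof
  assume "g a \<circ> g b = id"
  then have "act [a, b] = act []" by simp
  then have "[a, b] = []" using assms by (intro act_inject) (auto simp: reduced_def)
  then show False by simp
qed

lemma g_inject:
  assumes "2 \<le> d" "a \<in> \<Lambda>" "b \<in> \<Lambda>" "g a = g b"
  shows "a = b"
  using g_pair_neq_id[OF assms(1-3)] g_comp_g[OF assms(2)] assms(4) by metis

text \<open>\<open>t \<circ> g c = s \<circ> g e\<close> says that \<open>t\<close> and \<open>s\<close> differ by the reduced word \<open>e c\<close>, so two copies that
  share two vertices are equal.\<close>

lemma g_shared_pair:
  assumes d: "2 \<le> d" and st: "s permutes reduced" "s \<noteq> t" and \<Lambda>: "{j, k, j', k'} \<subseteq> \<Lambda>"
    and e: "s \<circ> g j = t \<circ> g j'" "s \<circ> g k = t \<circ> g k'" and t: "t permutes reduced"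
  shows "j = k"
proof -
  have in\<Lambda>: "j \<in> \<Lambda>" "k \<in> \<Lambda>" "j' \<in> \<Lambda>" "k' \<in> \<Lambda>" using \<Lambda> by auto
  have s1: "s = t \<circ> (g j' \<circ> g j)" using e(1) comp_g_comp_g[OF in\<Lambda>(1), of s] by (simp add: comp_assoc)
  have s2: "s = t \<circ> (g k' \<circ> g k)" using e(2) comp_g_comp_g[OF in\<Lambda>(2), of s] by (simp add: comp_assoc)
  have eq: "g j' \<circ> g j = g k' \<circ> g k" by (rule permutes_left_cancel[OF t trans[OF s1[symmetric] s2]])
  have "j' \<noteq> j" using s1 st(2) g_comp_g[OF in\<Lambda>(1)] by auto
  moreover have "k' \<noteq> k" using s2 st(2) g_comp_g[OF in\<Lambda>(2)] by auto
  ultimately show "j = k" using g_pair_eqD(2)[OF d _ _ _ eq] in\<Lambda> by simp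
qed

text \<open>Serves both word constructions. \<open>\<kappa>\<close> is the kind of a vertex:
  constant for the Cayley graph, \<open>isl\<close> where leaves must not be identified with
  vertices of \<open>K\<close>. After the step by \<open>(c, e)\<close> the new copy has its vertex
  \<open>e\<close> where the old one has \<open>c\<close>, so equal kinds make consecutive copies
  intersect.\<close>

lemma orbit_family_heq_wedge_form:
  fixes L :: "'c set set" and \<kappa> :: "'c \<Rightarrow> 'k" and \<phi> :: "('c list \<Rightarrow> 'c list) \<Rightarrow> 'c \<Rightarrow> 'x"
  assumes L: "simplicial_complex L" "finite L" "edge_connected L" and v: "v \<in> \<Union>L"
    and \<Lambda>: "\<Union>L = \<Lambda>" and d: "2 \<le> d"
    and P: "P = {(p, q). p \<in> \<Lambda> \<and> q \<in> \<Lambda> \<and> \<kappa> p = \<kappa> q}" and t0: "t0 permutes reduced"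
    and \<phi>: "\<And>s t c e. \<phi> s c = \<phi> t e \<longleftrightarrow> \<kappa> c = \<kappa> e \<and> s \<circ> g c = t \<circ> g e"
  shows "\<exists>n l r. 0 < n \<and> (\<Union>t\<in>orb P t0. (`) (\<phi> t) ` L) \<sim> wedge_form L v n l (r :: 'x)"
proof (rule glued_family_heq_wedge_form[OF L v])
  have P\<Lambda>: "P \<subseteq> \<Lambda> \<times> \<Lambda>" using P by auto
  note perm = orb_permutes[OF _ P\<Lambda> t0]
  show "finite (orb P t0)" by (rule finite_orb[OF P\<Lambda> t0])
  show "t0 \<in> orb P t0" by (rule orb.base)
  show "inj_on (\<phi> t) (\<Union>L)" if "t \<in> orb P t0" for t
  proof (rule inj_onI, unfold \<Lambda>)
    fix c e assume ce: "c \<in> \<Lambda>" "e \<in> \<Lambda>" "\<phi> t c = \<phi> t e"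
    then have "g c = g e" using \<phi> permutes_left_cancel[OF perm[OF that]] by blast
    then show "c = e" using g_inject[OF d ce(1,2)] by simp
  qed
  show "j = k" if "s \<in> orb P t0" "t \<in> orb P t0" "s \<noteq> t" "j \<in> \<Union>L" "k \<in> \<Union>L" "j' \<in> \<Union>L" "k' \<in> \<Union>L"
    "\<phi> s j = \<phi> t j'" "\<phi> s k = \<phi> t k'" for s t j k j' k'
  proof (rule g_shared_pair[OF d perm[OF that(1)] that(3) _ _ _ perm[OF that(2)]])
    show "{j, k, j', k'} \<subseteq> \<Lambda>" using that(4-7) unfolding \<Lambda> by simp
    show "s \<circ> g j = t \<circ> g j'" "s \<circ> g k = t \<circ> g k'" using that(8,9) \<phi> by blast+
  qed
  show "(t0, t) \<in> (meets \<phi> (\<Union>L) (orb P t0))\<^sup>*" if "t \<in> orb P t0" for t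
    using that
  proof induction
    case (step t c e)
    have ce: "c \<in> \<Lambda>" "e \<in> \<Lambda>" "\<kappa> c = \<kappa> e" using step.hyps(2) P by auto
    have "\<phi> t c = \<phi> (t \<circ> g c \<circ> g e) e"
      unfolding \<phi> using ce(3) comp_g_comp_g[OF ce(2), of "t \<circ> g c"] by simp
    then have "\<phi> t c \<in> \<phi> t ` \<Union>L \<inter> \<phi> (t \<circ> g c \<circ> g e) ` \<Union>L"
      unfolding \<Lambda> using ce by (metis IntI imageI)
    then have "(t, t \<circ> g c \<circ> g e) \<in> meets \<phi> (\<Union>L) (orb P t0)"
      unfolding meets_def using step.hyps orb.step[OF step.hyps] by blast
    then show ?case using step.IH by (rule rtrancl_into_rtrancl[rotated])
  qed simp
qed

text \<open>For a flag complex \<open>L\<close> on the letters, the copies of \<open>L\<close> placed at the odd words fill exactly the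
  cliques of the Cayley graph on the even words: a triangle \<open>(i j)(p q) = (k l)\<close> of words of length two
  forces \<open>j = p\<close>.\<close>

lemma clique_complex_orbit:
  fixes L :: "'c set set"
  assumes L: "simplicial_complex L" and v: "v \<in> \<Union>L" and \<Lambda>: "\<Union>L = \<Lambda>" and d: "4 \<le> d"
    and flag: "\<And>\<sigma>. finite \<sigma> \<Longrightarrow> \<sigma> \<subseteq> \<Lambda> \<Longrightarrow> (\<And>c e. c \<in> \<sigma> \<Longrightarrow> e \<in> \<sigma> \<Longrightarrow> c \<noteq> e \<Longrightarrow> {c, e} \<in> L) \<Longrightarrow> \<sigma> \<in> L"
  defines "H \<equiv> orb (\<Lambda> \<times> \<Lambda>) id" and "T \<equiv> orb (\<Lambda> \<times> \<Lambda>) (g v)"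
    and "S \<equiv> {g c \<circ> g e | c e. c \<noteq> e \<and> {c, e} \<in> L}"
  shows "(\<Union>t\<in>T. (`) (\<lambda>c. t \<circ> g c) ` L) = clique_complex H (\<lambda>x y. \<exists>s\<in>S. y = x \<circ> s)"
proof -
  have v\<Lambda>: "v \<in> \<Lambda>" using v \<Lambda> by simp
  have d2: "2 \<le> d" using d by simp
  have permH: "x permutes reduced" if "x \<in> H" for x
    using orb_permutes[of x "\<Lambda> \<times> \<Lambda>" id] that permutes_id unfolding H_def by blast
  have permT: "t permutes reduced" if "t \<in> T" for t
    using orb_permutes[of t "\<Lambda> \<times> \<Lambda>" "g v"] that g_permutes[OF v\<Lambda>] unfolding T_def by blast
  \<comment> \<open>\<open>T\<close> holds the odd words and \<open>H\<close> the even ones; one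
    more letter leads from either to the other.\<close>
  have T_H: "t \<circ> g c \<in> H" if "t \<in> T" "c \<in> \<Lambda>" for t c
    using that unfolding T_def
  proof (induction arbitrary: c)
    case base
    have "id \<circ> g v \<circ> g c \<in> H" unfolding H_def using base v\<Lambda> by (intro orb.step orb.base) auto
    then show ?case by (simp only: id_comp)
  next
    case (step t a b)
    then have ab: "t \<circ> g a \<in> H" "(b, c) \<in> \<Lambda> \<times> \<Lambda>" by blast+
    have "(t \<circ> g a) \<circ> g b \<circ> g c \<in> H"
      unfolding H_def by (rule orb.step[OF ab[unfolded H_def]])
    then show ?case .
  qed
  have H_T: "x \<circ> g c \<in> T" if "x \<in> H" "c \<in> \<Lambda>" for x c
    using that unfolding H_def
  proof (induction arbitrary: c)
    case base
    have "g v \<circ> g v \<circ> g c \<in> T" unfolding T_def using base v\<Lambda> by (intro orb.step orb.base) auto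
    then show ?case by (simp only: g_comp_g[OF v\<Lambda>])
  next
    case (step t a b)
    then have ab: "t \<circ> g a \<in> T" "(b, c) \<in> \<Lambda> \<times> \<Lambda>" by blast+
    have "(t \<circ> g a) \<circ> g b \<circ> g c \<in> T"
      unfolding T_def by (rule orb.step[OF ab[unfolded T_def]])
    then show ?case .
  qed
  have pairL: "c \<in> \<Lambda>" "e \<in> \<Lambda>" if "{c, e} \<in> L" for c e
    using that unfolding \<Lambda>[symmetric] by blast+
  show ?thesis
  proof (intro equalityI subsetI)
    fix F assume "F \<in> (\<Union>t\<in>T. (`) (\<lambda>c. t \<circ> g c) ` L)"
    then obtain t \<sigma> where F: "t \<in> T" "\<sigma> \<in> L" "F = (\<lambda>c. t \<circ> g c) ` \<sigma>" by blast
    have \<sigma>\<Lambda>: "\<sigma> \<subseteq> \<Lambda>" using F(2) \<Lambda> by blast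
    have "F \<subseteq> H" unfolding F(3) using T_H[OF F(1)] \<sigma>\<Lambda> by blast
    moreover have "finite F" unfolding F(3) using simplicial_complex_finite[OF L F(2)] by (rule finite_imageI)
    moreover have "\<exists>s\<in>S. y = x \<circ> s" if xy: "x \<in> F" "y \<in> F" "x \<noteq> y" for x y
    proof -
      obtain c where c: "c \<in> \<sigma>" "x = t \<circ> g c" using xy(1) unfolding F(3) by (elim imageE)
      obtain e where e: "e \<in> \<sigma>" "y = t \<circ> g e" using xy(2) unfolding F(3) by (elim imageE)
      note ce = c e
      have "{c, e} \<in> L" using simplicial_complex_subset[OF L F(2), of "{c, e}"] ce(1,3) by simp
      moreover have "c \<noteq> e" using xy(3) ce by blast
      ultimately have "g c \<circ> g e \<in> S" unfolding S_def by blast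
      moreover have "y = x \<circ> (g c \<circ> g e)"
        using comp_g_comp_g[of c t] ce \<sigma>\<Lambda> by (simp add: comp_assoc[symmetric] subset_iff)
      ultimately show ?thesis by blast
    qed
    ultimately show "F \<in> clique_complex H (\<lambda>x y. \<exists>s\<in>S. y = x \<circ> s)" by (simp add: clique_complex_def)
  next
    fix F assume "F \<in> clique_complex H (\<lambda>x y. \<exists>s\<in>S. y = x \<circ> s)"
    then have F: "finite F" "F \<subseteq> H" and adj: "\<And>x y. x \<in> F \<Longrightarrow> y \<in> F \<Longrightarrow> x \<noteq> y \<Longrightarrow> \<exists>s\<in>S. y = x \<circ> s"
      by (auto simp: clique_complex_def)
    have adj': "\<exists>c e. c \<noteq> e \<and> {c, e} \<in> L \<and> y = x \<circ> (g c \<circ> g e)" if "x \<in> F" "y \<in> F" "x \<noteq> y" for x y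
      using adj[OF that] unfolding S_def by blast
    \<comment> \<open>All vertices of a clique belong to one copy. If
      \<open>y = x \<circ> (g i \<circ> g j)\<close>, it is the copy at
      \<open>x \<circ> g i\<close>, which has \<open>x\<close> as its vertex \<open>i\<close> and
      \<open>y\<close> as its vertex \<open>j\<close>.\<close>
    have "\<exists>t\<in>T. \<forall>z\<in>F. \<exists>c\<in>\<Lambda>. z = t \<circ> g c"
    proof (cases "\<exists>x\<in>F. \<exists>y\<in>F. x \<noteq> y")
      case False
      show ?thesis
      proof (cases "F = {}")
        case True
        have "g v \<in> T" unfolding T_def by (rule orb.base)
        then show ?thesis using True by blast
      next
        case ne: False
        then obtain x where x: "x \<in> F" "F = {x}" using False by blast
        have "x = (x \<circ> g v) \<circ> g v" using comp_g_comp_g[OF v\<Lambda>, of x] by simp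
        moreover have "x \<circ> g v \<in> T" using H_T[OF _ v\<Lambda>] x F by blast
        ultimately show ?thesis using x v\<Lambda> by blast
      qed
    next
      case True
      then obtain x y where xy: "x \<in> F" "y \<in> F" "x \<noteq> y" by blast
      obtain i j where ij: "i \<noteq> j" "{i, j} \<in> L" "y = x \<circ> (g i \<circ> g j)" using adj'[OF xy] by blast
      note ij\<Lambda> = pairL[OF ij(2)]
      have "x \<circ> g i \<in> T" using H_T[OF _ ij\<Lambda>(1)] xy(1) F(2) by blast
      moreover have "\<exists>c\<in>\<Lambda>. z = x \<circ> g i \<circ> g c" if z: "z \<in> F" for z
      proof -
        consider "z = x" | "z = y" | "z \<noteq> x" "z \<noteq> y" by blast
        then show ?thesis
        proof cases
          case 1
          then show ?thesis using comp_g_comp_g[OF ij\<Lambda>(1), of x] ij\<Lambda>(1) by metis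
        next
          case 2
          then show ?thesis using ij(3) ij\<Lambda>(2) by (metis comp_assoc)
        next
          case 3
          obtain k l where kl: "k \<noteq> l" "{k, l} \<in> L" "z = x \<circ> (g k \<circ> g l)" using adj'[OF xy(1) z] 3(1) by blast
          obtain p q where pq: "p \<noteq> q" "{p, q} \<in> L" "z = y \<circ> (g p \<circ> g q)" using adj'[OF xy(2) z] 3(2) by blast
          note kl\<Lambda> = pairL[OF kl(2)] and pq\<Lambda> = pairL[OF pq(2)]
          have "x permutes reduced" using permH xy(1) F(2) by blast
          then have eq: "g k \<circ> g l = g i \<circ> g j \<circ> (g p \<circ> g q)"
            by (rule permutes_left_cancel) (use kl(3) pq(3) ij(3) in \<open>simp add: comp_assoc\<close>)
          \<comment> \<open>Otherwise \<open>[i, j, p, q]\<close> is a reduced word of four letters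
            acting like the two-letter word \<open>[k, l]\<close>; this comparison requires
            \<open>4 \<le> d\<close>.\<close>
          have jp: "j = p"
          proof (rule ccontr)
            assume "j \<noteq> p"
            have "act [k, l] = act [i, j, p, q]" using eq by (simp add: comp_assoc)
            then have "[k, l] = [i, j, p, q]"
              using \<open>j \<noteq> p\<close> d ij\<Lambda> kl\<Lambda> pq\<Lambda> ij(1) kl(1) pq(1) by (intro act_inject) (auto simp: reduced_def)
            then show False by simp
          qed
          have eq': "g k \<circ> g l = g i \<circ> g q"
            using eq comp_g_comp_g[OF ij\<Lambda>(2), of "g i"] by (simp add: jp comp_assoc[symmetric])
          have "i \<noteq> q" using eq' g_pair_neq_id[OF d2 kl\<Lambda> kl(1)] g_comp_g[OF ij\<Lambda>(1)] by auto
          then have "k = i" using g_pair_eqD(1)[OF d2 _ kl(1) _ eq'] kl\<Lambda> ij\<Lambda> pq\<Lambda> by simp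
          then have "z = x \<circ> g i \<circ> g l" using kl(3) by (simp add: comp_assoc)
          then show ?thesis using kl\<Lambda>(2) by blast
        qed
      qed
      ultimately show ?thesis by blast
    qed
    then obtain t where t: "t \<in> T" "\<And>z. z \<in> F \<Longrightarrow> \<exists>c\<in>\<Lambda>. z = t \<circ> g c" by blast
    define \<sigma> where "\<sigma> = {c \<in> \<Lambda>. t \<circ> g c \<in> F}"
    have F\<sigma>: "F = (\<lambda>c. t \<circ> g c) ` \<sigma>" using t(2) unfolding \<sigma>_def by blast
    \<comment> \<open>Adjacency of the vertices at \<open>c\<close> and \<open>e\<close> equates
      \<open>g c \<circ> g e\<close> with a generator \<open>g p \<circ> g q\<close>; as two-letter
      words are unique, \<open>{c, e}\<close> is the edge \<open>{p, q}\<close> of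
      \<open>L\<close>.\<close>
    have "\<sigma> \<in> L"
    proof (rule flag)
      show \<sigma>\<Lambda>: "\<sigma> \<subseteq> \<Lambda>" by (auto simp: \<sigma>_def)
      then show "finite \<sigma>" using fin_letters finite_subset by blast
      fix c e assume ce: "c \<in> \<sigma>" "e \<in> \<sigma>" "c \<noteq> e"
      then have ce\<Lambda>: "c \<in> \<Lambda>" "e \<in> \<Lambda>" using \<sigma>\<Lambda> by auto
      have "t \<circ> g c \<noteq> t \<circ> g e"
        using permutes_left_cancel[OF permT[OF t(1)]] g_inject[OF d2 ce\<Lambda>] ce(3) by blast
      then obtain p q where pq: "p \<noteq> q" "{p, q} \<in> L" "t \<circ> g e = t \<circ> g c \<circ> (g p \<circ> g q)"
        using adj'[of "t \<circ> g c" "t \<circ> g e"] ce by (auto simp: \<sigma>_def)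
      have "g e = g c \<circ> (g p \<circ> g q)"
        by (rule permutes_left_cancel[OF permT[OF t(1)]]) (use pq(3) in \<open>simp add: comp_assoc\<close>)
      then have "g c \<circ> g e = g c \<circ> g c \<circ> (g p \<circ> g q)" by (simp add: comp_assoc)
      then have eq: "g c \<circ> g e = g p \<circ> g q" by (simp add: g_comp_g[OF ce\<Lambda>(1)])
      have "c = p" "e = q"
        using g_pair_eqD[OF d2 _ ce(3) pq(1) eq] ce\<Lambda> pairL[OF pq(2)] by auto
      then show "{c, e} \<in> L" using pq(2) by simp
    qed
    then show "F \<in> (\<Union>t\<in>T. (`) (\<lambda>c. t \<circ> g c) ` L)" using t(1) F\<sigma> by blast
  qed
qed

end

text \<open>A group carried by naturals is called for, so composition is transported along
  \<open>\<iota>\<close>. Adjacency is preserved because the inverse of \<open>x\<close> times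
  \<open>y\<close> is precisely the \<open>s\<close> with \<open>y = x \<circ> s\<close>.\<close>

lemma cayley_clique_complex_transfer:
  fixes H :: "('w \<Rightarrow> 'w) set" and \<iota> :: "('w \<Rightarrow> 'w) \<Rightarrow> nat"
  assumes fin: "finite H" and inj: "inj_on \<iota> H" and one: "id \<in> H"
    and comp: "\<And>x y. x \<in> H \<Longrightarrow> y \<in> H \<Longrightarrow> x \<circ> y \<in> H"
    and inverse: "\<And>x. x \<in> H \<Longrightarrow> \<exists>y\<in>H. y \<circ> x = id \<and> x \<circ> y = id"
    and S: "S \<subseteq> H" "id \<notin> S" "\<And>s. s \<in> S \<Longrightarrow> \<exists>s'\<in>S. s' \<circ> s = id"
  shows "is_cayley_clique_complex ((`) \<iota> ` clique_complex H (\<lambda>x y. \<exists>s\<in>S. y = x \<circ> s))"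
proof -
  define \<kappa> where "\<kappa> = the_inv_into H \<iota>"
  have \<kappa>: "\<kappa> (\<iota> x) = x" if "x \<in> H" for x unfolding \<kappa>_def using the_inv_into_f_f[OF inj that] .
  define G :: "nat monoid" where "G = \<lparr>carrier = \<iota> ` H, monoid.mult = (\<lambda>a b. \<iota> (\<kappa> a \<circ> \<kappa> b)), one = \<iota> id\<rparr>"
  have carrier: "carrier G = \<iota> ` H" and oneG: "\<one>\<^bsub>G\<^esub> = \<iota> id" by (simp_all add: G_def)
  have mult: "\<iota> x \<otimes>\<^bsub>G\<^esub> \<iota> y = \<iota> (x \<circ> y)" if "x \<in> H" "y \<in> H" for x y
    using that by (simp add: G_def \<kappa>)
  have grp: "group G"
  proof (rule groupI)
    show "\<one>\<^bsub>G\<^esub> \<in> carrier G" unfolding carrier oneG using one by (rule imageI)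
    fix a assume "a \<in> carrier G"
    then obtain x where x: "x \<in> H" "a = \<iota> x" unfolding carrier by blast
    show "\<one>\<^bsub>G\<^esub> \<otimes>\<^bsub>G\<^esub> a = a" unfolding oneG x(2) mult[OF one x(1)] by (simp only: id_comp)
    obtain y where y: "y \<in> H" "y \<circ> x = id" using inverse[OF x(1)] by blast
    have "\<iota> y \<otimes>\<^bsub>G\<^esub> a = \<one>\<^bsub>G\<^esub>" unfolding oneG x(2) mult[OF y(1) x(1)] y(2) ..
    then show "\<exists>y\<in>carrier G. y \<otimes>\<^bsub>G\<^esub> a = \<one>\<^bsub>G\<^esub>" unfolding carrier using y(1) by blast
    fix b assume "b \<in> carrier G"
    then obtain y where y: "y \<in> H" "b = \<iota> y" unfolding carrier by blast
    show "a \<otimes>\<^bsub>G\<^esub> b \<in> carrier G" unfolding x(2) y(2) mult[OF x(1) y(1)] carrier using comp x y by blast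
    fix c assume "c \<in> carrier G"
    then obtain z where z: "z \<in> H" "c = \<iota> z" unfolding carrier by blast
    show "a \<otimes>\<^bsub>G\<^esub> b \<otimes>\<^bsub>G\<^esub> c = a \<otimes>\<^bsub>G\<^esub> (b \<otimes>\<^bsub>G\<^esub> c)"
      unfolding x(2) y(2) z(2) using x(1) y(1) z(1) comp by (simp add: mult comp_assoc)
  qed
  have invG: "inv\<^bsub>G\<^esub> (\<iota> x) = \<iota> y" if "x \<in> H" "y \<in> H" "y \<circ> x = id" for x y
    using group.inv_equality[OF grp, of "\<iota> y" "\<iota> x"] that by (simp add: mult carrier oneG)
  have adj: "inv\<^bsub>G\<^esub> (\<iota> x) \<otimes>\<^bsub>G\<^esub> \<iota> y \<in> \<iota> ` S \<longleftrightarrow> (\<exists>s\<in>S. y = x \<circ> s)" if xy: "x \<in> H" "y \<in> H" for x y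
  proof -
    obtain z where z: "z \<in> H" "z \<circ> x = id" "x \<circ> z = id" using inverse[OF xy(1)] by blast
    have "inv\<^bsub>G\<^esub> (\<iota> x) \<otimes>\<^bsub>G\<^esub> \<iota> y = \<iota> (z \<circ> y)" unfolding invG[OF xy(1) z(1,2)] by (rule mult[OF z(1) xy(2)])
    then have "inv\<^bsub>G\<^esub> (\<iota> x) \<otimes>\<^bsub>G\<^esub> \<iota> y \<in> \<iota> ` S \<longleftrightarrow> z \<circ> y \<in> S"
      using inj_on_image_mem_iff[OF inj comp[OF z(1) xy(2)] S(1)] by simp
    also have "\<dots> \<longleftrightarrow> (\<exists>s\<in>S. y = x \<circ> s)"
    proof
      assume "z \<circ> y \<in> S"
      moreover have "y = x \<circ> (z \<circ> y)" by (simp only: comp_assoc[symmetric] z(3) id_comp)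
      ultimately show "\<exists>s\<in>S. y = x \<circ> s" by blast
    next
      assume "\<exists>s\<in>S. y = x \<circ> s"
      then obtain s where "s \<in> S" "y = x \<circ> s" by blast
      then show "z \<circ> y \<in> S" by (simp only: comp_assoc[symmetric] z(2) id_comp)
    qed
    finally show ?thesis .
  qed
  have eq: "(`) \<iota> ` clique_complex H (\<lambda>x y. \<exists>s\<in>S. y = x \<circ> s)
      = clique_complex (carrier G) (\<lambda>g h. inv\<^bsub>G\<^esub> g \<otimes>\<^bsub>G\<^esub> h \<in> \<iota> ` S)"
  proof (intro equalityI subsetI)
    fix F assume "F \<in> (`) \<iota> ` clique_complex H (\<lambda>x y. \<exists>s\<in>S. y = x \<circ> s)"
    then obtain D where D: "F = \<iota> ` D" "finite D" "D \<subseteq> H"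
      and a: "\<And>x y. x \<in> D \<Longrightarrow> y \<in> D \<Longrightarrow> x \<noteq> y \<Longrightarrow> \<exists>s\<in>S. y = x \<circ> s" by (auto simp: clique_complex_def)
    have "inv\<^bsub>G\<^esub> u \<otimes>\<^bsub>G\<^esub> w \<in> \<iota> ` S" if "u \<in> F" "w \<in> F" "u \<noteq> w" for u w
    proof -
      obtain x y where "x \<in> D" "u = \<iota> x" "y \<in> D" "w = \<iota> y" using \<open>u \<in> F\<close> \<open>w \<in> F\<close> D(1) by blast
      then show ?thesis using adj[of x y] a[of x y] D(3) \<open>u \<noteq> w\<close> by blast
    qed
    then show "F \<in> clique_complex (carrier G) (\<lambda>g h. inv\<^bsub>G\<^esub> g \<otimes>\<^bsub>G\<^esub> h \<in> \<iota> ` S)"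
      using D unfolding clique_complex_def carrier by blast
  next
    fix F assume "F \<in> clique_complex (carrier G) (\<lambda>g h. inv\<^bsub>G\<^esub> g \<otimes>\<^bsub>G\<^esub> h \<in> \<iota> ` S)"
    then have F: "finite F" "F \<subseteq> \<iota> ` H"
      and a: "\<And>u w. u \<in> F \<Longrightarrow> w \<in> F \<Longrightarrow> u \<noteq> w \<Longrightarrow> inv\<^bsub>G\<^esub> u \<otimes>\<^bsub>G\<^esub> w \<in> \<iota> ` S"
      by (auto simp: clique_complex_def carrier)
    obtain D where D: "D \<subseteq> H" "F = \<iota> ` D" using F(2) by (rule subset_imageE)
    have "finite D" using F(1) D inj_on_subset[OF inj D(1)] finite_imageD by blast
    moreover have "\<exists>s\<in>S. y = x \<circ> s" if xy: "x \<in> D" "y \<in> D" "x \<noteq> y" for x y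
    proof -
      have xyH: "x \<in> H" "y \<in> H" using xy D(1) by auto
      have "\<iota> x \<noteq> \<iota> y" using inj_onD[OF inj _ xyH] xy(3) by blast
      then show ?thesis using a[of "\<iota> x" "\<iota> y"] xy D(2) adj[OF xyH] by blast
    qed
    ultimately have "D \<in> clique_complex H (\<lambda>x y. \<exists>s\<in>S. y = x \<circ> s)"
      using D(1) by (simp add: clique_complex_def)
    then show "F \<in> (`) \<iota> ` clique_complex H (\<lambda>x y. \<exists>s\<in>S. y = x \<circ> s)" using D(2) by blast
  qed
  show ?thesis
    unfolding is_cayley_clique_complex_def
  proof (intro exI conjI ballI)
    show "group G" by (rule grp)
    show "finite (carrier G)" unfolding carrier using fin by (rule finite_imageI)
    show "\<iota> ` S \<subseteq> carrier G" unfolding carrier using S(1) by (rule image_mono)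
    show "\<one>\<^bsub>G\<^esub> \<notin> \<iota> ` S" unfolding oneG using inj_on_image_mem_iff[OF inj one S(1)] S(2) by simp
    show "inv\<^bsub>G\<^esub> u \<in> \<iota> ` S" if "u \<in> \<iota> ` S" for u
    proof -
      obtain s where s: "s \<in> S" "u = \<iota> s" using \<open>u \<in> \<iota> ` S\<close> by blast
      then obtain s' where s': "s' \<in> S" "s' \<circ> s = id" using S(3) by blast
      show ?thesis using invG[of s s'] s s' S(1) by blast
    qed
  qed (rule eq)
qed

lemma finite_injection_nat:
  assumes "finite A"
  obtains \<iota> :: "'b \<Rightarrow> nat" where "inj_on \<iota> A"
  using finite_imp_inj_to_nat_seg[OF assms] by blast

lemma cayley_construction:
  fixes K :: "'a set set"
  assumes K: "simplicial_complex K" "finite K" "edge_connected K" and v: "v \<in> \<Union>K"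
  shows "\<exists>X :: nat set set. finite_simplicial_complex X \<and> vertex_transitive X \<and> wedge_type K X
    \<and> is_cayley_clique_complex X"
proof -
  define \<Lambda> where "\<Lambda> = \<Union>(sd K)"
  have v\<Lambda>: "{v} \<in> \<Union>(sd K)"
    unfolding vertices_sd using simplicial_complex_empty_face(2)[OF K(1) v] by simp
  have finL: "finite (sd K)" by (rule finite_sd[OF K(2)])
  interpret word_permutations \<Lambda> 4
    by unfold_locales (use K(2) in \<open>simp add: \<Lambda>_def vertices_sd\<close>)
  define P where "P = \<Lambda> \<times> \<Lambda>"
  define H where "H = orb P id"
  define T where "T = orb P (g {v})"
  define S where "S = {g c \<circ> g e | c e. c \<noteq> e \<and> {c, e} \<in> sd K}"
  define X0 where "X0 = (\<Union>t\<in>T. (`) (\<lambda>c. t \<circ> g c) ` sd K)"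
  note v\<Lambda>' = v\<Lambda>[folded \<Lambda>_def]
  have P: "P \<subseteq> \<Lambda> \<times> \<Lambda>" "sym P" by (auto simp: P_def sym_def)
  have gv: "g {v} permutes reduced" by (rule g_permutes[OF v\<Lambda>'])
  have finH: "finite H" and finT: "finite T"
    unfolding H_def T_def using finite_orb[OF P(1)] gv permutes_id by blast+
  have X0: "X0 = clique_complex H (\<lambda>x y. \<exists>s\<in>S. y = x \<circ> s)"
    unfolding X0_def T_def H_def S_def P_def
  proof (rule clique_complex_orbit[OF simplicial_sd v\<Lambda> \<Lambda>_def[symmetric]])
    fix \<sigma> :: "'a set set"
    assume \<sigma>: "finite \<sigma>" "\<sigma> \<subseteq> \<Lambda>" and a: "\<And>c e. c \<in> \<sigma> \<Longrightarrow> e \<in> \<sigma> \<Longrightarrow> c \<noteq> e \<Longrightarrow> {c, e} \<in> sd K"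
    have "c \<subseteq> e \<or> e \<subseteq> c" if "c \<in> \<sigma>" "e \<in> \<sigma>" for c e
      using a[OF that] by (cases "c = e") (auto simp: sd_def chain_of_def)
    then show "\<sigma> \<in> sd K" using \<sigma> unfolding \<Lambda>_def vertices_sd by (simp add: sd_def chain_of_def)
  qed simp
  have sX0: "simplicial_complex X0"
    unfolding X0_def by (intro simplicial_complex_UN simplicial_complex_image simplicial_sd)
  have finX0: "finite X0" unfolding X0_def using finT finL by simp
  have X0H: "\<Union>X0 \<subseteq> H" unfolding X0 by (auto simp: clique_complex_def)
  have "\<exists>n l r. 0 < n \<and> (\<Union>t\<in>orb P (g {v}). (`) (\<lambda>c. t \<circ> g c) ` sd K) \<sim> wedge_form (sd K) {v} n l (r :: 'a set list \<Rightarrow> 'a set list)"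
    by (rule orbit_family_heq_wedge_form[OF simplicial_sd finL edge_connected_sd[OF K(1,3) v] v\<Lambda> \<Lambda>_def[symmetric] _ _ gv,
          where \<kappa> = "\<lambda>_. ()"]) (auto simp: P_def)
  then obtain n l and r :: "'a set list \<Rightarrow> 'a set list" where "0 < n" "X0 \<sim> wedge_form (sd K) {v} n l r"
    unfolding X0_def T_def by blast
  then have wt: "wedge_type K X0"
    by (intro wedge_typeI[OF heq_trans[OF _ wedge_form_sd[OF K v]] _ v K(1,2)])
  have vt: "vertex_transitive X0"
    unfolding vertex_transitive_def vertices_def
  proof (intro ballI)
    fix u w assume uw: "u \<in> \<Union>X0" "w \<in> \<Union>X0"
    obtain y where y: "y \<in> H" "y \<circ> u = id"
      using orb_id_inverse[OF _ P] uw(1) X0H unfolding H_def by blast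
    \<comment> \<open>\<open>y\<close> is the inverse of \<open>u\<close>, so left translation by
      \<open>h\<close> takes \<open>u\<close> to \<open>w\<close>.\<close>
    define h where "h = w \<circ> y"
    have hH: "h \<in> H" unfolding h_def H_def using uw(2) X0H y(1) by (intro orb_id_comp) (auto simp: H_def)
    define \<sigma> where "\<sigma> x = (if x \<in> \<Union>X0 then h \<circ> x else x)" for x
    have \<sigma>: "\<sigma> x = h \<circ> x" if "x \<in> \<Union>X0" for x using that by (simp only: \<sigma>_def if_True)
    have "\<sigma> \<in> automorphisms X0"
    proof (rule automorphismI[OF sX0 finX0])
      have hp: "h permutes reduced" using orb_permutes[OF _ P(1) permutes_id] hH unfolding H_def by blast
      show "inj_on \<sigma> (\<Union>X0)"
        by (rule inj_onI) (use \<sigma> permutes_left_cancel[OF hp] in metis)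
      show "\<sigma> ` F \<in> X0" if F: "F \<in> X0" for F
      proof -
        obtain t D where D: "t \<in> T" "D \<in> sd K" "F = (\<lambda>c. t \<circ> g c) ` D" using F unfolding X0_def by blast
        have "\<sigma> ` F = (\<lambda>x. h \<circ> x) ` F" using F by (intro image_cong refl \<sigma>) blast
        also have "\<dots> = (\<lambda>c. (h \<circ> t) \<circ> g c) ` D" unfolding D(3) image_image by (simp only: comp_assoc)
        finally have e: "\<sigma> ` F = (\<lambda>c. (h \<circ> t) \<circ> g c) ` D" .
        \<comment> \<open>Left translation by an even word has to keep the odd words; a doubled
          letter \<open>g {v}\<close> is inserted to regroup the pairs.\<close>
        have "h \<circ> g {v} \<in> T"
          using hH unfolding H_def
        proof induction
          case base
          show ?case unfolding T_def id_comp by (rule orb.base)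
        next
          case (step x c e)
          then have ce: "c \<in> \<Lambda>" "e \<in> \<Lambda>" by (auto simp: P_def)
          have pairs: "({v}, c) \<in> P" "(e, {v}) \<in> P" using ce v\<Lambda>' by (simp_all add: P_def)
          have "x \<circ> g {v} \<circ> g {v} \<circ> g c \<in> T"
            unfolding T_def by (rule orb.step[OF step.IH[unfolded T_def] pairs(1)])
          then have "x \<circ> g c \<in> T" by (simp only: comp_g_comp_g[OF v\<Lambda>'])
          then show ?case unfolding T_def by (rule orb.step[OF _ pairs(2)])
        qed
        then have "h \<circ> t \<in> T" using orb_comp[of h P t "g {v}"] D(1) hH orb_trans
          unfolding T_def H_def by blast
        then show ?thesis unfolding X0_def e using D(2) by blast
      qed
    qed (simp only: \<sigma>_def if_False)
    moreover have "\<sigma> u = w" unfolding \<sigma>[OF uw(1)] h_def comp_assoc y(2) by (simp only: comp_id)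
    ultimately show "\<exists>\<sigma>\<in>automorphisms X0. \<sigma> u = w" by blast
  qed
  obtain \<iota> :: "('a set list \<Rightarrow> 'a set list) \<Rightarrow> nat" where \<iota>: "inj_on \<iota> H" using finite_injection_nat[OF finH] .
  have \<iota>0: "inj_on \<iota> (\<Union>X0)" using inj_on_subset[OF \<iota> X0H] .
  have "is_cayley_clique_complex ((`) \<iota> ` X0)"
    unfolding X0
  proof (rule cayley_clique_complex_transfer[OF finH \<iota>])
    show "id \<in> H" unfolding H_def by (rule orb.base)
    show "x \<circ> y \<in> H" if "x \<in> H" "y \<in> H" for x y using that unfolding H_def by (rule orb_id_comp)
    show "\<exists>y\<in>H. y \<circ> x = id \<and> x \<circ> y = id" if "x \<in> H" for x
      using orb_id_inverse[OF _ P] that unfolding H_def by blast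
    have Sc: "\<exists>c e. s = g c \<circ> g e \<and> c \<noteq> e \<and> {c, e} \<in> sd K \<and> c \<in> \<Lambda> \<and> e \<in> \<Lambda>" if "s \<in> S" for s
      using that unfolding S_def \<Lambda>_def by blast
    show "S \<subseteq> H"
    proof
      fix s assume "s \<in> S"
      then obtain c e where ce: "s = g c \<circ> g e" "c \<in> \<Lambda>" "e \<in> \<Lambda>" using Sc by blast
      have "id \<circ> g c \<circ> g e \<in> H" unfolding H_def using ce by (intro orb.step orb.base) (auto simp: P_def)
      then show "s \<in> H" unfolding ce(1) by (simp only: id_comp)
    qed
    show "id \<notin> S" using Sc g_pair_neq_id by fastforce
    show "\<exists>s'\<in>S. s' \<circ> s = id" if "s \<in> S" for s
    proof -
      obtain c e where ce: "s = g c \<circ> g e" "c \<noteq> e" "{c, e} \<in> sd K" "c \<in> \<Lambda>" "e \<in> \<Lambda>" using Sc[OF \<open>s \<in> S\<close>] by blast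
      have "{e, c} \<in> sd K" using ce(3) by (simp only: insert_commute)
      then have "g e \<circ> g c \<in> S" using ce(2)[symmetric] unfolding S_def by blast
      moreover have "(g e \<circ> g c) \<circ> s = id" using ce(4,5) by (simp add: ce(1) fun_eq_iff g_g)
      ultimately show ?thesis by blast
    qed
  qed
  moreover have "vertex_transitive ((`) \<iota> ` X0)" by (rule vertex_transitive_image[OF \<iota>0 sX0 finX0 vt])
  moreover have "wedge_type K ((`) \<iota> ` X0)" by (rule wedge_type_heq[OF heq_image[OF sX0 \<iota>0] wt])
  moreover have "finite_simplicial_complex ((`) \<iota> ` X0)"
    unfolding finite_simplicial_complex_def using simplicial_complex_image[OF sX0] finX0 by blast
  ultimately show ?thesis by blast
qed

section \<open>Facet-transitive complexes\<close>

type_synonym 'a word_map = "('a + 'a set) list \<Rightarrow> ('a + 'a set) list"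

text \<open>The letters are the vertices of \<open>K\<close> whiskered at its facets:
  \<open>Inl j\<close> for a vertex, \<open>Inr i\<close> for a facet. Words of four letters arise
  when two large simplices share a vertex.\<close>

locale facet_words = word_permutations "\<Union>(whiskered K (facets K) c)" 4
  for K :: "'a set set" and c :: "'a set \<Rightarrow> 'a" +
  fixes v :: 'a
  assumes K: "simplicial_complex K" "finite K" "edge_connected K" and v: "v \<in> \<Union>K"
    and c: "\<And>i. i \<in> facets K \<Longrightarrow> c i \<in> i"
begin

abbreviation "\<Lambda> \<equiv> \<Union>(whiskered K (facets K) c)"
abbreviation "I \<equiv> facets K"
abbreviation "a j \<equiv> g (Inl j)"
abbreviation "b i \<equiv> g (Inr i)"

definition P :: "(('a + 'a set) \<times> ('a + 'a set)) set" where
  "P = {(p, q). p \<in> \<Lambda> \<and> q \<in> \<Lambda> \<and> isl p = isl q}"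

text \<open>The indices of the copies of \<open>K\<close>. A pair of vertex letters leads to a copy
  through a common vertex, a pair of facet letters to a copy that takes part in the same large
  simplex.\<close>

definition T :: "'a word_map set" where
  "T = orb P id"

text \<open>The indices of the large simplices: facet \<open>i\<close> of copy \<open>t\<close>
  belongs to the simplex \<open>t \<circ> b i\<close>, and since \<open>b i\<close> is an
  involution, \<open>block s i\<close> is facet \<open>i\<close> of the copy
  \<open>s \<circ> b i\<close>.\<close>

definition S :: "'a word_map set" where
  "S = {t \<circ> b k | t k. t \<in> T \<and> k \<in> I}"

definition block :: "'a word_map \<Rightarrow> 'a set \<Rightarrow> 'a word_map set" where
  "block s i = {s \<circ> b i \<circ> a j | j. j \<in> i}"

definition E :: "'a word_map \<Rightarrow> 'a word_map set" where
  "E s = (\<Union>i\<in>I. block s i)"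

text \<open>All facets are translates of one simplex, which contains one facet of each of several copies
  of \<open>K\<close>, one for every facet of \<open>K\<close>.\<close>

definition X0 :: "'a word_map set set" where
  "X0 = {D. \<exists>s\<in>S. D \<subseteq> E s}"

text \<open>The vertex at which block \<open>i\<close> remains tied to the apex over the simplex
  \<open>s\<close>.\<close>

definition w :: "'a word_map \<Rightarrow> 'a set \<Rightarrow> 'a word_map" where
  "w s i = s \<circ> b i \<circ> a (c i)"

lemma I_sub: "i \<in> I \<Longrightarrow> i \<in> K"
  by (simp add: facets_def)

lemma c_vertices: "c ` I \<subseteq> \<Union>K"
  using c I_sub by blast

lemma \<Lambda>_eq: "\<Lambda> = Inl ` \<Union>K \<union> Inr ` I"
  by (rule vertices_whiskered[OF c_vertices])

lemma facet_above:
  assumes "F \<in> K"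
  obtains i where "i \<in> I" "F \<subseteq> i"
proof -
  obtain i where "i \<in> K" "F \<subseteq> i" "\<forall>G\<in>K. i \<subseteq> G \<longrightarrow> i = G"
    using finite_has_maximal2[OF K(2) assms] by blast
  then show ?thesis using that[of i] by (auto simp: facets_def)
qed

lemma I_nonempty: "I \<noteq> {}"
  using v facet_above by (metis UnionE empty_iff)

lemma finite_I: "finite I"
  using K(2) by (rule rev_finite_subset) (auto simp: facets_def)

lemma letters: "i \<in> I \<Longrightarrow> Inr i \<in> \<Lambda>" "i \<in> I \<Longrightarrow> j \<in> i \<Longrightarrow> Inl j \<in> \<Lambda>" "x \<in> \<Union>K \<Longrightarrow> Inl x \<in> \<Lambda>"
proof -
  show "i \<in> I \<Longrightarrow> Inr i \<in> \<Lambda>" "x \<in> \<Union>K \<Longrightarrow> Inl x \<in> \<Lambda>" unfolding \<Lambda>_eq by blast+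
  assume "i \<in> I" "j \<in> i"
  then have "j \<in> \<Union>K" using I_sub by blast
  then show "Inl j \<in> \<Lambda>" unfolding \<Lambda>_eq by blast
qed

lemma P\<Lambda>: "P \<subseteq> \<Lambda> \<times> \<Lambda>" "sym P"
  by (auto simp: P_def sym_def)

lemma finite_T: "finite T"
  unfolding T_def by (rule finite_orb[OF P\<Lambda>(1) permutes_id])

lemma T_permutes: "t \<in> T \<Longrightarrow> t permutes reduced"
  unfolding T_def by (rule orb_permutes[OF _ P\<Lambda>(1) permutes_id])

lemma T_step: "t \<in> T \<Longrightarrow> p \<in> \<Lambda> \<Longrightarrow> q \<in> \<Lambda> \<Longrightarrow> isl p = isl q \<Longrightarrow> t \<circ> g p \<circ> g q \<in> T"
  unfolding T_def by (rule orb.step) (simp_all add: P_def)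

lemma T_comp: "x \<in> T \<Longrightarrow> y \<in> T \<Longrightarrow> x \<circ> y \<in> T"
  unfolding T_def by (rule orb_id_comp)

lemma T_inverse: "x \<in> T \<Longrightarrow> \<exists>y\<in>T. y \<circ> x = id \<and> x \<circ> y = id"
  unfolding T_def by (rule orb_id_inverse[OF _ P\<Lambda>])

lemma S_I: "t \<in> T \<Longrightarrow> k \<in> I \<Longrightarrow> t \<circ> b k \<in> S"
  unfolding S_def by blast

lemma S_E:
  assumes "s \<in> S"
  obtains t k where "t \<in> T" "k \<in> I" "s = t \<circ> b k"
  using assms unfolding S_def by blast

lemma S_T:
  assumes s: "s \<in> S" and i: "i \<in> I"
  shows "s \<circ> b i \<in> T"
proof -
  obtain t k where tk: "t \<in> T" "k \<in> I" "s = t \<circ> b k" using S_E[OF s] .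
  show ?thesis unfolding tk(3) by (rule T_step[OF tk(1) letters(1)[OF tk(2)] letters(1)[OF i]]) simp
qed

lemma S_permutes:
  assumes s: "s \<in> S"
  shows "s permutes reduced"
proof -
  obtain t k where tk: "t \<in> T" "k \<in> I" "s = t \<circ> b k" using S_E[OF s] .
  show ?thesis unfolding tk(3)
    by (rule permutes_compose[OF g_permutes[OF letters(1)[OF tk(2)]] T_permutes[OF tk(1)]])
qed

lemma finite_S: "finite S"
proof -
  have "S = (\<lambda>(t, k). t \<circ> b k) ` (T \<times> I)" unfolding S_def by auto
  then show ?thesis using finite_T finite_I by simp
qed

lemma finite_E: "finite (E s)"
proof -
  have "finite (block s i)" if "i \<in> I" for i
  proof -
    have "block s i = (\<lambda>j. s \<circ> b i \<circ> a j) ` i" unfolding block_def by blast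
    then show ?thesis using simplicial_complex_finite[OF K(1) I_sub[OF that]] by simp
  qed
  then show ?thesis unfolding E_def using finite_I by blast
qed

lemma block_E: "i \<in> I \<Longrightarrow> block s i \<subseteq> E s"
  unfolding E_def by blast

lemma w_block: "i \<in> I \<Longrightarrow> w s i \<in> block s i"
  unfolding w_def block_def using c by blast

lemma word_inject:
  assumes s: "s \<in> S" and ik: "i \<in> I" "k \<in> I" "j \<in> i" "l \<in> k" and e: "s \<circ> b i \<circ> a j = s \<circ> b k \<circ> a l"
  shows "i = k" "j = l"
proof -
  have eq: "b i \<circ> a j = b k \<circ> a l"
    by (rule permutes_left_cancel[OF S_permutes[OF s]]) (use e in \<open>simp only: comp_assoc\<close>)
  have "{Inr i, Inl j, Inr k, Inl l} \<subseteq> \<Lambda>" using letters(1)[OF ik(1)] letters(1)[OF ik(2)]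
      letters(2)[OF ik(1,3)] letters(2)[OF ik(2,4)] by simp
  then show "i = k" "j = l" using g_pair_eqD[OF _ _ _ _ eq] by auto
qed

lemma block_disjoint:
  assumes "s \<in> S" "i \<in> I" "k \<in> I" "x \<in> block s i" "x \<in> block s k"
  shows "i = k"
  using assms(4,5) word_inject(1)[OF assms(1-3)] unfolding block_def by blast

text \<open>The word leading from \<open>s'\<close> to \<open>s\<close> through a common vertex has
  the letters \<open>Inr k\<close>, \<open>Inl l\<close>, \<open>Inl j\<close>,
  \<open>Inr i\<close>; equal inner letters are cancelled, and then equal outer ones.\<close>

definition nf :: "'a set \<Rightarrow> 'a \<Rightarrow> 'a \<Rightarrow> 'a set \<Rightarrow> ('a + 'a set) list" where
  "nf k l j i = (if l = j then if k = i then [] else [Inr k, Inr i] else [Inr k, Inl l, Inl j, Inr i])"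

lemma nf:
  assumes ik: "i \<in> I" "k \<in> I" "j \<in> i" "l \<in> k" and s': "s' \<in> S" and e: "s \<circ> b i \<circ> a j = s' \<circ> b k \<circ> a l"
  shows "s = s' \<circ> act (nf k l j i)" "nf k l j i \<in> reduced"
proof -
  note lt = letters(1)[OF ik(1)] letters(1)[OF ik(2)] letters(2)[OF ik(1,3)] letters(2)[OF ik(2,4)]
  have "s = s \<circ> b i \<circ> a j \<circ> a j \<circ> b i"
    by (simp only: comp_g_comp_g[OF lt(3)] comp_g_comp_g[OF lt(1)])
  also have "\<dots> = s' \<circ> b k \<circ> a l \<circ> a j \<circ> b i" by (simp only: e)
  also have "\<dots> = s' \<circ> act (nf k l j i)"
  proof (cases "l = j")
    case True
    then have "s' \<circ> b k \<circ> a l \<circ> a j \<circ> b i = s' \<circ> b k \<circ> b i" by (simp only: comp_g_comp_g[OF lt(3)])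
    also have "\<dots> = s' \<circ> act (nf k l j i)"
      using comp_g_comp_g[OF lt(1), of s'] True by (simp add: nf_def comp_assoc)
    finally show ?thesis .
  next
    case False
    then show ?thesis by (simp add: nf_def comp_assoc)
  qed
  finally show "s = s' \<circ> act (nf k l j i)" .
  show "nf k l j i \<in> reduced" using lt unfolding nf_def reduced_def by simp
qed

text \<open>Both common vertices yield the same reduced word from \<open>s'\<close> to
  \<open>s\<close>. It is nonempty, and its last letter names the block of \<open>s\<close>; so two
  different large simplices meet within a single block.\<close>

lemma inter_block:
  assumes s: "s \<in> S" and s': "s' \<in> S" and ne: "s \<noteq> s'"
    and x: "i \<in> I" "k \<in> I" "j \<in> i" "l \<in> k" "s \<circ> b i \<circ> a j = s' \<circ> b k \<circ> a l"
    and y: "i' \<in> I" "k' \<in> I" "j' \<in> i'" "l' \<in> k'" "s \<circ> b i' \<circ> a j' = s' \<circ> b k' \<circ> a l'"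
  shows "i = i'"
proof -
  note 1 = nf[OF x(1-4) s' x(5)] and 2 = nf[OF y(1-4) s' y(5)]
  have "act (nf k l j i) = act (nf k' l' j' i')"
    by (rule permutes_left_cancel[OF S_permutes[OF s'] trans[OF 1(1)[symmetric] 2(1)]])
  then have eq: "nf k l j i = nf k' l' j' i'" by (rule act_inject[OF 1(2) 2(2)])
  have "nf k l j i \<noteq> []" using 1(1) ne by auto
  then show ?thesis using eq by (auto simp: nf_def split: if_splits)
qed

text \<open>Nothing that lies within one block counts. A face of this kind belongs to one large
  simplex only, and these are the faces to remove in order to uncover the copies of
  \<open>K\<close>.\<close>

definition spread :: "'a word_map \<Rightarrow> 'a word_map set \<Rightarrow> bool" where
  "spread s D \<longleftrightarrow> (\<forall>i\<in>I. \<not> D \<subseteq> block s i)"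

lemma spread_mono: "spread s D \<Longrightarrow> D \<subseteq> D' \<Longrightarrow> spread s D'"
  unfolding spread_def by blast

lemma spread_nonempty: "spread s D \<Longrightarrow> D \<noteq> {}"
  unfolding spread_def using I_nonempty by blast

lemma E_E: "x \<in> E s \<Longrightarrow> \<exists>i\<in>I. \<exists>j\<in>i. x = s \<circ> b i \<circ> a j"
  unfolding E_def block_def by blast

lemma spread_unique:
  assumes s: "s \<in> S" "s' \<in> S" and D: "D \<subseteq> E s" "D \<subseteq> E s'" and sp: "spread s D"
  shows "s' = s"
proof (rule ccontr)
  assume ne: "s' \<noteq> s"
  obtain x where x: "x \<in> D" using spread_nonempty[OF sp] by blast
  obtain i j where ij: "i \<in> I" "j \<in> i" "x = s \<circ> b i \<circ> a j" using E_E[OF subsetD[OF D(1) x]] by blast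
  obtain k l where kl: "k \<in> I" "l \<in> k" "x = s' \<circ> b k \<circ> a l" using E_E[OF subsetD[OF D(2) x]] by blast
  have "D \<subseteq> block s i"
  proof
    fix y assume y: "y \<in> D"
    obtain i' j' where ij': "i' \<in> I" "j' \<in> i'" "y = s \<circ> b i' \<circ> a j'" using E_E[OF subsetD[OF D(1) y]] by blast
    obtain k' l' where kl': "k' \<in> I" "l' \<in> k'" "y = s' \<circ> b k' \<circ> a l'" using E_E[OF subsetD[OF D(2) y]] by blast
    have "i = i'"
      by (rule inter_block[OF s ne[symmetric] ij(1) kl(1) ij(2) kl(2) trans[OF ij(3)[symmetric] kl(3)]
            ij'(1) kl'(1) ij'(2) kl'(2) trans[OF ij'(3)[symmetric] kl'(3)]])
    then show "y \<in> block s i" using ij' unfolding block_def by blast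
  qed
  then show False using sp ij(1) unfolding spread_def by blast
qed

section \<open>Cones over the large simplices\<close>

abbreviation "Tr D \<equiv> Pair True ` D"
abbreviation "Hb s D \<equiv> insert (False, s) (Pair True ` D)"

text \<open>\<open>X0\<close> with a cone over each \<open>E s\<close>. The tag \<open>True\<close>
  marks the vertices of \<open>X0\<close>, and \<open>(False, s)\<close> is the apex over
  \<open>E s\<close>. The apex takes over the linking of the blocks once the interior of the simplex
  is collapsed.\<close>

definition X1 :: "(bool \<times> 'a word_map) set set" where
  "X1 = (`) (Pair True) ` X0 \<union> {Hb s D | s D. s \<in> S \<and> D \<subseteq> E s}"

definition vert :: "(bool \<times> 'a word_map) set \<Rightarrow> 'a word_map set" where
  "vert G = {x. (True, x) \<in> G}"

definition hub :: "(bool \<times> 'a word_map) set \<Rightarrow> 'a word_map" where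
  "hub G = (SOME s. (False, s) \<in> G)"

lemma vert_simps: "vert (Tr D) = D" "vert (Hb s D) = D"
  by (auto simp: vert_def)

lemma hub_Hb: "hub (Hb s D) = s"
  unfolding hub_def by (rule some_equality) auto

lemma Tr_Hb:
  fixes s s' :: "'a word_map"
  shows "Tr D \<noteq> Hb s D'" "Tr D = Tr D' \<longleftrightarrow> D = D'" "Hb s D = Hb s' D' \<longleftrightarrow> s = s' \<and> D = D'"
proof -
  show "Tr D \<noteq> Hb s D'" by blast
  show "Tr D = Tr D' \<longleftrightarrow> D = D'" by (rule inj_image_eq_iff) (simp add: inj_def)
  show "Hb s D = Hb s' D' \<longleftrightarrow> s = s' \<and> D = D'"
  proof
    assume e: "Hb s D = Hb s' D'"
    show "s = s' \<and> D = D'"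
      using arg_cong[OF e, of vert] arg_cong[OF e, of hub] unfolding vert_simps hub_Hb by (rule conjI[rotated])
  qed simp
qed

lemma X1_cases:
  assumes "G \<in> X1"
  obtains s D where "s \<in> S" "D \<subseteq> E s" "G = Tr D" | s D where "s \<in> S" "D \<subseteq> E s" "G = Hb s D"
  using assms unfolding X1_def X0_def by blast

lemma X1_I: "s \<in> S \<Longrightarrow> D \<subseteq> E s \<Longrightarrow> Tr D \<in> X1" "s \<in> S \<Longrightarrow> D \<subseteq> E s \<Longrightarrow> Hb s D \<in> X1"
  unfolding X1_def X0_def by blast+

lemma X1_above_Hb:
  assumes "G \<in> X1" "Hb s D \<subseteq> G"
  obtains D' where "D \<subseteq> D'" "s \<in> S" "D' \<subseteq> E s" "G = Hb s D'"
  using assms(1)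
proof (cases rule: X1_cases)
  case (1 s' D')
  then show ?thesis using assms(2) by blast
next
  case (2 s' D')
  have "(False, s) \<in> G" using assms(2) by blast
  then have "s' = s" using 2(3) by blast
  moreover have "D \<subseteq> D'"
  proof
    fix x assume "x \<in> D"
    then have "(True, x) \<in> G" using assms(2) by blast
    then show "x \<in> D'" using 2(3) by blast
  qed
  ultimately show ?thesis using 2 that by blast
qed

lemma X1_above_Tr:
  assumes "G \<in> X1" "Tr D \<subseteq> G"
  obtains D' s where "D \<subseteq> D'" "s \<in> S" "D' \<subseteq> E s" "G = Tr D' \<or> G = Hb s D'"
proof -
  have sub: "D \<subseteq> D'" if "G = Tr D' \<or> G = Hb s D'" for s D'
  proof
    fix x assume "x \<in> D"
    then have "(True, x) \<in> G" using assms(2) by blast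
    then show "x \<in> D'" using that by blast
  qed
  from assms(1) show ?thesis
  proof (cases rule: X1_cases)
    case (1 s' D')
    show ?thesis by (rule that[OF sub 1(1,2)]) (use 1(3) in blast)+
  next
    case (2 s' D')
    show ?thesis by (rule that[OF sub 2(1,2)]) (use 2(3) in blast)+
  qed
qed

lemma simplicial_X0: "simplicial_complex X0"
  unfolding simplicial_complex_def X0_def using finite_E finite_subset by blast

lemma finite_X0: "finite X0"
proof -
  have "X0 = (\<Union>s\<in>S. Pow (E s))" unfolding X0_def by blast
  then show ?thesis using finite_S finite_E by simp
qed

lemma simplicial_X1: "simplicial_complex X1"
  unfolding simplicial_complex_def
proof (intro conjI ballI allI impI)
  fix F assume F: "F \<in> X1"
  then obtain s D where sD: "s \<in> S" "D \<subseteq> E s" "F = Tr D \<or> F = Hb s D" by (elim X1_cases) blast+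
  have "finite D" using sD(2) finite_E finite_subset by blast
  then show "finite F" using sD(3) by auto
  fix G assume G: "G \<subseteq> F"
  have V: "vert G \<subseteq> E s" using G sD(2,3) unfolding vert_def by blast
  have "G = Tr (vert G) \<or> G = Hb s (vert G)"
  proof (cases "(False, s) \<in> G")
    case True
    have "G = Hb s (vert G)"
    proof (intro equalityI subsetI)
      fix x assume "x \<in> G"
      then show "x \<in> Hb s (vert G)" using G sD(3) unfolding vert_def by blast
    next
      fix x assume "x \<in> Hb s (vert G)"
      then show "x \<in> G" using True unfolding vert_def by blast
    qed
    then show ?thesis by (rule disjI2)
  next
    case False
    have "G = Tr (vert G)"
    proof (intro equalityI subsetI)
      fix x assume "x \<in> G"
      then show "x \<in> Tr (vert G)" using G sD(3) False unfolding vert_def by blast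
    next
      fix x assume "x \<in> Tr (vert G)"
      then show "x \<in> G" unfolding vert_def by blast
    qed
    then show ?thesis by (rule disjI1)
  qed
  then show "G \<in> X1" using X1_I[OF sD(1) V] by metis
qed

lemma finite_X1: "finite X1"
proof -
  have "X1 = (`) (Pair True) ` X0 \<union> (\<Union>s\<in>S. (\<lambda>D. Hb s D) ` Pow (E s))"
    unfolding X1_def by blast
  then show ?thesis using finite_S finite_E finite_X0 by simp
qed

text \<open>Each cone disappears by toggling one fixed vertex of its base, the tie of the block
  \<open>i0\<close>, in all faces through the apex.\<close>

lemma X1_heq_X0: "X1 \<sim> X0"
proof -
  obtain i0 where i0: "i0 \<in> I" using I_nonempty by blast
  define R where "R = {Hb s D | s D. s \<in> S \<and> D \<subseteq> E s}"
  have wE: "w s i0 \<in> E s" for s using w_block[OF i0] block_E[OF i0] by blast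
  have eq: "(`) (Pair True) ` X0 = X1 - R"
  proof -
    have "G \<notin> R" if "G \<in> (`) (Pair True) ` X0" for G using that Tr_Hb(1) unfolding R_def by blast
    then show ?thesis unfolding X1_def R_def by blast
  qed
  have "X1 \<sim> (`) (Pair True) ` X0"
  proof (rule collapse_heq[OF simplicial_X1 finite_X1 _ _ eq, where h = "\<lambda>G. (True, w (hub G) i0)" and \<rho> = "\<lambda>_. 0"])
    show "R \<subseteq> X1" unfolding X1_def R_def by blast
    show "{} \<notin> R" unfolding R_def by blast
    fix G assume "G \<in> R"
    then obtain s D where G: "s \<in> S" "D \<subseteq> E s" "G = Hb s D" unfolding R_def by blast
    have 1: "insert (True, w s i0) (Hb s D) = Hb s (insert (w s i0) D)" by blast
    have 2: "Hb s D - {(True, w s i0)} = Hb s (D - {w s i0})" by blast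
    have "Hb s (insert (w s i0) D) \<in> R" "Hb s (D - {w s i0}) \<in> R"
      using G(1,2) wE unfolding R_def by blast+
    then show "insert (True, w (hub G) i0) G \<in> R
      \<and> (True, w (hub (insert (True, w (hub G) i0) G)) i0) = (True, w (hub G) i0)
      \<and> G - {(True, w (hub G) i0)} \<in> R
      \<and> (True, w (hub (G - {(True, w (hub G) i0)})) i0) = (True, w (hub G) i0) \<and> (0 :: nat) = 0"
      unfolding G(3) hub_Hb 1 2 by simp
  next
    fix F G assume F: "F \<in> R" and G: "G \<in> X1" and FG: "F \<subseteq> G"
    obtain s D where sD: "s \<in> S" "D \<subseteq> E s" "F = Hb s D" using F unfolding R_def by blast
    obtain D' where D': "s \<in> S" "D' \<subseteq> E s" "G = Hb s D'" using X1_above_Hb[OF G FG[unfolded sD(3)]] .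
    have "G \<in> R" using D' unfolding R_def by blast
    then show "G \<in> R \<and> ((0 :: nat) < 0 \<or> (0 :: nat) = 0 \<and> (True, w (hub F) i0) = (True, w (hub G) i0))"
      unfolding sD(3) D'(3) hub_Hb by simp
  qed
  also have "\<dots> \<sim> X0"
    by (rule heq_sym[OF heq_image[OF simplicial_X0]]) (simp add: inj_on_def)
  finally show ?thesis .
qed

text \<open>Toggling the apex pairs these faces; which apex is determined by the face, as a spread
  face lies in one large simplex only.\<close>

definition R1 :: "(bool \<times> 'a word_map) set set" where
  "R1 = {G. \<exists>s\<in>S. \<exists>D\<subseteq>E s. spread s D \<and> (G = Tr D \<or> G = Hb s D)}"

text \<open>The cone over each block is collapsed by toggling \<open>w s i\<close>. The apex alone
  determines no block, so it is left out together with its edges to the ties.\<close>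

definition R2 :: "(bool \<times> 'a word_map) set set" where
  "R2 = {Hb s D | s D. s \<in> S \<and> (\<exists>i\<in>I. D \<subseteq> block s i \<and> D \<noteq> {} \<and> D \<noteq> {w s i})}"

lemma R1_up:
  assumes F: "F \<in> R1" and G: "G \<in> X1" and FG: "F \<subseteq> G"
  obtains s D D' where "s \<in> S" "D \<subseteq> E s" "spread s D" "F = Tr D \<or> F = Hb s D"
    "D' \<subseteq> E s" "spread s D'" "G = Tr D' \<or> G = Hb s D'"
proof -
  obtain s D where sD: "s \<in> S" "D \<subseteq> E s" "spread s D" "F = Tr D \<or> F = Hb s D"
    using F unfolding R1_def by blast
  have "Tr D \<subseteq> G" using sD(4) FG by blast
  then obtain D' s' where D': "D \<subseteq> D'" "s' \<in> S" "D' \<subseteq> E s'" "G = Tr D' \<or> G = Hb s' D'"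
    using X1_above_Tr[OF G] by metis
  have "s' = s" using spread_unique[OF sD(1) D'(2) sD(2) _ sD(3)] D'(1,3) by blast
  then show ?thesis using that[OF sD] D' spread_mono[OF sD(3) D'(1)] by blast
qed

lemma R1_I: "s \<in> S \<Longrightarrow> D \<subseteq> E s \<Longrightarrow> spread s D \<Longrightarrow> G = Tr D \<or> G = Hb s D \<Longrightarrow> G \<in> R1"
  unfolding R1_def by blast

lemma X1_heq_R1: "X1 \<sim> X1 - R1"
proof -
  define h where "h G = (False, SOME s. s \<in> S \<and> vert G \<subseteq> E s)" for G :: "(bool \<times> 'a word_map) set"
  have h: "h G = (False, s)" if "s \<in> S" "D \<subseteq> E s" "spread s D" "G = Tr D \<or> G = Hb s D" for s D G
  proof -
    have V: "vert G = D" using that(4) vert_simps by metis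
    have "(SOME s. s \<in> S \<and> vert G \<subseteq> E s) = s"
      unfolding V using that spread_unique[OF that(1) _ that(2) _ that(3)] by (intro some_equality) blast+
    then show ?thesis by (simp add: h_def)
  qed
  show ?thesis
  proof (rule collapse_heq[OF simplicial_X1 finite_X1 _ _ refl, where h = h and \<rho> = "\<lambda>_. 0"])
    show "R1 \<subseteq> X1" unfolding R1_def using X1_I by blast
    show "{} \<notin> R1" unfolding R1_def using spread_nonempty by blast
    fix G assume "G \<in> R1"
    then obtain s D where G: "s \<in> S" "D \<subseteq> E s" "spread s D" "G = Tr D \<or> G = Hb s D" unfolding R1_def by blast
    have 1: "insert (False, s) G = Hb s D" using G(4) by blast
    have 2: "G - {(False, s)} = Tr D" using G(4) by blast
    have 3: "Hb s D \<in> R1" "Tr D \<in> R1" by (rule R1_I[OF G(1-3)]; blast)+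
    have 4: "h (Hb s D) = (False, s)" "h (Tr D) = (False, s)" by (rule h[OF G(1-3)]; blast)+
    show "insert (h G) G \<in> R1 \<and> h (insert (h G) G) = h G \<and> G - {h G} \<in> R1 \<and> h (G - {h G}) = h G \<and> (0 :: nat) = 0"
      unfolding h[OF G] 1 2 4 using 3 by blast
  next
    fix F G assume "F \<in> R1" "G \<in> X1" "F \<subseteq> G"
    then obtain s D D' where sD: "s \<in> S" "D \<subseteq> E s" "spread s D" "F = Tr D \<or> F = Hb s D"
      "D' \<subseteq> E s" "spread s D'" "G = Tr D' \<or> G = Hb s D'" by (rule R1_up)
    have "h F = h G" unfolding h[OF sD(1-4)] h[OF sD(1,5-7)] ..
    then show "G \<in> R1 \<and> ((0 :: nat) < 0 \<or> (0 :: nat) = 0 \<and> h F = h G)"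
      using R1_I[OF sD(1,5-7)] by blast
  qed
qed

lemma simplicial_X1_R1: "simplicial_complex (X1 - R1)"
proof (rule simplicial_complex_Diff[OF simplicial_X1])
  fix F G assume "F \<in> R1" "G \<in> X1" "F \<subseteq> G"
  then obtain s D D' where sD: "s \<in> S" "D \<subseteq> E s" "spread s D" "F = Tr D \<or> F = Hb s D"
    "D' \<subseteq> E s" "spread s D'" "G = Tr D' \<or> G = Hb s D'" by (rule R1_up)
  show "G \<in> R1" by (rule R1_I[OF sD(1,5-7)])
qed

lemma Hb_R1: "Hb s D \<in> R1 \<longleftrightarrow> s \<in> S \<and> D \<subseteq> E s \<and> spread s D"
proof
  assume "Hb s D \<in> R1"
  then obtain s' D' where s': "s' \<in> S" "D' \<subseteq> E s'" "spread s' D'" "Hb s D = Tr D' \<or> Hb s D = Hb s' D'"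
    unfolding R1_def by (elim CollectE bexE exE conjE)
  then have "Hb s D = Hb s' D'" using Tr_Hb(1)[of D' s D] by metis
  then have "s = s'" "D = D'" unfolding Tr_Hb(3) by simp_all
  then show "s \<in> S \<and> D \<subseteq> E s \<and> spread s D" using s'(1-3) by simp
next
  assume "s \<in> S \<and> D \<subseteq> E s \<and> spread s D"
  then show "Hb s D \<in> R1" by (elim conjE) (rule R1_I, assumption+, rule disjI2, rule refl)
qed

lemma R2_I: "s \<in> S \<Longrightarrow> i \<in> I \<Longrightarrow> D \<subseteq> block s i \<Longrightarrow> D \<noteq> {} \<Longrightarrow> D \<noteq> {w s i} \<Longrightarrow> Hb s D \<in> R2"
  unfolding R2_def by blast

lemma R2_E:
  assumes "G \<in> R2"
  obtains s i D where "s \<in> S" "i \<in> I" "D \<subseteq> block s i" "D \<noteq> {}" "D \<noteq> {w s i}" "G = Hb s D"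
  using assms unfolding R2_def by blast

lemma R2_heq: "X1 - R1 \<sim> X1 - R1 - R2"
proof -
  define h where "h G = (True, w (hub G) (SOME i. i \<in> I \<and> vert G \<subseteq> block (hub G) i))"
    for G :: "(bool \<times> 'a word_map) set"
  have uniq: "k = i" if "s \<in> S" "i \<in> I" "D \<subseteq> block s i" "D \<noteq> {}" "k \<in> I" "D \<subseteq> block s k" for s i k D
    using that block_disjoint[OF that(1,2,5)] by blast
  have h: "h (Hb s D) = (True, w s i)" if "s \<in> S" "i \<in> I" "D \<subseteq> block s i" "D \<noteq> {}" for s i D
  proof -
    have "(SOME i. i \<in> I \<and> D \<subseteq> block s i) = i"
      using that uniq[OF that] by (intro some_equality) blast+
    then show ?thesis unfolding h_def hub_Hb vert_simps by simp
  qed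
  show ?thesis
  proof (rule collapse_heq[OF simplicial_X1_R1 _ _ _ refl, where h = h and \<rho> = "\<lambda>_. 0"])
    show "finite (X1 - R1)" using finite_X1 by simp
    show "R2 \<subseteq> X1 - R1"
    proof
      fix G assume "G \<in> R2"
      then obtain s i D where G: "s \<in> S" "i \<in> I" "D \<subseteq> block s i" "D \<noteq> {}" "D \<noteq> {w s i}" "G = Hb s D" by (rule R2_E)
      have "D \<subseteq> E s" using G(3) block_E[OF G(2)] by blast
      moreover have "\<not> spread s D" unfolding spread_def using G(2,3) by blast
      ultimately show "G \<in> X1 - R1" using X1_I(2)[OF G(1)] Hb_R1 unfolding G(6) by blast
    qed
    show "{} \<notin> R2" unfolding R2_def by blast
    fix G assume "G \<in> R2"
    then obtain s i D where G: "s \<in> S" "i \<in> I" "D \<subseteq> block s i" "D \<noteq> {}" "D \<noteq> {w s i}" "G = Hb s D" by (rule R2_E)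
    let ?w = "w s i"
    have 1: "insert (True, ?w) (Hb s D) = Hb s (insert ?w D)" by blast
    have 2: "Hb s D - {(True, ?w)} = Hb s (D - {?w})" by blast
    have D1: "insert ?w D \<subseteq> block s i" "insert ?w D \<noteq> {}" "insert ?w D \<noteq> {?w}"
      using G(3-5) w_block[OF G(2)] by blast+
    have D2: "D - {?w} \<subseteq> block s i" "D - {?w} \<noteq> {}" "D - {?w} \<noteq> {?w}"
      using G(3-5) by blast+
    show "insert (h G) G \<in> R2 \<and> h (insert (h G) G) = h G \<and> G - {h G} \<in> R2 \<and> h (G - {h G}) = h G \<and> (0 :: nat) = 0"
      unfolding G(6) h[OF G(1-4)] 1 2 h[OF G(1,2) D1(1,2)] h[OF G(1,2) D2(1,2)]
      using R2_I[OF G(1,2) D1] R2_I[OF G(1,2) D2] by blast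
  next
    fix F G assume F: "F \<in> R2" and GX: "G \<in> X1 - R1" and FG: "F \<subseteq> G"
    obtain s i D where sD: "s \<in> S" "i \<in> I" "D \<subseteq> block s i" "D \<noteq> {}" "D \<noteq> {w s i}" "F = Hb s D" using R2_E[OF F] .
    have "G \<in> X1" using GX by blast
    then obtain D' where D': "D \<subseteq> D'" "D' \<subseteq> E s" "G = Hb s D'" using X1_above_Hb[OF _ FG[unfolded sD(6)]] by metis
    have "\<not> spread s D'" using GX Hb_R1 sD(1) D'(2) unfolding D'(3) by blast
    then obtain k where k: "k \<in> I" "D' \<subseteq> block s k" unfolding spread_def by blast
    have "k = i" using uniq[OF sD(1-4) k(1)] k(2) D'(1) by blast
    then have b': "D' \<subseteq> block s i" "D' \<noteq> {}" "D' \<noteq> {w s i}" using k(2) D'(1) sD(4,5) by blast+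
    have "h F = h G" unfolding sD(6) D'(3) h[OF sD(1-4)] h[OF sD(1,2) b'(1,2)] ..
    then show "G \<in> R2 \<and> ((0 :: nat) < 0 \<or> (0 :: nat) = 0 \<and> h F = h G)"
      using R2_I[OF sD(1,2) b'] unfolding D'(3) by blast
  qed
qed

text \<open>The first component agrees with the tag in \<open>X1\<close>: vertex letters yield
  vertices of \<open>X0\<close>, facet letters yield apexes.\<close>

definition \<phi> :: "'a word_map \<Rightarrow> 'a + 'a set \<Rightarrow> bool \<times> 'a word_map" where
  "\<phi> t p = (isl p, t \<circ> g p)"

lemma \<phi>_simps: "\<phi> t (Inl j) = (True, t \<circ> a j)" "\<phi> t (Inr i) = (False, t \<circ> b i)"
  by (simp_all add: \<phi>_def)

lemma \<phi>_faces:
  "\<phi> t ` Inl ` \<sigma> = Tr ((\<lambda>j. t \<circ> a j) ` \<sigma>)" "\<phi> t ` {Inr i} = Hb (t \<circ> b i) {}"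
  "\<phi> t ` {Inl (c i), Inr i} = Hb (t \<circ> b i) {t \<circ> a (c i)}"
  by (simp_all add: image_image \<phi>_simps insert_commute)

text \<open>What survives of the cones are the ties, and they turn the copies of \<open>K\<close>
  into whiskered copies: the apex over \<open>t \<circ> b i\<close> is the leaf \<open>Inr i\<close>
  of copy \<open>t\<close>, shared by all copies with a block in that simplex.\<close>

lemma remaining_eq: "X1 - R1 - R2 = (\<Union>t\<in>T. (`) (\<phi> t) ` whiskered K I c)"
proof (intro equalityI subsetI)
  fix G assume G: "G \<in> X1 - R1 - R2"
  have cancel: "s \<circ> b i \<circ> b i = s" if "i \<in> I" for s i by (rule comp_g_comp_g[OF letters(1)[OF that]])
  have "G \<in> X1" using G by blast
  then show "G \<in> (\<Union>t\<in>T. (`) (\<phi> t) ` whiskered K I c)"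
  proof (cases rule: X1_cases)
    case (1 s D)
    then have "\<not> spread s D" using G R1_I[OF 1(1,2), of G] by blast
    then obtain i where i: "i \<in> I" "D \<subseteq> block s i" unfolding spread_def by blast
    have "block s i = (\<lambda>j. s \<circ> b i \<circ> a j) ` i" unfolding block_def by blast
    with i(2) have "D \<subseteq> (\<lambda>j. s \<circ> b i \<circ> a j) ` i" by (simp only:)
    then obtain \<sigma> where \<sigma>: "\<sigma> \<subseteq> i" "D = (\<lambda>j. s \<circ> b i \<circ> a j) ` \<sigma>" by (rule subset_imageE)
    have "\<sigma> \<in> K" using simplicial_complex_subset[OF K(1) I_sub[OF i(1)] \<sigma>(1)] .
    then have "Inl ` \<sigma> \<in> whiskered K I c" unfolding whiskered_def by blast
    moreover have "G = \<phi> (s \<circ> b i) ` Inl ` \<sigma>" unfolding \<phi>_faces 1(3) \<sigma>(2) ..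
    ultimately show ?thesis using S_T[OF 1(1) i(1)] by blast
  next
    case (2 s D)
    then have "\<not> spread s D" using G R1_I[OF 2(1,2), of G] by blast
    then obtain i where i: "i \<in> I" "D \<subseteq> block s i" unfolding spread_def by blast
    have "D = {} \<or> D = {w s i}" using G R2_I[OF 2(1) i] 2(3) by blast
    then show ?thesis
    proof
      assume D: "D = {}"
      have "G = \<phi> (s \<circ> b i) ` {Inr i}" unfolding \<phi>_faces cancel[OF i(1)] 2(3) D ..
      moreover have "{Inr i} \<in> whiskered K I c" unfolding whiskered_def using i(1) by blast
      ultimately show ?thesis using S_T[OF 2(1) i(1)] by blast
    next
      assume D: "D = {w s i}"
      have "G = \<phi> (s \<circ> b i) ` {Inl (c i), Inr i}" unfolding \<phi>_faces cancel[OF i(1)] 2(3) D w_def ..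
      moreover have "{Inl (c i), Inr i} \<in> whiskered K I c" unfolding whiskered_def using i(1) by blast
      ultimately show ?thesis using S_T[OF 2(1) i(1)] by blast
    qed
  qed
next
  fix G assume "G \<in> (\<Union>t\<in>T. (`) (\<phi> t) ` whiskered K I c)"
  then obtain t F where t: "t \<in> T" and F: "F \<in> whiskered K I c" "G = \<phi> t ` F" by blast
  have ti: "t \<circ> b i \<in> S" "t \<circ> b i \<circ> b i = t" if "i \<in> I" for i
    by (rule S_I[OF t that]) (rule comp_g_comp_g[OF letters(1)[OF that]])
  from F(1) show "G \<in> X1 - R1 - R2"
  proof (cases rule: whiskered_cases)
    case (base \<sigma>)
    note 1 = this
    obtain i where i: "i \<in> I" "\<sigma> \<subseteq> i" using facet_above[OF 1(1)] .
    let ?s = "t \<circ> b i" and ?D = "(\<lambda>j. t \<circ> a j) ` \<sigma>"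
    have G: "G = Tr ?D" unfolding F(2) 1(2) \<phi>_faces ..
    have D: "?D \<subseteq> block ?s i" unfolding block_def ti(2)[OF i(1)] using i(2) by blast
    then have DE: "?D \<subseteq> E ?s" using block_E[OF i(1)] by blast
    have "G \<notin> R1"
    proof
      assume "G \<in> R1"
      then obtain s' where s': "s' \<in> S" "?D \<subseteq> E s'" "spread s' ?D"
      proof -
        obtain s' D' where s': "s' \<in> S" "D' \<subseteq> E s'" "spread s' D'" "Tr ?D = Tr D' \<or> Tr ?D = Hb s' D'"
          using \<open>G \<in> R1\<close> unfolding R1_def G by (elim CollectE bexE exE conjE)
        then have "Tr ?D = Tr D'" using Tr_Hb(1)[of ?D s' D'] by metis
        then have "?D = D'" unfolding Tr_Hb(2) .
        then show ?thesis using that s'(1-3) by simp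
      qed
      have "?s = s'" using spread_unique[OF s'(1) ti(1)[OF i(1)] s'(2) DE s'(3)] .
      then show False using s'(3) D i(1) unfolding spread_def by blast
    qed
    moreover have "G \<notin> R2" unfolding G R2_def using Tr_Hb(1) by blast
    ultimately show ?thesis using X1_I(1)[OF ti(1)[OF i(1)] DE] unfolding G by blast
  next
    case (leaf i)
    note 2 = this
    have G: "G = Hb (t \<circ> b i) {}" unfolding F(2) 2(2) \<phi>_faces ..
    have "G \<notin> R1" unfolding G Hb_R1 using spread_nonempty by blast
    moreover have "G \<notin> R2" unfolding G R2_def Tr_Hb(3) by blast
    ultimately show ?thesis using X1_I(2)[OF ti(1)[OF 2(1)], of "{}"] unfolding G by blast
  next
    case (whisker i)
    note 3 = this
    let ?s = "t \<circ> b i"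
    have G: "G = Hb ?s {w ?s i}" unfolding F(2) 3(2) \<phi>_faces w_def ti(2)[OF 3(1)] ..
    have D: "{w ?s i} \<subseteq> block ?s i" using w_block[OF 3(1)] by blast
    have "G \<notin> R1" unfolding G Hb_R1 spread_def using D 3(1) by blast
    moreover have "G \<notin> R2"
    proof
      assume "G \<in> R2"
      then obtain s' k D' where k: "s' \<in> S" "k \<in> I" "D' \<subseteq> block s' k" "D' \<noteq> {w s' k}" "G = Hb s' D'"
        by (rule R2_E)
      then have "s' = ?s" "D' = {w ?s i}" unfolding G Tr_Hb(3) by blast+
      moreover from this have "k = i" using block_disjoint[OF ti(1)[OF 3(1)] k(2) 3(1), of "w ?s i"] k(3) D by blast
      ultimately show False using k(4) by blast
    qed
    moreover have "G \<in> X1" unfolding G using X1_I(2)[OF ti(1)[OF 3(1)]] D block_E[OF 3(1)] by blast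
    ultimately show ?thesis by blast
  qed
qed

lemma wedge_type_X0: "wedge_type K X0"
proof -
  let ?L = "whiskered K I c"
  have vL: "Inl v \<in> \<Union>?L" by (rule letters(3)[OF v])
  have "\<exists>n l r. 0 < n \<and> (\<Union>t\<in>orb P id. (`) (\<phi> t) ` ?L)
      \<sim> wedge_form ?L (Inl v) n l (r :: bool \<times> 'a word_map)"
    by (rule orbit_family_heq_wedge_form[OF simplicial_whiskered[OF K(1) c_vertices v]
          finite_whiskered[OF K(2) finite_I] edge_connected_whiskered[OF K(3) c_vertices v] vL refl _ _ permutes_id,
          where \<kappa> = isl]) (simp_all add: P_def \<phi>_def)
  then obtain n l and r :: "bool \<times> 'a word_map" where n: "0 < n"
    and e: "X1 - R1 - R2 \<sim> wedge_form ?L (Inl v) n l r" unfolding remaining_eq T_def by blast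
  have "X0 \<sim> wedge_form ?L (Inl v) n l r"
    using heq_trans[OF heq_sym[OF X1_heq_X0] heq_trans[OF X1_heq_R1 heq_trans[OF R2_heq e]]] .
  from heq_trans[OF this wedge_form_whiskered[OF K(1,2) v finite_I c_vertices]]
  show ?thesis by (rule wedge_typeI[OF _ n v K(1,2)])
qed

section \<open>Symmetries of the facet-transitive complex\<close>

lemma translation_automorphism:
  assumes h: "h \<in> T"
  shows "(\<lambda>x. if x \<in> \<Union>X0 then h \<circ> x else x) \<in> automorphisms X0"
    and "s \<in> S \<Longrightarrow> (\<lambda>x. if x \<in> \<Union>X0 then h \<circ> x else x) ` E s = E (h \<circ> s)"
proof -
  let ?\<sigma> = "\<lambda>x. if x \<in> \<Union>X0 then h \<circ> x else x"
  have \<sigma>: "?\<sigma> x = h \<circ> x" if "x \<in> \<Union>X0" for x using that by (simp only: if_True)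
  have hS: "h \<circ> s \<in> S" if s: "s \<in> S" for s
  proof -
    obtain t k where tk: "t \<in> T" "k \<in> I" "s = t \<circ> b k" using S_E[OF s] .
    show ?thesis unfolding tk(3) comp_assoc[symmetric] by (rule S_I[OF T_comp[OF h tk(1)] tk(2)])
  qed
  have sub: "E s \<subseteq> \<Union>X0" if "s \<in> S" for s using that unfolding X0_def by blast
  have hE: "(\<lambda>x. h \<circ> x) ` E s = E (h \<circ> s)" for s
  proof -
    have "(\<lambda>x. h \<circ> x) ` block s i = block (h \<circ> s) i" for i
    proof -
      have "block s i = (\<lambda>j. s \<circ> b i \<circ> a j) ` i" for s unfolding block_def by blast
      then show ?thesis by (simp only: image_image comp_assoc)
    qed
    then show ?thesis unfolding E_def image_UN by simp
  qed
  show \<sigma>E: "?\<sigma> ` E s = E (h \<circ> s)" if s: "s \<in> S" for s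
  proof -
    have "?\<sigma> ` E s = (\<lambda>x. h \<circ> x) ` E s" by (rule image_cong[OF refl \<sigma>]) (rule subsetD[OF sub[OF s]])
    then show ?thesis using hE by simp
  qed
  show "?\<sigma> \<in> automorphisms X0"
  proof (rule automorphismI[OF simplicial_X0 finite_X0])
    show "inj_on ?\<sigma> (\<Union>X0)"
    proof (rule inj_onI)
      fix x y assume "x \<in> \<Union>X0" "y \<in> \<Union>X0" "?\<sigma> x = ?\<sigma> y"
      then have "h \<circ> x = h \<circ> y" by (simp only: if_True)
      then show "x = y" by (rule permutes_left_cancel[OF T_permutes[OF h]])
    qed
    show "?\<sigma> ` F \<in> X0" if F: "F \<in> X0" for F
    proof -
      obtain s where s: "s \<in> S" "F \<subseteq> E s" using F unfolding X0_def by blast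
      have "?\<sigma> ` F \<subseteq> E (h \<circ> s)" using image_mono[OF s(2), of ?\<sigma>] \<sigma>E[OF s(1)] by simp
      then show ?thesis using hS[OF s(1)] unfolding X0_def by blast
    qed
  qed (simp only: if_False)
qed

lemma vertex_transitive_X0: "vertex_transitive X0"
  unfolding vertex_transitive_def vertices_def
proof (intro ballI)
  have form: "\<exists>t\<in>T. \<exists>p. Inl p \<in> \<Lambda> \<and> x = t \<circ> a p" if x: "x \<in> \<Union>X0" for x
  proof -
    obtain s where s: "s \<in> S" "x \<in> E s" using x unfolding X0_def by blast
    then obtain i j where ij: "i \<in> I" "j \<in> i" "x = s \<circ> b i \<circ> a j" using E_E by blast
    show ?thesis using S_T[OF s(1) ij(1)] letters(2)[OF ij(1,2)] ij(3) by blast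
  qed
  fix u z assume uz: "u \<in> \<Union>X0" "z \<in> \<Union>X0"
  obtain t p where t: "t \<in> T" "Inl p \<in> \<Lambda>" "u = t \<circ> a p" using form[OF uz(1)] by blast
  obtain t' q where t': "t' \<in> T" "Inl q \<in> \<Lambda>" "z = t' \<circ> a q" using form[OF uz(2)] by blast
  obtain y where y: "y \<in> T" "y \<circ> t = id" using T_inverse[OF t(1)] by blast
  \<comment> \<open>\<open>z\<close> times the inverse of \<open>u\<close>; it lies in
    \<open>T\<close> because its two vertex letters form an admissible pair.\<close>
  define h where "h = t' \<circ> a q \<circ> a p \<circ> y"
  have "h \<in> T" unfolding h_def by (intro T_comp[OF T_step[OF t'(1,2) t(2)] y(1)]) simp
  moreover have "h \<circ> u = z"
  proof -
    have "h \<circ> u = t' \<circ> a q \<circ> a p \<circ> (y \<circ> t) \<circ> a p" unfolding h_def t(3) by (simp only: comp_assoc)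
    also have "\<dots> = z" unfolding y(2) t'(3) comp_id by (rule comp_g_comp_g[OF t(2)])
    finally show ?thesis .
  qed
  ultimately have "h \<in> T" "(if u \<in> \<Union>X0 then h \<circ> u else u) = z" using uz(1) by (simp_all only: if_True)
  then show "\<exists>\<sigma>\<in>automorphisms X0. \<sigma> u = z"
    by (intro bexI[OF _ translation_automorphism(1)[of h]])
qed

lemma facet_transitive_X0: "facet_transitive X0"
  unfolding facet_transitive_def
proof (intro ballI)
  \<comment> \<open>Every face is contained in some \<open>E s\<close>, which is a face as well, so
    a facet has to be all of it.\<close>
  have form: "\<exists>s\<in>S. F = E s" if F: "F \<in> facets X0" for F
  proof -
    obtain s where s: "s \<in> S" "F \<subseteq> E s" using F unfolding facets_def X0_def by blast
    then have "E s \<in> X0" unfolding X0_def by blast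
    then show ?thesis using F s unfolding facets_def by blast
  qed
  fix F G assume "F \<in> facets X0" "G \<in> facets X0"
  then obtain s s' where s: "s \<in> S" "F = E s" and s': "s' \<in> S" "G = E s'" using form by meson
  obtain t k where t: "t \<in> T" "k \<in> I" "s = t \<circ> b k" using S_E[OF s(1)] .
  obtain t' k' where t': "t' \<in> T" "k' \<in> I" "s' = t' \<circ> b k'" using S_E[OF s'(1)] .
  obtain y where y: "y \<in> T" "y \<circ> t = id" using T_inverse[OF t(1)] by blast
  \<comment> \<open>\<open>s'\<close> times the inverse of \<open>s\<close>; its two facet letters
    form an admissible pair, so it lies in \<open>T\<close>.\<close>
  define h where "h = t' \<circ> b k' \<circ> b k \<circ> y"
  have hT: "h \<in> T"
    unfolding h_def by (intro T_comp[OF T_step[OF t'(1) letters(1)[OF t'(2)] letters(1)[OF t(2)]] y(1)]) simp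
  have "h \<circ> s = s'"
  proof -
    have "h \<circ> s = t' \<circ> b k' \<circ> b k \<circ> (y \<circ> t) \<circ> b k" unfolding h_def t(3) by (simp only: comp_assoc)
    also have "\<dots> = s'" unfolding y(2) t'(3) comp_id by (rule comp_g_comp_g[OF letters(1)[OF t(2)]])
    finally show ?thesis .
  qed
  then have "(\<lambda>x. if x \<in> \<Union>X0 then h \<circ> x else x) ` F = G"
    using translation_automorphism(2)[OF hT s(1)] unfolding s(2) s'(2) by (simp only:)
  then show "\<exists>\<sigma>\<in>automorphisms X0. \<sigma> ` F = G"
    by (rule bexI[OF _ translation_automorphism(1)[OF hT]])
qed

end

lemma facet_construction:
  fixes K :: "'a set set"
  assumes K: "simplicial_complex K" "finite K" "edge_connected K" and v: "v \<in> \<Union>K"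
  shows "\<exists>X :: nat set set. finite_simplicial_complex X \<and> vertex_transitive X \<and> wedge_type K X
    \<and> facet_transitive X"
proof -
  define c where "c i = (SOME x. x \<in> i)" for i :: "'a set"
  have c: "c i \<in> i" if "i \<in> facets K" for i
  proof -
    have "i \<noteq> {}"
    proof
      assume "i = {}"
      then have "\<forall>G\<in>K. G = {}" using that unfolding facets_def by blast
      then show False using v by blast
    qed
    then show ?thesis unfolding c_def some_in_eq .
  qed
  interpret facet_words K c v
  proof
    have "finite (whiskered K (facets K) c)"
      using K(2) by (intro finite_whiskered) (auto simp: facets_def)
    moreover have "simplicial_complex (whiskered K (facets K) c)"
    proof (rule simplicial_whiskered[OF K(1) _ v])
      show "c ` facets K \<subseteq> \<Union>K" using c unfolding facets_def by blast
    qed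
    ultimately show "finite (\<Union>(whiskered K (facets K) c))"
      using simplicial_complex_finite by blast
  qed (use K v c in blast)+
  have "finite (\<Union>X0)" using finite_X0 simplicial_complex_finite[OF simplicial_X0] by blast
  then obtain \<iota> :: "'a word_map \<Rightarrow> nat" where \<iota>: "inj_on \<iota> (\<Union>X0)"
    by (rule finite_injection_nat)
  have "finite_simplicial_complex ((`) \<iota> ` X0)"
    unfolding finite_simplicial_complex_def using simplicial_complex_image[OF simplicial_X0] finite_X0 by blast
  moreover have "vertex_transitive ((`) \<iota> ` X0)"
    by (rule vertex_transitive_image[OF \<iota> simplicial_X0 finite_X0 vertex_transitive_X0])
  moreover have "facet_transitive ((`) \<iota> ` X0)"
    by (rule facet_transitive_image[OF \<iota> simplicial_X0 finite_X0 facet_transitive_X0])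
  moreover have "wedge_type K ((`) \<iota> ` X0)"
    by (rule wedge_type_heq[OF heq_image[OF simplicial_X0 \<iota>] wedge_type_X0])
  ultimately show ?thesis by blast
qed

theorem theorem1p1:
  fixes K :: "'a set set"
  assumes "finite_simplicial_complex K" and "connected_complex K"
  shows "(\<exists>X :: nat set set. finite_simplicial_complex X \<and> vertex_transitive X \<and>
            (\<exists>n l v. n \<ge> 1 \<and> v \<in> vertices K \<and>
               realization_top X homotopy_equivalent_space realization_top (wedge_complex K v n l)))
       \<and> (\<exists>X :: nat set set. finite_simplicial_complex X \<and> vertex_transitive X \<and>
            (\<exists>n l v. n \<ge> 1 \<and> v \<in> vertices K \<and>
               realization_top X homotopy_equivalent_space realization_top (wedge_complex K v n l))
            \<and> cyclic_vertex_transitive X)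
       \<and> (\<exists>X :: nat set set. finite_simplicial_complex X \<and> vertex_transitive X \<and>
            (\<exists>n l v. n \<ge> 1 \<and> v \<in> vertices K \<and>
               realization_top X homotopy_equivalent_space realization_top (wedge_complex K v n l))
            \<and> is_cayley_clique_complex X)
       \<and> (\<exists>X :: nat set set. finite_simplicial_complex X \<and> vertex_transitive X \<and>
            (\<exists>n l v. n \<ge> 1 \<and> v \<in> vertices K \<and>
               realization_top X homotopy_equivalent_space realization_top (wedge_complex K v n l))
            \<and> facet_transitive X)"
proof -
  have K: "simplicial_complex K" "finite K" using assms(1) by (simp_all add: finite_simplicial_complex_def)
  note con = connected_complex_imp_edge_connected[OF assms]
  obtain v where v: "v \<in> \<Union>K" using assms(2) by (auto simp: connected_complex_def vertices_def)
  \<comment> \<open>The statement without an additional condition follows from any of the three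
    constructions.\<close>
  show ?thesis
    unfolding wedge_type_def[symmetric]
    using cyclic_construction[OF K con v] cayley_construction[OF K con v] facet_construction[OF K con v]
    by blast
qed

end
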